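(* Let $H$ be a BLS-hole with canonical ordering $L_1(H),N_2(H),L_2(H),\dots,N_k(H),L_k(H),R(H)$. For $i\in\{2,\dots,k\}$ let $Q_i$ be the upper vertex of $N_i(H)$, let $QN_i$ be the first intersection of the boundary of $H$ with the ray $\{(x(Q_i),p_2):p_2>y(Q_i)\}$, and let $QN_i^*$ be the upper vertex of $e$ if $QN_i$ is the lower vertex of a (clockwise) downward edge $e$ of $H$, and $QN_i^*=QN_i$ otherwise. After adding the segments $\mathrm{seg}(Q_i,QN_i)$ for all $i\in\{2,\dots,k\}$, the following hold: (1) $H$ is partitioned into $k$ nice holes $S_1,\dots,S_k$; (2) each leftmost edge $L_i(H)$ is contained in exactly one of these nice holes, and each of these nice holes contains exactly one leftmost edge of $H$; (3) for each nice hole $S'$ of the partition, its rightmost edge is $R(S')=R(H)$ if its leftmost edge is $L(S')=L_1(H)$, and $R(S')=\{QN_i^*,Q_i\}$ if $L(S')=L_i(H)$ with $i\in\{2,\dots,k\}$; (4) $\sum_{i=1}^k nv(S_i)=O(nv(H))$.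
   Context: A hole is a set $H=J\cup I$ where $J$ is a closed rectilinear arc (a closed Jordan curve that is a finite union of axis-parallel segments) and $I$ its bounded inner region; $nv(H)$ is its number of vertices. Edges are the maximal straight segments of $J$, vertices the points where two edges meet. Clockwise traversal of $J$ labels edges leftward/rightward/upward/downward by traversal direction. For a vertical edge $e$ whose two adjacent horizontal edges both extend to the left of $e$: $e$ is a rightmost edge if the interior of $H$ near $e$ lies to its left, a left notch if to its right. For a vertical edge whose two adjacent horizontal edges both extend to the right: it is a leftmost edge if the interior lies to its right, a right notch if to its left. A horizontal edge whose two adjacent vertical edges extend above it is a top notch if the interior near it lies below it. A falling corner is a vertex whose clockwise-preceding edge is downward and clockwise-succeeding edge rightward. A BLS-hole is a hole with no right notch, no top notch and at most one falling corner; a nice hole is a BLS-hole with no left notch. A BLS-hole has a unique rightmost edge $R(H)$; its canonical ordering lists, starting after $R(H)$ in clockwise order, its leftmost edges $L_1(H),\dots,L_k(H)$ and left notches $N_2(H),\dots,N_k(H)$ in clockwise order, which alternate as $L_1,N_2,L_2,\dots,N_k,L_k$ before returning to $R(H)$. The pieces of the partition are the closures of the connected components of the interior of $H$ minus the added segments. *)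

theory Defs
  imports "HOL-Complex_Analysis.Complex_Analysis"
begin

text \<open>The plane is \<^typ>\<open>complex\<close>: the point \<open>p\<close> has coordinates \<open>x(p) = Re p\<close>, \<open>y(p) = Im p\<close>.\<close>

definition axis_parallel_segment :: "complex set \<Rightarrow> bool" where
  "axis_parallel_segment s \<longleftrightarrow>
     (\<exists>a b. s = closed_segment a b \<and> (Re a = Re b \<or> Im a = Im b))"

definition closed_rectilinear_arc :: "complex set \<Rightarrow> bool" where
  "closed_rectilinear_arc J \<longleftrightarrow>
     (\<exists>g. simple_path g \<and> pathfinish g = pathstart g \<and> path_image g = J) \<and>
     (\<exists>F. finite F \<and> (\<forall>s\<in>F. axis_parallel_segment s) \<and> \<Union>F = J)"

definition hole :: "complex set \<Rightarrow> bool" where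
  "hole H \<longleftrightarrow> (\<exists>J. closed_rectilinear_arc J \<and> H = J \<union> inside J)"

text \<open>The arc \<open>J\<close> and its inner region are recovered from the set \<open>H = J \<union> I\<close> as
  \<^term>\<open>frontier H\<close> and \<^term>\<open>interior H\<close>.\<close>

lemma
  assumes "closed_rectilinear_arc J"
  shows frontier_hole: "frontier (J \<union> inside J) = J"
    and interior_hole: "interior (J \<union> inside J) = inside J"
proof -
  obtain g where g: "simple_path g" "pathfinish g = pathstart g" "path_image g = J"
    using assms unfolding closed_rectilinear_arc_def by blast
  have J: "frontier (inside J) = J" "frontier (outside J) = J" "open (inside J)" "open (outside J)"
    using Jordan_inside_outside[OF g(1,2)] g(3) by auto
  have eq: "J \<union> inside J = - outside J"
    using union_with_inside[of J] by simp
  show fr: "frontier (J \<union> inside J) = J"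
    using J(2) by (simp add: eq frontier_complement)
  have "inside J \<inter> J = {}"
    by (rule inside_no_overlap)
  moreover have "interior (J \<union> inside J) = (J \<union> inside J) - frontier (J \<union> inside J)"
    using interior_subset closure_subset by (auto simp: frontier_def)
  ultimately show "interior (J \<union> inside J) = inside J"
    unfolding fr by blast
qed

definition edges :: "complex set \<Rightarrow> complex set set" where
  "edges H = {e. (\<exists>a b. a \<noteq> b \<and> e = closed_segment a b) \<and> e \<subseteq> frontier H \<and>
      (\<forall>a b. e \<subseteq> closed_segment a b \<and> closed_segment a b \<subseteq> frontier H \<longrightarrow> closed_segment a b = e)}"

definition vertices :: "complex set \<Rightarrow> complex set" where
  "vertices H = {p. \<exists>e\<in>edges H. \<exists>e'\<in>edges H. e \<noteq> e' \<and> p \<in> e \<and> p \<in> e'}"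

definition nv :: "complex set \<Rightarrow> nat" where
  "nv H = card (vertices H)"

definition adjacent :: "complex set \<Rightarrow> complex set \<Rightarrow> complex set \<Rightarrow> bool" where
  "adjacent H e e' \<longleftrightarrow> e \<in> edges H \<and> e' \<in> edges H \<and> e \<noteq> e' \<and> e \<inter> e' \<noteq> {}"

definition vertical :: "complex set \<Rightarrow> bool" where
  "vertical e \<longleftrightarrow> (\<forall>p\<in>e. \<forall>q\<in>e. Re p = Re q)"

definition horizontal :: "complex set \<Rightarrow> bool" where
  "horizontal e \<longleftrightarrow> (\<forall>p\<in>e. \<forall>q\<in>e. Im p = Im q)"

text \<open>In the next two definitions the side of an edge is given by a unit vector \<open>d\<close>:
  \<open>1\<close> is right, \<open>-1\<close> left, \<open>\<i>\<close> above, \<open>-\<i>\<close> below.\<close>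

definition neighbours_extend :: "complex set \<Rightarrow> complex set \<Rightarrow> complex \<Rightarrow> bool" where
  "neighbours_extend H e d \<longleftrightarrow> (\<forall>e'. adjacent H e e' \<longrightarrow> (\<forall>p\<in>e. \<forall>q\<in>e'. 0 \<le> (q - p) \<bullet> d))"

definition interior_near :: "complex set \<Rightarrow> complex set \<Rightarrow> complex \<Rightarrow> bool" where
  "interior_near H e d \<longleftrightarrow>
     (\<forall>p\<in>rel_interior e. \<forall>\<^sub>F t in at_right (0::real). p + of_real t * d \<in> interior H)"

definition rightmost_edge :: "complex set \<Rightarrow> complex set \<Rightarrow> bool" where
  "rightmost_edge H e \<longleftrightarrow>
     e \<in> edges H \<and> vertical e \<and> neighbours_extend H e (- 1) \<and> interior_near H e (- 1)"

definition left_notch :: "complex set \<Rightarrow> complex set \<Rightarrow> bool" where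
  "left_notch H e \<longleftrightarrow>
     e \<in> edges H \<and> vertical e \<and> neighbours_extend H e (- 1) \<and> interior_near H e 1"

definition leftmost_edge :: "complex set \<Rightarrow> complex set \<Rightarrow> bool" where
  "leftmost_edge H e \<longleftrightarrow>
     e \<in> edges H \<and> vertical e \<and> neighbours_extend H e 1 \<and> interior_near H e 1"

definition right_notch :: "complex set \<Rightarrow> complex set \<Rightarrow> bool" where
  "right_notch H e \<longleftrightarrow>
     e \<in> edges H \<and> vertical e \<and> neighbours_extend H e 1 \<and> interior_near H e (- 1)"

definition top_notch :: "complex set \<Rightarrow> complex set \<Rightarrow> bool" where
  "top_notch H e \<longleftrightarrow>
     e \<in> edges H \<and> horizontal e \<and> neighbours_extend H e \<i> \<and> interior_near H e (- \<i>)"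

definition clockwise_traversal :: "complex set \<Rightarrow> (real \<Rightarrow> complex) \<Rightarrow> bool" where
  "clockwise_traversal H g \<longleftrightarrow>
     simple_path g \<and> pathfinish g = pathstart g \<and> path_image g = frontier H \<and>
     (\<forall>z\<in>interior H. winding_number g z = - 1)"

text \<open>\<open>clockwise_edge H a b\<close>: the segment from \<open>a\<close> to \<open>b\<close> is an edge of \<open>H\<close> that a clockwise
  traversal runs through from \<open>a\<close> to \<open>b\<close>.\<close>

definition clockwise_edge :: "complex set \<Rightarrow> complex \<Rightarrow> complex \<Rightarrow> bool" where
  "clockwise_edge H a b \<longleftrightarrow> closed_segment a b \<in> edges H \<and>
     (\<exists>g s t. clockwise_traversal H g \<and> 0 \<le> s \<and> s < t \<and> t \<le> 1 \<and>
        g s = a \<and> g t = b \<and> g ` {s..t} = closed_segment a b)"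

definition downward_edge :: "complex set \<Rightarrow> complex \<Rightarrow> complex \<Rightarrow> bool" where
  "downward_edge H a b \<longleftrightarrow> clockwise_edge H a b \<and> Re a = Re b \<and> Im b < Im a"

definition rightward_edge :: "complex set \<Rightarrow> complex \<Rightarrow> complex \<Rightarrow> bool" where
  "rightward_edge H a b \<longleftrightarrow> clockwise_edge H a b \<and> Im a = Im b \<and> Re a < Re b"

definition falling_corner :: "complex set \<Rightarrow> complex \<Rightarrow> bool" where
  "falling_corner H p \<longleftrightarrow>
     p \<in> vertices H \<and> (\<exists>a. downward_edge H a p) \<and> (\<exists>b. rightward_edge H p b)"

definition BLS_hole :: "complex set \<Rightarrow> bool" where
  "BLS_hole H \<longleftrightarrow> hole H \<and> (\<nexists>e. right_notch H e) \<and> (\<nexists>e. top_notch H e) \<and>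
     (\<exists>\<^sub>\<le>\<^sub>1p. falling_corner H p)"

definition nice_hole :: "complex set \<Rightarrow> bool" where
  "nice_hole H \<longleftrightarrow> BLS_hole H \<and> (\<nexists>e. left_notch H e)"

text \<open>\<open>R(H)\<close> of a BLS-hole, and \<open>L(S)\<close> of a nice hole.\<close>

definition rightmost :: "complex set \<Rightarrow> complex set" where
  "rightmost H = (THE e. rightmost_edge H e)"

definition leftmost :: "complex set \<Rightarrow> complex set" where
  "leftmost S = (THE e. leftmost_edge S e)"

text \<open>The vertices in clockwise order; the list is determined up to rotation.\<close>

definition clockwise_vertices :: "complex set \<Rightarrow> complex list \<Rightarrow> bool" where
  "clockwise_vertices H vs \<longleftrightarrow> distinct vs \<and> set vs = vertices H \<and>
     (\<forall>i<length vs. clockwise_edge H (vs ! i) (vs ! (Suc i mod length vs)))"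

definition edge_list :: "complex list \<Rightarrow> complex set list" where
  "edge_list vs =
     map (\<lambda>i. closed_segment (vs ! i) (vs ! (Suc i mod length vs))) [0..<length vs]"

text \<open>\<open>L 1, N 2, L 2, \<dots>, N k, L k\<close> are all the leftmost edges \<open>L i\<close> and all the left notches \<open>N i\<close>
  of \<open>H\<close>, in the order of a clockwise traversal whose last edge is \<open>R(H)\<close>.\<close>

definition canonical_ordering ::
  "complex set \<Rightarrow> nat \<Rightarrow> (nat \<Rightarrow> complex set) \<Rightarrow> (nat \<Rightarrow> complex set) \<Rightarrow> bool" where
  "canonical_ordering H k L N \<longleftrightarrow> 1 \<le> k \<and>
     (\<forall>i\<in>{1..k}. leftmost_edge H (L i)) \<and> (\<forall>i\<in>{2..k}. left_notch H (N i)) \<and>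
     (\<exists>vs. clockwise_vertices H vs \<and> vs \<noteq> [] \<and> last (edge_list vs) = rightmost H \<and>
        filter (\<lambda>e. leftmost_edge H e \<or> left_notch H e) (edge_list vs) =
          L 1 # concat (map (\<lambda>i. [N i, L i]) [2..<Suc k]))"

definition upper_vertex :: "complex set \<Rightarrow> complex" where
  "upper_vertex e = (THE p. p \<in> e \<and> (\<forall>q\<in>e. Im q \<le> Im p))"

text \<open>With \<open>Q = Q\<^sub>i\<close>, the points \<open>QN\<^sub>i\<close> and \<open>QN\<^sub>i\<^sup>*\<close>.\<close>

definition first_above :: "complex set \<Rightarrow> complex \<Rightarrow> complex" where
  "first_above H Q = (THE p. p \<in> frontier H \<and> Re p = Re Q \<and> Im Q < Im p \<and>
     (\<forall>p'\<in>frontier H. Re p' = Re Q \<and> Im Q < Im p' \<longrightarrow> Im p \<le> Im p'))"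

definition first_above_star :: "complex set \<Rightarrow> complex \<Rightarrow> complex" where
  "first_above_star H Q =
     (if \<exists>a. downward_edge H a (first_above H Q)
      then THE a. downward_edge H a (first_above H Q)
      else first_above H Q)"

definition pieces :: "complex set \<Rightarrow> complex set set \<Rightarrow> complex set set" where
  "pieces H segs = closure ` components (interior H - \<Union>segs)"

end

theory Submission
  imports Defs
begin

text \<open>
  Near any point \<open>p\<close> a hole is a union of open quadrants at \<open>p\<close>, so edges, vertices, notches, extreme
  edges and falling corners can all be read off the \<^emph>\<open>pattern\<close> of quadrants lying in the interior.
  The segments added at the left notches are pairwise disjoint crosscuts, hence by the theta-curve
  theorem \<open>k - 1\<close> of them produce \<open>k\<close> Jordan domains. A piece has the pattern of \<open>H\<close> at every boundary
  point off the cuts, and only few patterns on them; this excludes notches and new falling corners.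
  Every piece has a rightmost edge (take its points of maximal abscissa), which is \<open>R(H)\<close> or lies
  immediately to the left of a cut; by counting, this labels the pieces bijectively. The boundary of
  \<open>H\<close> runs from \<open>R(H)\<close> to \<open>L\<^sub>1\<close>, and from \<open>N\<^sub>i\<close> to \<open>L\<^sub>i\<close>, without rightward edges, so it meets no cut in
  between: this identifies the leftmost edge of each piece.
\<close>

section \<open>Rectilinear Jordan curves\<close>

text \<open>The obstacle is that a piece is known only as a Jordan domain whose boundary lies in the
  boundary of \<open>H\<close> together with the cuts; neither its vertices nor a clockwise
  traversal of it are at hand. Quadrant patterns need no parametrisation and can be compared between
  \<open>H\<close> and a piece at a single point. For the same reason rectilinearity is encoded by a
  local condition that passes to subsets. Clockwise orientation enters through one fact, that the
  interior lies to the right of a clockwise edge, which is a jump of the winding number. A list of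
  vertices in clockwise order is used for \<open>H\<close> only.

  Degenerate positions are allowed: several notches may lie on one vertical line, so that a single
  edge of a piece runs through several notches and cuts. The uniqueness of \<open>R(H)\<close> has
  to be derived as well; it follows from the canonical ordering by summing the changes of direction
  around the boundary.\<close>

definition Jordan :: "complex set \<Rightarrow> bool" where
  "Jordan J \<longleftrightarrow> (\<exists>g. simple_path g \<and> pathfinish g = pathstart g \<and> path_image g = J)"

text \<open>Rectilinearity as a local condition at every point of the plane. Unlike a decomposition
  into finitely many segments it is inherited by subsets, and the boundary of a piece is at first
  known only as a subset of the boundary of \<open>H\<close> and the cuts.\<close>

definition cross_like :: "complex set \<Rightarrow> bool" where
  "cross_like T \<longleftrightarrow> (\<forall>p. \<exists>r>0. \<forall>z\<in>T. dist p z < r \<longrightarrow> Re z = Re p \<or> Im z = Im p)"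

text \<open>The axis directions as complex units: \<open>\<i> * d\<close> is a quarter turn to the
  left of \<open>d\<close>, so one argument serves all four directions.\<close>

definition dirs :: "complex set" where
  "dirs = {1, -1, \<i>, -\<i>}"

lemma dirs_simps [simp]: "1 \<in> dirs" "-1 \<in> dirs" "\<i> \<in> dirs" "-\<i> \<in> dirs"
  by (auto simp: dirs_def)

lemma dirs_rotate [simp]:
  assumes "d \<in> dirs" shows "-d \<in> dirs" "\<i> * d \<in> dirs" "-(\<i> * d) \<in> dirs"
  using assms by (auto simp: dirs_def)

lemma dirs_cases:
  assumes "d \<in> dirs"
  obtains "d = 1" | "d = -1" | "d = \<i>" | "d = -\<i>"
  using assms by (auto simp: dirs_def)

lemma norm_dirs: "d \<in> dirs \<Longrightarrow> norm d = 1"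
  by (auto simp: dirs_def)

lemma cross_like_mono: "cross_like T \<Longrightarrow> S \<subseteq> T \<Longrightarrow> cross_like S"
  unfolding cross_like_def by (meson subsetD)

lemma cross_like_Un:
  assumes "cross_like S" "cross_like T" shows "cross_like (S \<union> T)"
  unfolding cross_like_def
proof
  fix p
  obtain r where r: "r > 0" "\<forall>z\<in>S. dist p z < r \<longrightarrow> Re z = Re p \<or> Im z = Im p"
    using assms(1) unfolding cross_like_def by blast
  obtain r' where r': "r' > 0" "\<forall>z\<in>T. dist p z < r' \<longrightarrow> Re z = Re p \<or> Im z = Im p"
    using assms(2) unfolding cross_like_def by blast
  show "\<exists>r>0. \<forall>z\<in>S \<union> T. dist p z < r \<longrightarrow> Re z = Re p \<or> Im z = Im p"
    using r r' by (intro exI[of _ "min r r'"]) auto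
qed

lemma cross_like_Union:
  assumes "finite F" "\<forall>s\<in>F. cross_like s" shows "cross_like (\<Union>F)"
  using assms
proof (induction F)
  case empty
  then show ?case by (auto simp: cross_like_def intro: exI[of _ 1])
qed (simp add: cross_like_Un)

text \<open>The condition is imposed at points off the segment too; there a ball that misses the
  closed segment makes it vacuous.\<close>

lemma cross_like_segment:
  assumes "Re a = Re b \<or> Im a = Im b" shows "cross_like (closed_segment a b)"
  unfolding cross_like_def
proof
  fix p
  have *: "Re z = Re w \<or> Im z = Im w" if zw: "z \<in> closed_segment a b" "w \<in> closed_segment a b" for z w
  proof -
    obtain u v where uv: "z = (1 - u) *\<^sub>R a + u *\<^sub>R b" "w = (1 - v) *\<^sub>R a + v *\<^sub>R b"
      using zw unfolding closed_segment_def by blast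
    show ?thesis using assms by (auto simp: uv algebra_simps)
  qed
  show "\<exists>r>0. \<forall>z\<in>closed_segment a b. dist p z < r \<longrightarrow> Re z = Re p \<or> Im z = Im p"
  proof (cases "p \<in> closed_segment a b")
    case True
    then show ?thesis using * by (intro exI[of _ 1]) auto
  next
    case False
    then obtain r where "r > 0" "\<forall>z\<in>closed_segment a b. r \<le> dist p z"
      using separate_point_closed[OF closed_segment] by blast
    then show ?thesis by (intro exI[of _ r]) auto
  qed
qed

lemma closed_rectilinear_arc_imp:
  assumes "closed_rectilinear_arc J" shows "Jordan J" "cross_like J"
proof -
  obtain F where "finite F" "\<forall>s\<in>F. axis_parallel_segment s" "\<Union>F = J"
    using assms unfolding closed_rectilinear_arc_def by blast
  then show "cross_like J"
    using cross_like_Union[of F] cross_like_segment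
    unfolding axis_parallel_segment_def by (metis (no_types, lifting))
qed (use assms in \<open>auto simp: closed_rectilinear_arc_def Jordan_def\<close>)

text \<open>Moving the base point of the loop puts \<open>p\<close> at parameter 1/2, so that the
  curve enters and leaves \<open>p\<close> away from the ends of the parameter interval, where
  injectivity fails.\<close>

lemma Jordan_through_half:
  assumes "Jordan J" "p \<in> J"
  obtains g where "simple_path g" "pathfinish g = pathstart g" "path_image g = J" "g (1/2) = p"
proof -
  obtain g where g: "simple_path g" "pathfinish g = pathstart g" "path_image g = J"
    using assms(1) unfolding Jordan_def by blast
  obtain t where t: "t \<in> {0..1}" "g t = p"
    using assms(2) g(3) by (auto simp: path_image_def)
  define a where "a = (if t \<ge> 1/2 then t - 1/2 else t + 1/2)"
  have a: "a \<in> {0..1}" using t by (auto simp: a_def)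
  have half: "shiftpath a g (1/2) = p"
    using t g(2) by (auto simp: shiftpath_def a_def pathfinish_def pathstart_def)
  show ?thesis
  proof (rule that[of "shiftpath a g"])
    show "simple_path (shiftpath a g)" using simple_path_shiftpath g a by auto
    show "pathfinish (shiftpath a g) = pathstart (shiftpath a g)"
      using closed_shiftpath[OF g(2)] a by auto
    show "path_image (shiftpath a g) = J" using path_image_shiftpath[OF a g(2)] g(3) by simp
  qed (rule half)
qed

section \<open>Local shape of a rectilinear Jordan curve at a point\<close>

text \<open>The open right-angled sector around the ray from \<open>p\<close> in direction
  \<open>d\<close>; multiplication by \<open>cnj d\<close> turns \<open>d\<close> to 1. The four
  sectors are disjoint and cover the axis cross without its centre, so a connected part of that set
  stays on one arm.\<close>

definition wedge :: "complex \<Rightarrow> complex \<Rightarrow> complex set" where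
  "wedge p d = {z. \<bar>Im ((z - p) * cnj d)\<bar> < Re ((z - p) * cnj d)}"

lemma open_wedge: "open (wedge p d)"
  unfolding wedge_def by (intro open_Collect_less continuous_intros)

lemma wedge_disjoint: "d \<in> dirs \<Longrightarrow> d' \<in> dirs \<Longrightarrow> d \<noteq> d' \<Longrightarrow> wedge p d \<inter> wedge p d' = {}"
  by (auto simp: dirs_def wedge_def abs_less_iff)

lemma cross_in_wedge:
  assumes "Re z = Re p \<or> Im z = Im p" "z \<noteq> p"
  shows "\<exists>d\<in>dirs. z \<in> wedge p d"
proof -
  have "Re z > Re p \<or> Re z < Re p \<or> Im z > Im p \<or> Im z < Im p"
    using assms(2) complex_eqI by force
  then show ?thesis
    using assms(1) by (auto simp: dirs_def wedge_def)
qed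

lemma cross_wedge_ray:
  assumes "Re z = Re p \<or> Im z = Im p" "z \<in> wedge p d" "d \<in> dirs"
  shows "\<exists>t>0. z = p + of_real t * d"
  using assms(3)
proof (cases rule: dirs_cases)
  case 1
  then show ?thesis using assms by (intro exI[of _ "Re z - Re p"]) (auto simp: wedge_def complex_eq_iff)
next
  case 2
  then show ?thesis using assms by (intro exI[of _ "Re p - Re z"]) (auto simp: wedge_def complex_eq_iff)
next
  case 3
  then show ?thesis using assms by (intro exI[of _ "Im z - Im p"]) (auto simp: wedge_def complex_eq_iff)
next
  case 4
  then show ?thesis using assms by (intro exI[of _ "Im p - Im z"]) (auto simp: wedge_def complex_eq_iff)
qed

lemma connected_in_wedge:
  assumes "connected A" "A \<subseteq> (\<Union>d\<in>dirs. wedge p d)" "z \<in> A" "z \<in> wedge p d" "d \<in> dirs"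
  shows "A \<subseteq> wedge p d"
proof -
  let ?V = "\<Union>d'\<in>dirs - {d}. wedge p d'"
  have "open ?V" using open_wedge by blast
  moreover have "wedge p d \<inter> ?V = {}" using wedge_disjoint assms(5) by blast
  moreover have "A \<subseteq> wedge p d \<union> ?V" using assms(2) by blast
  ultimately have "wedge p d \<inter> A = {} \<or> ?V \<inter> A = {}"
    using connectedD[OF assms(1) open_wedge[of p d] \<open>open ?V\<close>] by blast
  then show ?thesis using assms by blast
qed

text \<open>Injectivity keeps the curve away from \<open>p\<close> after time 0, so the rest of its
  image is a connected part of the cross without centre and stays on one arm. The intermediate value
  theorem then fills an initial piece of that arm.\<close>

lemma injective_curve_leaves_along_ray:
  fixes h :: "real \<Rightarrow> complex"
  assumes "continuous_on {0..\<delta>} h" "inj_on h {0..\<delta>}" "h 0 = p" "0 < \<delta>"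
    and cross: "\<forall>t\<in>{0..\<delta>}. Re (h t) = Re p \<or> Im (h t) = Im p"
  obtains d t1 where "d \<in> dirs" "0 < t1"
    "\<forall>z\<in>h ` {0<..\<delta>}. \<exists>t>0. z = p + of_real t * d"
    "\<forall>t\<in>{0<..t1}. p + of_real t * d \<in> h ` {0<..\<delta>}"
proof -
  have ne: "h t \<noteq> p" if "t \<in> {0<..\<delta>}" for t
    using assms(2,3) that assms(4) by (metis atLeastAtMost_iff greaterThanAtMost_iff inj_onD less_eq_real_def less_irrefl)
  have conn: "connected (h ` {0<..\<delta>})"
    by (intro connected_continuous_image continuous_on_subset[OF assms(1)]) auto
  have sub: "h ` {0<..\<delta>} \<subseteq> (\<Union>d\<in>dirs. wedge p d)"
    using cross_in_wedge cross ne by force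
  have h\<delta>: "h \<delta> \<in> h ` {0<..\<delta>}" using assms(4) by auto
  then obtain d where d: "d \<in> dirs" "h \<delta> \<in> wedge p d" using sub by blast
  have inw: "h ` {0<..\<delta>} \<subseteq> wedge p d"
    using connected_in_wedge[OF conn sub h\<delta> d(2,1)] .
  have ray: "\<exists>t>0. z = p + of_real t * d" if "z \<in> h ` {0<..\<delta>}" for z
    using cross_wedge_ray[OF _ _ d(1), of z p] that inw cross by force
  obtain t1 where t1: "t1 > 0" "h \<delta> = p + of_real t1 * d" using ray[OF h\<delta>] by blast
  have "p + of_real t * d \<in> h ` {0<..\<delta>}" if t: "t \<in> {0<..t1}" for t
  proof -
    \<comment> \<open>The coordinate along the ray, which grows from 0 at time 0 to
      \<open>t1\<close> at time \<open>\<delta>\<close>.\<close>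
    let ?f = "\<lambda>x. Re ((h x - p) * cnj d)"
    have f: "?f x = s" if "h x = p + of_real s * d" for x s
      using that d(1) by (auto simp: dirs_def)
    have "\<exists>x. 0 \<le> x \<and> x \<le> \<delta> \<and> ?f x = t"
    proof (rule IVT')
      show "?f 0 \<le> t" using t assms(3) by simp
      show "t \<le> ?f \<delta>" using t f[OF t1(2)] by simp
      show "continuous_on {0..\<delta>} ?f" using assms(1) by (intro continuous_intros)
    qed (use assms in auto)
    then obtain x where x: "0 \<le> x" "x \<le> \<delta>" "?f x = t" by blast
    have "x \<noteq> 0" using x(3) t assms(3) by auto
    then have "x \<in> {0<..\<delta>}" using x by auto
    moreover from ray[of "h x"] this obtain s where "h x = p + of_real s * d" by blast
    ultimately show ?thesis using f x(3) by (metis image_eqI)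
  qed
  then show ?thesis using that d(1) t1(1) ray by blast
qed

text \<open>Each half of the curve at \<open>p\<close> leaves along one axis direction, and the
  remaining part of the curve keeps a positive distance from \<open>p\<close>, so a small ball
  contains nothing but two rays.\<close>

lemma two_rays:
  assumes "Jordan J" "cross_like J" "p \<in> J"
  obtains r d1 d2 where "r > 0" "d1 \<in> dirs" "d2 \<in> dirs" "d1 \<noteq> d2"
    "\<And>z. dist p z < r \<Longrightarrow>
       z \<in> J \<longleftrightarrow> z = p \<or> (\<exists>t>0. z = p + of_real t * d1) \<or> (\<exists>t>0. z = p + of_real t * d2)"
proof -
  obtain g where g: "simple_path g" "pathfinish g = pathstart g" "path_image g = J" "g (1/2) = p"
    using Jordan_through_half assms by blast
  have cont: "continuous_on {0..1} g" using g(1) by (simp add: simple_path_def path_def)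
  have lf: "x = y" if "g x = g y" "x \<in> {0..1}" "y \<in> {0<..<1}" for x y
    using g(1) that unfolding simple_path_def loop_free_def by (metis greaterThanLessThan_iff less_irrefl atLeastAtMost_iff less_imp_le)
  obtain r0 where r0: "r0 > 0" "\<forall>z\<in>J. dist p z < r0 \<longrightarrow> Re z = Re p \<or> Im z = Im p"
    using assms(2) unfolding cross_like_def by blast
  obtain \<delta>0 where \<delta>0: "\<delta>0 > 0" "\<forall>t\<in>{0..1}. dist t (1/2) < \<delta>0 \<longrightarrow> dist (g t) (g (1/2)) < r0"
    using cont[unfolded continuous_on_iff, rule_format, of "1/2" r0] r0(1) by auto
  define \<delta> where "\<delta> = min (\<delta>0/2) (1/4)"
  have \<delta>: "0 < \<delta>" "\<delta> < \<delta>0" "\<delta> \<le> 1/4" using \<delta>0 by (auto simp: \<delta>_def)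
  have J: "g t \<in> J" if "t \<in> {0..1}" for t using that g(3) by (auto simp: path_image_def)
  have cross: "Re (g t) = Re p \<or> Im (g t) = Im p" if "t \<in> {1/2-\<delta>..1/2+\<delta>}" for t
  proof -
    have "t \<in> {0..1}" "dist t (1/2) < \<delta>0" using that \<delta> by (auto simp: dist_real_def abs_less_iff)
    then show ?thesis using \<delta>0(2) r0(2) J g(4) by (metis dist_commute)
  qed
  have c1: "continuous_on {0..\<delta>} (\<lambda>t. g (1/2 + t))" "continuous_on {0..\<delta>} (\<lambda>t. g (1/2 - t))"
    by (rule continuous_on_compose2[OF cont]; use \<delta> in \<open>auto intro!: continuous_intros\<close>)+
  have i1: "inj_on (\<lambda>t. g (1/2 + t)) {0..\<delta>}"
  proof (rule inj_onI)
    fix x y assume "x \<in> {0..\<delta>}" "y \<in> {0..\<delta>}" "g (1/2 + x) = g (1/2 + y)"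
    then show "x = y" using lf[of "1/2 + x" "1/2 + y"] \<delta> by auto
  qed
  have i2: "inj_on (\<lambda>t. g (1/2 - t)) {0..\<delta>}"
  proof (rule inj_onI)
    fix x y assume "x \<in> {0..\<delta>}" "y \<in> {0..\<delta>}" "g (1/2 - x) = g (1/2 - y)"
    then show "x = y" using lf[of "1/2 - x" "1/2 - y"] \<delta> by auto
  qed
  have h0: "g (1/2 + 0) = p" "g (1/2 - 0) = p" using g(4) by simp_all
  have x1: "\<forall>t\<in>{0..\<delta>}. Re (g (1/2 + t)) = Re p \<or> Im (g (1/2 + t)) = Im p"
    and x2: "\<forall>t\<in>{0..\<delta>}. Re (g (1/2 - t)) = Re p \<or> Im (g (1/2 - t)) = Im p"
    using cross by simp_all
  obtain d1 t1 where d1: "d1 \<in> dirs" "0 < t1"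
    "\<forall>z\<in>(\<lambda>t. g (1/2 + t)) ` {0<..\<delta>}. \<exists>t>0. z = p + of_real t * d1"
    "\<forall>t\<in>{0<..t1}. p + of_real t * d1 \<in> (\<lambda>t. g (1/2 + t)) ` {0<..\<delta>}"
    by (rule injective_curve_leaves_along_ray[OF c1(1) i1 h0(1) \<delta>(1) x1])
  obtain d2 t2 where d2: "d2 \<in> dirs" "0 < t2"
    "\<forall>z\<in>(\<lambda>t. g (1/2 - t)) ` {0<..\<delta>}. \<exists>t>0. z = p + of_real t * d2"
    "\<forall>t\<in>{0<..t2}. p + of_real t * d2 \<in> (\<lambda>t. g (1/2 - t)) ` {0<..\<delta>}"
    by (rule injective_curve_leaves_along_ray[OF c1(2) i2 h0(2) \<delta>(1) x2])
  have ne: "d1 \<noteq> d2"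
  proof
    assume "d1 = d2"
    \<comment> \<open>Two halves leaving along the same ray would share the point at distance
      \<open>t\<close>, against injectivity.\<close>
    define t where "t = min t1 t2"
    have t: "t \<in> {0<..t1}" "t \<in> {0<..t2}" using d1 d2 by (auto simp: t_def)
    obtain u where u: "u \<in> {0<..\<delta>}" "p + of_real t * d1 = g (1/2 + u)" using d1(4) t by blast
    obtain v where v: "v \<in> {0<..\<delta>}" "p + of_real t * d1 = g (1/2 - v)" using d2(4) t \<open>d1 = d2\<close> by blast
    have "1/2 + u = 1/2 - v" using lf[of "1/2+u" "1/2-v"] u v \<delta> by auto
    then show False using u v by auto
  qed
  \<comment> \<open>The curve outside the parameter window around 1/2: a closed set missing
    \<open>p\<close>, whose distance from \<open>p\<close> bounds the radius.\<close>
  define R where "R = g ` ({0..1/2-\<delta>} \<union> {1/2+\<delta>..1})"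
  have "continuous_on ({0..1/2-\<delta>} \<union> {1/2+\<delta>..1}) g"
    using cont by (rule continuous_on_subset) (use \<delta> in auto)
  then have "closed R" unfolding R_def
    by (intro compact_imp_closed compact_continuous_image compact_Un) auto
  moreover have "p \<notin> R" 
  proof
    assume "p \<in> R"
    then obtain x where x: "x \<in> {0..1/2-\<delta>} \<union> {1/2+\<delta>..1}" "p = g x" unfolding R_def by blast
    then have "x = 1/2" using lf[of x "1/2"] g(4) \<delta> by auto
    then show False using x \<delta> by auto
  qed
  ultimately obtain r1 where r1: "r1 > 0" "\<forall>z\<in>R. r1 \<le> dist p z"
    using separate_point_closed by metis
  define r where "r = min r1 (min t1 t2)"
  show thesis
  proof (rule that[of r d1 d2])
    show "r > 0" using r1 d1 d2 by (auto simp: r_def)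
    fix z assume z: "dist p z < r"
    show "z \<in> J \<longleftrightarrow> z = p \<or> (\<exists>t>0. z = p + of_real t * d1) \<or> (\<exists>t>0. z = p + of_real t * d2)" (is "?l \<longleftrightarrow> ?r")
    proof
      assume ?l
      then obtain t where t: "t \<in> {0..1}" "z = g t" using g(3) by (auto simp: path_image_def)
      have "z \<notin> R" using z r1 by (auto simp: r_def)
      then have tt: "1/2 - \<delta> < t" "t < 1/2 + \<delta>" using t by (auto simp: R_def)
      consider "t = 1/2" | "t > 1/2" | "t < 1/2" by linarith
      then show ?r
      proof cases
        case 1
        then show ?thesis using t(2) g(4) by metis
      next
        case 2
        then have "z \<in> (\<lambda>t. g (1/2 + t)) ` {0<..\<delta>}" using t tt by (intro image_eqI[of _ _ "t - 1/2"]) auto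
        then show ?thesis using d1(3) by blast
      next
        case 3
        then have "z \<in> (\<lambda>t. g (1/2 - t)) ` {0<..\<delta>}" using t tt by (intro image_eqI[of _ _ "1/2 - t"]) auto
        then show ?thesis using d2(3) by blast
      qed
    next
      assume ?r
      then consider "z = p" | t where "t > 0" "z = p + of_real t * d1" | t where "t > 0" "z = p + of_real t * d2"
        by blast
      then show ?l
      proof cases
        case (2 t)
        then have "t < r" using z norm_dirs[OF d1(1)] by (simp add: dist_norm norm_mult)
        then have "t \<in> {0<..t1}" using 2 by (auto simp: r_def)
        then have "z \<in> (\<lambda>t. g (1/2 + t)) ` {0<..\<delta>}" using d1(4) 2 by blast
        then show ?thesis using J \<delta> by auto
      next
        case (3 t)
        then have "t < r" using z norm_dirs[OF d2(1)] by (simp add: dist_norm norm_mult)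
        then have "t \<in> {0<..t2}" using 3 by (auto simp: r_def)
        then have "z \<in> (\<lambda>t. g (1/2 - t)) ` {0<..\<delta>}" using d2(4) 3 by blast
        then show ?thesis using J \<delta> by auto
      qed (use assms in simp)
    qed
  qed (use d1 d2 ne in auto)
qed

lemma axis_parallel_ray_segment:
  "d \<in> dirs \<Longrightarrow> axis_parallel_segment (closed_segment p (p + of_real t * d))"
  unfolding axis_parallel_segment_def
  by (intro exI[of _ p] exI[of _ "p + of_real t * d"]) (auto simp: dirs_def)

lemma in_ray_segment:
  assumes "d \<in> dirs" "0 \<le> l"
  shows "z \<in> closed_segment p (p + of_real l * d) \<longleftrightarrow> (\<exists>t. 0 \<le> t \<and> t \<le> l \<and> z = p + of_real t * d)"
proof
  assume "z \<in> closed_segment p (p + of_real l * d)"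
  then obtain u where u: "0 \<le> u" "u \<le> 1" "z = (1 - u) *\<^sub>R p + u *\<^sub>R (p + of_real l * d)"
    unfolding closed_segment_def by blast
  have "z = p + of_real (u * l) * d" unfolding u(3) by (simp add: scaleR_conv_of_real algebra_simps)
  moreover have "0 \<le> u * l" "u * l \<le> l" using u assms by (auto simp: mult_left_le_one_le)
  ultimately show "\<exists>t. 0 \<le> t \<and> t \<le> l \<and> z = p + of_real t * d" by blast
next
  assume "\<exists>t. 0 \<le> t \<and> t \<le> l \<and> z = p + of_real t * d"
  then obtain t where t: "0 \<le> t" "t \<le> l" "z = p + of_real t * d" by blast
  show "z \<in> closed_segment p (p + of_real l * d)"
  proof (cases "l = 0")
    case False
    then have "z = (1 - t/l) *\<^sub>R p + (t/l) *\<^sub>R (p + of_real l * d)"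
      by (simp add: t(3) scaleR_conv_of_real algebra_simps)
    moreover have "0 \<le> t/l" "t/l \<le> 1" using t False assms by auto
    ultimately show ?thesis unfolding closed_segment_def by blast
  qed (use t in auto)
qed

text \<open>The finitely many segments come from compactness: near each of its points the curve is
  covered by two short segments of its own, and finitely many such neighbourhoods suffice. This is
  what makes the boundaries of the pieces closed rectilinear arcs.\<close>

lemma closed_rectilinear_arc_iff: "closed_rectilinear_arc J \<longleftrightarrow> Jordan J \<and> cross_like J"
proof
  assume J: "Jordan J \<and> cross_like J"
  have "\<exists>r F. r > 0 \<and> finite F \<and> (\<forall>s\<in>F. axis_parallel_segment s) \<and> J \<inter> ball p r \<subseteq> \<Union>F \<and> \<Union>F \<subseteq> J"
    if pJ: "p \<in> J" for p
  proof -
    obtain r d1 d2 where r: "r > 0" and d: "d1 \<in> dirs" "d2 \<in> dirs" "d1 \<noteq> d2"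
      and *: "\<And>z. dist p z < r \<Longrightarrow>
        z \<in> J \<longleftrightarrow> z = p \<or> (\<exists>t>0. z = p + of_real t * d1) \<or> (\<exists>t>0. z = p + of_real t * d2)"
      by (rule two_rays[OF conjunct1[OF J] conjunct2[OF J] pJ]) blast
    have dist: "dist p (p + of_real t * e) = \<bar>t\<bar>" if "e \<in> dirs" for t e
      using norm_dirs[OF that] by (simp add: dist_norm norm_mult)
    let ?F = "{closed_segment p (p + of_real (r/2) * d1), closed_segment p (p + of_real (r/2) * d2)}"
    have "J \<inter> ball p (r/2) \<subseteq> \<Union>?F"
    proof
      fix z assume z: "z \<in> J \<inter> ball p (r/2)"
      then have "dist p z < r" "dist p z < r/2" using r by auto
      with z *[of z] consider "z = p" | t where "t > 0" "z = p + of_real t * d1"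
        | t where "t > 0" "z = p + of_real t * d2" by blast
      then show "z \<in> \<Union>?F"
      proof cases
        case (2 t)
        then have "t \<le> r/2" using dist[OF d(1), of t] z by auto
        then have "z \<in> closed_segment p (p + of_real (r/2) * d1)"
          using in_ray_segment[OF d(1), of "r/2" z p] 2 r by force
        then show ?thesis by blast
      next
        case (3 t)
        then have "t \<le> r/2" using dist[OF d(2), of t] z by auto
        then have "z \<in> closed_segment p (p + of_real (r/2) * d2)"
          using in_ray_segment[OF d(2), of "r/2" z p] 3 r by force
        then show ?thesis by blast
      qed auto
    qed
    moreover have "closed_segment p (p + of_real (r/2) * e) \<subseteq> J" if "e \<in> {d1,d2}" for e
    proof
      fix z assume z: "z \<in> closed_segment p (p + of_real (r/2) * e)"
      have e: "e \<in> dirs" using that d by auto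
      obtain t where t: "0 \<le> t" "t \<le> r/2" "z = p + of_real t * e"
        using z in_ray_segment[OF e, of "r/2" z p] r by auto
      have "dist p z < r" using t dist[OF e] r by auto
      moreover have "z = p \<or> t > 0" using t by auto
      ultimately show "z \<in> J" using *[of z] t(3) that by blast
    qed
    then have "\<Union>?F \<subseteq> J" by blast
    moreover have "\<forall>s\<in>?F. axis_parallel_segment s"
      using axis_parallel_ray_segment d by blast
    ultimately show ?thesis
      using r by (intro exI[of _ "r/2"] exI[of _ ?F] conjI) auto
  qed
  then have "\<forall>p\<in>J. \<exists>rF. fst rF > 0 \<and> finite (snd rF) \<and> (\<forall>s\<in>snd rF. axis_parallel_segment s) \<and>
      J \<inter> ball p (fst rF) \<subseteq> \<Union>(snd rF) \<and> \<Union>(snd rF) \<subseteq> J" by simp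
  from bchoice[OF this] obtain rF where rF: "\<forall>p\<in>J. fst (rF p) > 0 \<and> finite (snd (rF p)) \<and>
      (\<forall>s\<in>snd (rF p). axis_parallel_segment s) \<and>
      J \<inter> ball p (fst (rF p)) \<subseteq> \<Union>(snd (rF p)) \<and> \<Union>(snd (rF p)) \<subseteq> J" by blast
  define r where "r = (\<lambda>p. fst (rF p))"
  define F where "F = (\<lambda>p. snd (rF p))"
  have rF: "r p > 0" "finite (F p)" "\<forall>s\<in>F p. axis_parallel_segment s"
      "J \<inter> ball p (r p) \<subseteq> \<Union>(F p)" "\<Union>(F p) \<subseteq> J" if "p \<in> J" for p
    using rF that by (auto simp: r_def F_def)
  have "compact J" using J compact_simple_path_image unfolding Jordan_def by blast
  moreover have "J \<subseteq> (\<Union>p\<in>J. ball p (r p))" 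
  proof
    fix p assume p: "p \<in> J"
    then have "p \<in> ball p (r p)" using rF(1) by simp
    then show "p \<in> (\<Union>p\<in>J. ball p (r p))" using p by blast
  qed
  ultimately obtain D where D: "D \<subseteq> J" "finite D" "J \<subseteq> (\<Union>p\<in>D. ball p (r p))"
    using compactE_image[of J J "\<lambda>p. ball p (r p)"] by (metis open_ball)
  have "\<Union>(\<Union>p\<in>D. F p) = J"
  proof
    show "J \<subseteq> \<Union>(\<Union>p\<in>D. F p)"
    proof
      fix z assume z: "z \<in> J"
      then obtain p where p: "p \<in> D" "z \<in> ball p (r p)" using D(3) by blast
      then have "z \<in> \<Union>(F p)" using z subsetD[OF rF(4)[OF subsetD[OF D(1) p(1)]], of z] by blast
      then show "z \<in> \<Union>(\<Union>p\<in>D. F p)" using p(1) by blast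
    qed
    show "\<Union>(\<Union>p\<in>D. F p) \<subseteq> J" 
    proof
      fix z assume "z \<in> \<Union>(\<Union>p\<in>D. F p)"
      then obtain p where p: "p \<in> D" "z \<in> \<Union>(F p)" by blast
      show "z \<in> J" using subsetD[OF rF(5)[OF subsetD[OF D(1) p(1)]] p(2)] .
    qed
  qed
  moreover have "finite (\<Union>p\<in>D. F p)" "\<forall>s\<in>(\<Union>p\<in>D. F p). axis_parallel_segment s"
    using D(2) rF(2)[OF subsetD[OF D(1)]] rF(3)[OF subsetD[OF D(1)]] by auto
  ultimately show "closed_rectilinear_arc J"
    using J unfolding closed_rectilinear_arc_def Jordan_def by blast
qed (use closed_rectilinear_arc_imp in blast)

section \<open>Crosscuts of a Jordan domain\<close>

lemma Jordan_regions:
  assumes "Jordan J"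
  shows "compact J" "inside J \<noteq> {}" "open (inside J)" "connected (inside J)" "open (outside J)"
    "connected (outside J)" "bounded (inside J)" "frontier (inside J) = J" "frontier (outside J) = J"
    "inside J \<inter> outside J = {}" "inside J \<union> outside J = - J" "closure (inside J) = J \<union> inside J"
proof -
  obtain g where g: "simple_path g" "pathfinish g = pathstart g" "path_image g = J"
    using assms unfolding Jordan_def by blast
  note * = Jordan_inside_outside[OF g(1,2), unfolded g(3)]
  show "compact J" using g by (metis compact_simple_path_image)
  show fr: "frontier (inside J) = J" using * by auto
  show "inside J \<noteq> {}" "open (inside J)" "connected (inside J)" "open (outside J)"
    "connected (outside J)" "bounded (inside J)" "frontier (outside J) = J"
    "inside J \<inter> outside J = {}" "inside J \<union> outside J = - J"
    using * by auto
  show "closure (inside J) = J \<union> inside J"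
    using fr closure_Un_frontier[of "inside J"] by blast
qed

text \<open>A connected subset of the union lies in one of the two sets, so maximality in the union
  and maximality in that set agree.\<close>

lemma components_disjoint_open_Un:
  fixes U V :: "'a::real_normed_vector set"
  assumes "open U" "open V" "U \<inter> V = {}"
  shows "components (U \<union> V) = components U \<union> components V"
proof -
  have *: "C \<in> components (U \<union> V) \<longleftrightarrow> C \<in> components U"
    if uv: "open U" "open V" "U \<inter> V = {}" "C \<subseteq> U" for U V C :: "'a set"
  proof
    assume C: "C \<in> components (U \<union> V)"
    note C' = in_components_nonempty[OF C] in_components_connected[OF C]
    have "d = C" if d: "d \<noteq> {} \<and> C \<subseteq> d \<and> d \<subseteq> U \<and> connected d" for d
    proof -
      have "C \<inter> d \<noteq> {}" "d \<subseteq> U \<union> V" using C'(1) d by auto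
      then show ?thesis using components_maximal[OF C, of d] d by auto
    qed
    then show "C \<in> components U" unfolding in_components_maximal using C' uv(4) by simp
  next
    assume C: "C \<in> components U"
    note C' = in_components_nonempty[OF C] in_components_connected[OF C]
    have "c = C" if c: "c \<noteq> {} \<and> C \<subseteq> c \<and> c \<subseteq> U \<union> V \<and> connected c" for c
    proof -
      have c': "connected c" "c \<subseteq> U \<union> V" using c by auto
      have "U \<inter> c = {} \<or> V \<inter> c = {}"
        using connectedD[OF c'(1) uv(1,2)] c'(2) uv(3) by auto
      moreover have "U \<inter> c \<noteq> {}" using C'(1) c uv(4) by auto
      ultimately have "c \<subseteq> U" using c'(2) by auto
      moreover have "C \<inter> c \<noteq> {}" using C'(1) c by auto
      ultimately show ?thesis using components_maximal[OF C c'(1)] c by auto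
    qed
    then show "C \<in> components (U \<union> V)" unfolding in_components_maximal using C' uv(4) by auto
  qed
  have cases: "C \<subseteq> U \<or> C \<subseteq> V" if C: "C \<in> components (U \<union> V)" for C
  proof -
    have "U \<inter> C = {} \<or> V \<inter> C = {}"
      using connectedD[OF in_components_connected[OF C] assms(1,2)] in_components_subset[OF C] assms(3)
      by auto
    then show ?thesis using in_components_subset[OF C] by auto
  qed
  have U: "C \<in> components (U \<union> V) \<longleftrightarrow> C \<in> components U" if "C \<subseteq> U" for C
    using *[OF assms that] .
  have V: "C \<in> components (U \<union> V) \<longleftrightarrow> C \<in> components V" if "C \<subseteq> V" for C
    using *[OF assms(2,1) _ that] assms(3) by (simp add: Un_commute Int_commute)
  show ?thesis
  proof (rule set_eqI)
    fix C
    show "C \<in> components (U \<union> V) \<longleftrightarrow> C \<in> components U \<union> components V"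
      using cases[of C] U[of C] V[of C] in_components_subset[of C U] in_components_subset[of C V]
      by (metis UnE UnI1 UnI2)
  qed
qed

definition crosscut :: "complex set \<Rightarrow> complex set \<Rightarrow> bool" where
  "crosscut J c \<longleftrightarrow> (\<exists>p q. p \<noteq> q \<and> c = closed_segment p q \<and> p \<in> J \<and> q \<in> J \<and> open_segment p q \<subseteq> inside J)"

text \<open>The theta-curve theorem: the ends of \<open>c\<close> divide \<open>J\<close> into two
  arcs, each of which closes up with \<open>c\<close> to a Jordan curve.\<close>

lemma Jordan_split:
  assumes "Jordan J" "crosscut J c"
  obtains J1 J2 where "Jordan J1" "Jordan J2" "J1 \<union> J2 = J \<union> c"
    "inside J1 \<inter> inside J2 = {}" "inside J - c = inside J1 \<union> inside J2" "c \<subseteq> J1" "c \<subseteq> J2"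
proof -
  obtain g where g: "simple_path g" "pathfinish g = pathstart g" "path_image g = J"
    using assms unfolding Jordan_def by blast
  obtain a b where ab: "a \<noteq> b" "c = closed_segment a b" "a \<in> J" "b \<in> J" "open_segment a b \<subseteq> inside J"
    using assms(2) unfolding crosscut_def by blast
  obtain u d where ud: "arc u" "arc d" "pathstart u = a" "pathfinish u = b"
    "pathstart d = b" "pathfinish d = a" "path_image u \<inter> path_image d = {a,b}" "path_image u \<union> path_image d = J"
    using exists_double_arc[OF g(1,2)] ab g(3) by metis
  define c2 where "c2 = reversepath d"
  define e where "e = linepath a b"
  have c2: "arc c2" "pathstart c2 = a" "pathfinish c2 = b" "path_image c2 = path_image d"
    using ud by (auto simp: c2_def arc_reversepath)
  have e: "arc e" "pathstart e = a" "pathfinish e = b" "path_image e = c"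
    using ab by (auto simp: e_def arc_linepath)
  have op: "c - {a,b} \<subseteq> inside J" "a \<in> c" "b \<in> c"
    using ab(5) by (auto simp: open_segment_def ab(2))
  have nJ: "inside J \<inter> J = {}" by (rule inside_no_overlap)
  have cJ: "c \<inter> J = {a,b}" using op nJ ab(3,4) by blast
  have ue: "path_image u \<inter> path_image e = {a,b}"
    unfolding e(4) using cJ ud(7,8) by blast
  have c2e: "path_image c2 \<inter> path_image e = {a,b}"
    unfolding e(4) c2(4) using cJ ud(7,8) by blast
  have uc2: "path_image u \<inter> path_image c2 = {a,b}" using ud c2 by simp
  have ne: "path_image e \<inter> inside (path_image u \<union> path_image c2) \<noteq> {}"
    unfolding e(4) c2(4) ud(8) using ab(1,2,5) open_segment_eq_empty[of a b]
    by (metis Int_greatest open_closed_segment subsetI subset_empty)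
  obtain split: "inside (path_image u \<union> path_image e) \<inter> inside (path_image c2 \<union> path_image e) = {}"
    "inside (path_image u \<union> path_image e) \<union> inside (path_image c2 \<union> path_image e) \<union> (path_image e - {a,b})
      = inside (path_image u \<union> path_image c2)"
    using split_inside_simple_closed_curve[of u a b c2 e] ud c2 e ue c2e uc2 ne ab(1)
    by (metis arc_imp_simple_path)
  have J: "Jordan (path_image x \<union> path_image e)"
    if x: "arc x" "pathstart x = a" "pathfinish x = b" "path_image x \<inter> path_image e = {a,b}" for x
    unfolding Jordan_def
  proof (intro exI conjI)
    show "simple_path (x +++ reversepath e)"
      using x e by (intro simple_path_join_loop) (auto simp: arc_reversepath)
    show "pathfinish (x +++ reversepath e) = pathstart (x +++ reversepath e)" using x e by simp
    show "path_image (x +++ reversepath e) = path_image x \<union> path_image e"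
      using x e by (simp add: path_image_join)
  qed
  show thesis
  proof (rule that[of "path_image u \<union> c" "path_image d \<union> c"])
    show "Jordan (path_image u \<union> c)" using J[of u] ud ue e by simp
    show "Jordan (path_image d \<union> c)" using J[of c2] c2 c2e e by simp
    show "path_image u \<union> c \<union> (path_image d \<union> c) = J \<union> c" using ud by blast
    show "inside (path_image u \<union> c) \<inter> inside (path_image d \<union> c) = {}" using split c2 e by simp
    have "inside (path_image u \<union> c) \<inter> c = {}" "inside (path_image d \<union> c) \<inter> c = {}"
      using inside_no_overlap by blast+
    then show "inside J - c = inside (path_image u \<union> c) \<union> inside (path_image d \<union> c)"
      using split(2) cJ nJ ab(3,4) unfolding e(4) c2(4) ud(8) by blast
  qed auto
qed

text \<open>Induction on the number of crosscuts. Splitting along one of them, \<open>c\<close>,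
  leaves two Jordan domains, and every other crosscut, being disjoint from \<open>c\<close>, lies on
  one side and is a crosscut there. The counts add up as (1 + |C1|) + (1 + |C2|) = 1 + |C|.\<close>

lemma components_minus_crosscuts:
  assumes "finite C" "Jordan J" "\<forall>c\<in>C. crosscut J c" "pairwise disjnt C"
  shows "finite (components (inside J - \<Union>C)) \<and> card (components (inside J - \<Union>C)) = Suc (card C) \<and>
    (\<forall>K\<in>components (inside J - \<Union>C). \<exists>J'. Jordan J' \<and> J' \<subseteq> J \<union> \<Union>C \<and> K = inside J')"
  using assms
proof (induction "card C" arbitrary: C J rule: less_induct)
  case less
  show ?case
  proof (cases "C = {}")
    case True
    have "components (inside J) = {inside J}"
      using Jordan_regions[OF less.prems(2)] by (simp add: components_eq_sing_iff)
    then show ?thesis using True less.prems(2) by auto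
  next
    case False
    then obtain c where c: "c \<in> C" by blast
    obtain J1 J2 where J12: "Jordan J1" "Jordan J2" "J1 \<union> J2 = J \<union> c"
      "inside J1 \<inter> inside J2 = {}" "inside J - c = inside J1 \<union> inside J2" "c \<subseteq> J1" "c \<subseteq> J2"
      using Jordan_split less.prems c by metis
    note R1 = Jordan_regions[OF J12(1)] and R2 = Jordan_regions[OF J12(2)]
    have disj: "c' \<inter> c = {}" if "c' \<in> C - {c}" for c'
      using less.prems(4) that c unfolding pairwise_def disjnt_def by blast
    \<comment> \<open>The open segment is connected and covered by two disjoint open sets, so once
      it meets \<open>inside J'\<close> it lies there; its ends belong to the closure and hence to
      \<open>J'\<close>.\<close>
    have cut: "crosscut J' c'"
      if J': "Jordan J'" "inside J' \<subseteq> inside J" and c': "crosscut J c'" "c' \<inter> inside J' \<noteq> {}"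
        "c' - J \<subseteq> inside J' \<union> V" "open V" "V \<inter> inside J' = {}" for J' V c'
    proof -
      obtain p q where pq: "p \<noteq> q" "c' = closed_segment p q" "p \<in> J" "q \<in> J" "open_segment p q \<subseteq> inside J"
        using c'(1) unfolding crosscut_def by blast
      note R' = Jordan_regions[OF J'(1)]
      have op: "open_segment p q = c' - {p,q}" using pq by (simp add: open_segment_def)
      have nJ: "inside J \<inter> J = {}" using inside_no_overlap by blast
      have "inside J' \<inter> open_segment p q \<noteq> {}"
        using c'(2) pq(3,4) nJ J'(2) op by blast
      moreover have "open_segment p q \<subseteq> inside J' \<union> V"
        using c'(3) pq(5) nJ op by blast
      ultimately have "open_segment p q \<subseteq> inside J'"
        using connectedD[OF convex_connected[OF convex_open_segment] R'(3) c'(4), of p q] c'(5) by blast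
      moreover have "closure (open_segment p q) = closed_segment p q"
        using pq(1) by simp
      ultimately have "closed_segment p q \<subseteq> J' \<union> inside J'"
        using R'(12) closure_mono by metis
      then have "p \<in> J'" "q \<in> J'" using pq(3,4) nJ J'(2) ends_in_segment[of p q] by blast+
      then show ?thesis using pq \<open>open_segment p q \<subseteq> inside J'\<close> unfolding crosscut_def by blast
    qed
    define C1 where "C1 = {c' \<in> C - {c}. c' \<inter> inside J1 \<noteq> {}}"
    define C2 where "C2 = {c' \<in> C - {c}. c' \<inter> inside J2 \<noteq> {}}"
    have sub: "inside J1 \<subseteq> inside J" "inside J2 \<subseteq> inside J" using J12(5) by auto
    have inj: "c' - J \<subseteq> inside J1 \<union> inside J2" "c' \<inter> (inside J1 \<union> inside J2) \<noteq> {}"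
      if c': "c' \<in> C - {c}" for c'
    proof -
      obtain p q where pq: "p \<noteq> q" "c' = closed_segment p q" "p \<in> J" "q \<in> J" "open_segment p q \<subseteq> inside J"
        using less.prems(3) c' unfolding crosscut_def by blast
      have op: "open_segment p q = c' - {p,q}" using pq by (simp add: open_segment_def)
      have "c' - J \<subseteq> inside J" using pq op by blast
      then show "c' - J \<subseteq> inside J1 \<union> inside J2" using disj[OF c'] J12(5) by blast
      have "open_segment p q \<subseteq> c' \<inter> (inside J1 \<union> inside J2)"
        using pq(5) op disj[OF c'] J12(5) by blast
      then show "c' \<inter> (inside J1 \<union> inside J2) \<noteq> {}"
        using pq(1) open_segment_eq_empty[of p q] by blast
    qed
    have C1: "crosscut J1 c' \<and> c' \<inter> inside J2 = {}" if "c' \<in> C1" for c'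
    proof -
      have *: "crosscut J1 c'"
        using cut[OF J12(1) sub(1), of c' "inside J2"] less.prems(3) that inj(1)[of c'] R2(3) J12(4)
        unfolding C1_def by (auto simp: Int_commute)
      then obtain p q where "c' = closed_segment p q" "p \<in> J1" "q \<in> J1" "open_segment p q \<subseteq> inside J1"
        unfolding crosscut_def by blast
      then have "c' \<subseteq> J1 \<union> inside J1" unfolding open_segment_def by blast
      \<comment> \<open>A boundary point of one domain is a limit of its inner points and cannot lie
        in an open set disjoint from it.\<close>
      moreover have "J1 \<inter> inside J2 = {}"
      proof -
        have "J1 \<subseteq> closure (inside J1)" using R1(12) by blast
        moreover have "closure (inside J1) \<inter> inside J2 = {}"
          using J12(4) R2(3) open_Int_closure_eq_empty by blast
        ultimately show ?thesis by blast
      qed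
      ultimately show ?thesis using * J12(4) by blast
    qed
    have C2: "crosscut J2 c' \<and> c' \<inter> inside J1 = {}" if "c' \<in> C2" for c'
    proof -
      have *: "crosscut J2 c'"
        using cut[OF J12(2) sub(2), of c' "inside J1"] less.prems(3) that inj(1)[of c'] R1(3) J12(4)
        unfolding C2_def by (auto simp: Un_commute)
      then obtain p q where "c' = closed_segment p q" "p \<in> J2" "q \<in> J2" "open_segment p q \<subseteq> inside J2"
        unfolding crosscut_def by blast
      then have "c' \<subseteq> J2 \<union> inside J2" unfolding open_segment_def by blast
      moreover have "J2 \<inter> inside J1 = {}"
      proof -
        have "J2 \<subseteq> closure (inside J2)" using R2(12) by blast
        moreover have "closure (inside J2) \<inter> inside J1 = {}"
          using J12(4) R1(3) open_Int_closure_eq_empty[of "inside J1" "inside J2"] by blast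
        ultimately show ?thesis by blast
      qed
      ultimately show ?thesis using * J12(4) by blast
    qed
    have Cun: "C = insert c (C1 \<union> C2)" using inj(2) c unfolding C1_def C2_def by blast
    have C12: "C1 \<inter> C2 = {}" using C1 unfolding C2_def by blast
    have notin: "c \<notin> C1 \<union> C2" unfolding C1_def C2_def by blast
    have fin: "finite C1" "finite C2" using less.prems(1) unfolding C1_def C2_def by auto
    have card: "card C = Suc (card C1 + card C2)"
      using Cun C12 notin fin by (simp add: card_Un_disjoint)
    have pw: "pairwise disjnt C1" "pairwise disjnt C2"
      using less.prems(4) by (rule pairwise_subset; auto simp: C1_def C2_def)+
    have IH1: "finite (components (inside J1 - \<Union>C1)) \<and> card (components (inside J1 - \<Union>C1)) = Suc (card C1) \<and>
      (\<forall>K\<in>components (inside J1 - \<Union>C1). \<exists>J'. Jordan J' \<and> J' \<subseteq> J1 \<union> \<Union>C1 \<and> K = inside J')"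
      using less.hyps[OF _ fin(1) J12(1) _ pw(1)] C1 card by simp
    have IH2: "finite (components (inside J2 - \<Union>C2)) \<and> card (components (inside J2 - \<Union>C2)) = Suc (card C2) \<and>
      (\<forall>K\<in>components (inside J2 - \<Union>C2). \<exists>J'. Jordan J' \<and> J' \<subseteq> J2 \<union> \<Union>C2 \<and> K = inside J')"
      using less.hyps[OF _ fin(2) J12(2) _ pw(2)] C2 card by simp
    have eq: "inside J - \<Union>C = (inside J1 - \<Union>C1) \<union> (inside J2 - \<Union>C2)"
    proof -
      have "inside J1 \<inter> \<Union>C2 = {}" "inside J2 \<inter> \<Union>C1 = {}" using C1 C2 by blast+
      moreover have "inside J - \<Union>C = inside J - c - \<Union>C1 - \<Union>C2" using Cun by auto
      ultimately show ?thesis unfolding J12(5) by blast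
    qed
    have "closed c'" if "crosscut J' c'" for J' c'
      using that unfolding crosscut_def by auto
    then have "\<forall>c'\<in>C1. closed c'" "\<forall>c'\<in>C2. closed c'" using C1 C2 by blast+
    then have closed: "closed (\<Union>C1)" "closed (\<Union>C2)"
      using fin by (simp_all add: closed_Union)
    have comps: "components (inside J - \<Union>C) = components (inside J1 - \<Union>C1) \<union> components (inside J2 - \<Union>C2)"
      unfolding eq using R1(3) R2(3) closed J12(4)
      by (intro components_disjoint_open_Un) (auto intro: open_Diff)
    have dj: "components (inside J1 - \<Union>C1) \<inter> components (inside J2 - \<Union>C2) = {}"

    proof -
      have False if K: "K \<in> components (inside J1 - \<Union>C1)" "K \<in> components (inside J2 - \<Union>C2)" for K
        using in_components_nonempty[OF K(1)] in_components_subset[OF K(1)] in_components_subset[OF K(2)] J12(4)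
        by blast
      then show ?thesis by blast
    qed
    have "J' \<subseteq> J \<union> \<Union>C" if "J' \<subseteq> J1 \<union> \<Union>C1 \<or> J' \<subseteq> J2 \<union> \<Union>C2" for J'
      using that J12(3) Cun by auto
    moreover have "card (components (inside J - \<Union>C)) = Suc (card C)"
      unfolding comps using IH1 IH2 dj card by (simp add: card_Un_disjoint)
    moreover have "finite (components (inside J - \<Union>C))"
      unfolding comps using IH1 IH2 by simp
    ultimately show ?thesis using IH1 IH2 unfolding comps by (meson Un_iff)
  qed
qed

section \<open>Quadrants at a point of a hole\<close>

text \<open>The quadrant meant by \<open>quad H p d\<close> lies between the rays from \<open>p\<close> in directions \<open>d\<close> and \<open>\<i> * d\<close>, so for
  \<open>d = 1, \<i>, -1, -\<i>\<close> it is the NE, NW, SW, SE quadrant.\<close>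

definition quad :: "complex set \<Rightarrow> complex \<Rightarrow> complex \<Rightarrow> bool" where
  "quad H p d \<longleftrightarrow> (\<exists>r>0. \<forall>s t. 0 < s \<and> s < r \<and> 0 < t \<and> t < r \<longrightarrow>
     p + of_real s * d + of_real t * (\<i> * d) \<in> interior H)"

text \<open>For a hole, \<open>germ H p d\<close> holds iff the boundary contains an initial piece of the ray from \<open>p\<close> in
  direction \<open>d\<close>: the quadrants on the two sides of the ray differ.\<close>

definition germ :: "complex set \<Rightarrow> complex \<Rightarrow> complex \<Rightarrow> bool" where
  "germ H p d \<longleftrightarrow> quad H p d \<noteq> quad H p (-(\<i> * d))"

lemma hole_facts:
  assumes "hole H"
  shows "Jordan (frontier H)" "cross_like (frontier H)" "interior H = inside (frontier H)"
    "- H = outside (frontier H)" "H = frontier H \<union> interior H"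
proof -
  obtain J where J: "closed_rectilinear_arc J" "H = J \<union> inside J"
    using assms unfolding hole_def by blast
  have fr: "frontier H = J" "interior H = inside J"
    using frontier_hole[OF J(1)] interior_hole[OF J(1)] J(2) by auto
  show "Jordan (frontier H)" "cross_like (frontier H)"
    using closed_rectilinear_arc_imp[OF J(1)] fr by auto
  show "interior H = inside (frontier H)" using fr by simp
  show "- H = outside (frontier H)" 
  proof -
    have "- H = outside J" unfolding J(2) by (simp add: union_with_inside)
    then show ?thesis unfolding fr(1) .
  qed
  show "H = frontier H \<union> interior H" using fr J(2) by simp
qed

lemma Jordan_imp_hole:
  assumes "Jordan J" "cross_like J"
  shows "hole (J \<union> inside J)" "frontier (J \<union> inside J) = J" "interior (J \<union> inside J) = inside J"
  using assms closed_rectilinear_arc_iff frontier_hole interior_hole unfolding hole_def by blast+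

lemma connected_side:
  assumes "Jordan J" "connected A" "A \<inter> J = {}"
  shows "A \<subseteq> inside J \<or> A \<subseteq> outside J"
proof -
  note R = Jordan_regions[OF assms(1)]
  have "A \<subseteq> inside J \<union> outside J" unfolding R(11) using assms(3) by blast
  then show ?thesis using connectedD[OF assms(2) R(3) R(5)] R(10) by blast
qed

lemma dir_coords:
  assumes "d \<in> dirs"
  shows "z = p + of_real (Re ((z - p) * cnj d)) * d + of_real (Im ((z - p) * cnj d)) * (\<i> * d)"
  using assms by (auto simp: dirs_def complex_eq_iff)

lemma off_axis_not_on_ray:
  assumes "d \<in> dirs" "d' \<in> dirs" "s > 0" "t > 0"
  shows "p + of_real s * d + of_real t * (\<i> * d) \<noteq> p + of_real u * d'"
  using assms by (auto simp: dirs_def complex_eq_iff)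

lemma strip_on_ray:
  assumes "d \<in> dirs" "d' \<in> dirs" "s > 0" "p + of_real s * d + of_real t * (\<i> * d) = p + of_real u * d'" "u \<ge> 0"
  shows "d' = d \<and> t = 0"
  using assms by (auto simp: dirs_def complex_eq_iff)

lemma norm_dir_comb:
  assumes "d \<in> dirs"
  shows "dist p (p + of_real s * d + of_real t * (\<i> * d)) \<le> \<bar>s\<bar> + \<bar>t\<bar>"
proof -
  have "dist p (p + of_real s * d + of_real t * (\<i> * d)) = norm (of_real s * d + of_real t * (\<i> * d))"
    by (metis add.assoc add_diff_cancel_left' dist_commute dist_norm)
  also have "\<dots> \<le> norm (of_real s * d) + norm (of_real t * (\<i> * d))" by (rule norm_triangle_ineq)
  finally show ?thesis using norm_dirs[OF assms] by (simp add: norm_mult)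
qed

lemma connected_rect:
  "connected ((\<lambda>(s,t). p + of_real s * d + of_real t * (\<i> * d)) ` ({a<..<b::real} \<times> {c<..<e::real}))"
  by (intro connected_continuous_image connected_Times)
     (auto simp: split_def intro!: continuous_intros)

text \<open>\<open>quad\<close> asks for some small square in the interior. If the square lies in a
  set that is wholly inside or wholly outside, its size does not matter.\<close>

lemma quadI_side:
  assumes "r > 0" "\<And>s t. \<lbrakk>0 < s; s < r; 0 < t; t < r\<rbrakk> \<Longrightarrow> p + of_real s * d + of_real t * (\<i> * d) \<in> X"
    "X \<inter> interior H = {} \<or> X \<subseteq> interior H"
  shows "quad H p d \<longleftrightarrow> X \<subseteq> interior H"
proof
  assume "quad H p d"
  then obtain r' where r': "r' > 0" "\<forall>s t. 0 < s \<and> s < r' \<and> 0 < t \<and> t < r' \<longrightarrow>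
     p + of_real s * d + of_real t * (\<i> * d) \<in> interior H" unfolding quad_def by blast
  define s where "s = min r r' / 2"
  have "0 < s" "s < r" "s < r'" using assms(1) r'(1) by (auto simp: s_def)
  then have "p + of_real s * d + of_real s * (\<i> * d) \<in> X \<inter> interior H" using assms(2) r'(2) by blast
  then show "X \<subseteq> interior H" using assms(3) by blast
next
  assume "X \<subseteq> interior H"
  then show "quad H p d" unfolding quad_def using assms(1,2) by blast
qed

lemma local_structure_off:
  assumes H: "hole H" and p: "p \<notin> frontier H"
  obtains r where "r > 0"
    "\<forall>z. dist p z < r \<longrightarrow> z \<notin> frontier H"
    "\<forall>z. dist p z < r \<longrightarrow> z \<in> interior H \<longleftrightarrow> p \<in> interior H"
    "\<forall>d\<in>dirs. quad H p d \<longleftrightarrow> p \<in> interior H"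
proof -
  note F = hole_facts[OF H]
  note R = Jordan_regions[OF F(1)]
  obtain r where r: "r > 0" "\<forall>z\<in>frontier H. r \<le> dist p z"
    using separate_point_closed[OF frontier_closed p] by blast
  have off: "z \<notin> frontier H" if "dist p z < r" for z using r(2) that by force
  have "ball p r \<inter> frontier H = {}" using off by auto
  then have side: "ball p r \<subseteq> inside (frontier H) \<or> ball p r \<subseteq> outside (frontier H)"
    using connected_side[OF F(1) connected_ball] by blast
  then have eq: "z \<in> interior H \<longleftrightarrow> p \<in> interior H" if "dist p z < r" for z
  proof -
    have "z \<in> ball p r" "p \<in> ball p r" using that r(1) by auto
    then show ?thesis using side R(10) unfolding F(3) by blast
  qed
  have "quad H p d \<longleftrightarrow> p \<in> interior H" if d: "d \<in> dirs" for d
  proof -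
    have "quad H p d \<longleftrightarrow> ball p r \<subseteq> interior H"
    proof (rule quadI_side)
      show "r/2 > 0" using r by simp
      fix s t :: real assume "0 < s" "s < r/2" "0 < t" "t < r/2"
      then show "p + of_real s * d + of_real t * (\<i> * d) \<in> ball p r"
        using norm_dir_comb[OF d, of p s t] by auto
    next
      show "ball p r \<inter> interior H = {} \<or> ball p r \<subseteq> interior H"
        using side R(10) unfolding F(3) by blast
    qed
    also have "\<dots> \<longleftrightarrow> p \<in> interior H"
    proof
      assume "ball p r \<subseteq> interior H"
      moreover have "p \<in> ball p r" using r(1) by simp
      ultimately show "p \<in> interior H" by blast
    next
      assume "p \<in> interior H"
      then show "ball p r \<subseteq> interior H" using eq by (metis mem_ball subsetI)
    qed
    finally show ?thesis .
  qed
  then show thesis using that[OF r(1)] off eq by simp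
qed

text \<open>Near \<open>p\<close> the boundary consists of two rays, so the open quadrants and the
  strips around the other two rays each lie on one side. Across a boundary ray the side changes,
  because the curve is the frontier both of its inside and of its outside.\<close>

lemma local_structure_on:
  assumes H: "hole H" and p: "p \<in> frontier H"
  obtains r d1 d2 where "r > 0" "d1 \<in> dirs" "d2 \<in> dirs" "d1 \<noteq> d2"
    "\<forall>d\<in>dirs. \<forall>s t. 0 < s \<and> s < r \<and> 0 < t \<and> t < r \<longrightarrow>
       p + of_real s * d + of_real t * (\<i> * d) \<notin> frontier H \<and>
       (p + of_real s * d + of_real t * (\<i> * d) \<in> interior H \<longleftrightarrow> quad H p d)"
    "\<forall>d\<in>dirs. \<forall>s. 0 < s \<and> s < r \<longrightarrow> p + of_real s * d \<in> frontier H \<longleftrightarrow> d \<in> {d1,d2}"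
    "\<forall>d\<in>dirs. \<forall>s. 0 < s \<and> s < r \<and> d \<notin> {d1,d2} \<longrightarrow> p + of_real s * d \<in> interior H \<longleftrightarrow> quad H p d"
    "\<forall>d\<in>dirs. germ H p d \<longleftrightarrow> d \<in> {d1,d2}"
proof -
  note F = hole_facts[OF H]
  note R = Jordan_regions[OF F(1)]
  obtain r0 d1 d2 where r0: "r0 > 0" and d12: "d1 \<in> dirs" "d2 \<in> dirs" "d1 \<noteq> d2"
    and ray: "\<And>z. dist p z < r0 \<Longrightarrow> z \<in> frontier H \<longleftrightarrow>
      z = p \<or> (\<exists>t>0. z = p + of_real t * d1) \<or> (\<exists>t>0. z = p + of_real t * d2)"
    by (rule two_rays[OF F(1,2) p]) blast
  define r where "r = r0/2"
  have r: "r > 0" using r0 by (simp add: r_def)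
  have near: "dist p (p + of_real s * d + of_real t * (\<i> * d)) < r0" if "d \<in> dirs" "\<bar>s\<bar> < r" "\<bar>t\<bar> < r" for d s t
    using norm_dir_comb[OF that(1), of p s t] that by (auto simp: r_def)
  define X where "X d = (\<lambda>(s,t). p + of_real s * d + of_real t * (\<i> * d)) ` ({0<..<r} \<times> {0<..<r})" for d
  \<comment> \<open>A strip around the ray in direction \<open>d\<close>. It contains both quadrants
    that border the ray, and misses the boundary if the ray does.\<close>
  define Y where "Y d = (\<lambda>(s,t). p + of_real s * d + of_real t * (\<i> * d)) ` ({0<..<r} \<times> {-r<..<r})" for d
  have XJ: "X d \<inter> frontier H = {}" if d: "d \<in> dirs" for d
  proof -
    have "p + of_real s * d + of_real t * (\<i> * d) \<notin> frontier H" if "0 < s" "s < r" "0 < t" "t < r" for s t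
      using ray[OF near[OF d, of s t]] off_axis_not_on_ray[OF d d12(1) that(1,3)]
        off_axis_not_on_ray[OF d d12(2) that(1,3)] off_axis_not_on_ray[OF d d(1) that(1,3), of p 0] that
      by auto
    then show ?thesis by (auto simp: X_def)
  qed
  have Xside: "X d \<inter> interior H = {} \<or> X d \<subseteq> interior H" if d: "d \<in> dirs" for d
    using connected_side[OF F(1) connected_rect XJ[OF d, unfolded X_def]] R(10)
    unfolding F(3) X_def by blast
  have Xquad: "quad H p d \<longleftrightarrow> X d \<subseteq> interior H" if d: "d \<in> dirs" for d
    by (rule quadI_side[OF r _ Xside[OF d]]) (force simp: X_def)
  have Xquad0: "\<not> quad H p d \<longleftrightarrow> X d \<inter> interior H = {}" if d: "d \<in> dirs" for d
  proof -
    have "X d \<noteq> {}" using r by (auto simp: X_def)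
    then show ?thesis using Xside[OF d] Xquad[OF d] by blast
  qed
  have YJ: "Y d \<inter> frontier H = {}" if d: "d \<in> dirs" "d \<notin> {d1,d2}" for d
  proof -
    have "p + of_real s * d + of_real t * (\<i> * d) \<notin> frontier H" if st: "0 < s" "s < r" "-r < t" "t < r" for s t
    proof
      assume "p + of_real s * d + of_real t * (\<i> * d) \<in> frontier H"
      moreover have "\<bar>s\<bar> < r" "\<bar>t\<bar> < r" using st by auto
      ultimately have "p + of_real s * d + of_real t * (\<i> * d) = p + of_real 0 * d1 \<or>
          (\<exists>u>0. p + of_real s * d + of_real t * (\<i> * d) = p + of_real u * d1) \<or>
          (\<exists>u>0. p + of_real s * d + of_real t * (\<i> * d) = p + of_real u * d2)"
        using ray[OF near[OF d(1), of s t]] by simp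
      then show False
        using strip_on_ray[OF d(1) d12(1) st(1), of p t] strip_on_ray[OF d(1) d12(2) st(1), of p t] d(2)
        by (metis insertI1 insertI2 less_eq_real_def)
    qed
    then show ?thesis by (auto simp: Y_def)
  qed
  have XY: "X d \<subseteq> Y d" "X (-(\<i> * d)) \<subseteq> Y d" if d: "d \<in> dirs" for d
  proof -
    show "X d \<subseteq> Y d" using r unfolding X_def Y_def by (intro image_mono) auto
    show "X (-(\<i> * d)) \<subseteq> Y d"
    proof
      fix z assume "z \<in> X (-(\<i> * d))"
      then obtain s t where st: "0 < s" "s < r" "0 < t" "t < r"
        "z = p + of_real s * (-(\<i> * d)) + of_real t * (\<i> * (-(\<i> * d)))" by (auto simp: X_def)
      then have "z = p + of_real t * d + of_real (-s) * (\<i> * d)" by (simp add: algebra_simps)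
      then show "z \<in> Y d" using st unfolding Y_def by (intro image_eqI[of _ _ "(t,-s)"]) auto
    qed
  qed
  have rayY: "p + of_real s * d \<in> Y d" if "0 < s" "s < r" for s d
    using that unfolding Y_def by (intro image_eqI[of _ _ "(s,0)"]) auto
  have Yside: "Y d \<inter> interior H = {} \<or> Y d \<subseteq> interior H" if d: "d \<in> dirs" "d \<notin> {d1,d2}" for d
    using connected_side[OF F(1) connected_rect YJ[OF d, unfolded Y_def]] R(10)
    unfolding F(3) Y_def by blast
  have nongerm: "\<not> germ H p d \<and> (\<forall>s. 0 < s \<and> s < r \<longrightarrow> (p + of_real s * d \<in> interior H \<longleftrightarrow> quad H p d))"
    if d: "d \<in> dirs" "d \<notin> {d1,d2}" for d
  proof (cases "Y d \<subseteq> interior H")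
    case True
    then have "quad H p d" "quad H p (-(\<i> * d))" 
      using Xquad[of d] Xquad[of "-(\<i> * d)"] XY[OF d(1)] d(1) by auto
    then show ?thesis using True rayY unfolding germ_def by blast
  next
    case False
    then have "Y d \<inter> interior H = {}" using Yside[OF d] by blast
    then have "\<not> quad H p d" "\<not> quad H p (-(\<i> * d))" 
      using Xquad0[of d] Xquad0[of "-(\<i> * d)"] XY[OF d(1)] d(1) by auto
    then show ?thesis using \<open>Y d \<inter> interior H = {}\<close> rayY unfolding germ_def by blast
  qed
  \<comment> \<open>With equal status on both sides, a point \<open>x\<close> in the middle of the
    ray would have a neighbourhood that misses the inside or the outside, though \<open>x\<close> is
    a limit of both.\<close>
  have isgerm: "germ H p d" if d: "d \<in> {d1,d2}" for d
  proof (rule ccontr)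
    assume "\<not> germ H p d"
    then have eq: "quad H p d = quad H p (-(\<i> * d))" unfolding germ_def by simp
    have dd: "d \<in> dirs" "-(\<i> * d) \<in> dirs" using d d12 by auto
    define x where "x = p + of_real (r/2) * d"
    have "dist p x < r0" using near[OF dd(1), of "r/2" 0] r by (simp add: x_def)
    moreover have "\<exists>t>0. x = p + of_real t * d" using r unfolding x_def by (intro exI[of _ "r/2"]) auto
    ultimately have xJ: "x \<in> frontier H" using ray[of x] d by auto
    have fill: "y \<in> X d \<union> X (-(\<i> * d)) \<union> frontier H" if y: "dist x y < r/2" for y
    proof -
      define s where "s = Re ((y - p) * cnj d)"
      define t where "t = Im ((y - p) * cnj d)"
      have yeq: "y = p + of_real s * d + of_real t * (\<i> * d)"
        unfolding s_def t_def by (rule dir_coords[OF dd(1)])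
      have "(y - p) * cnj d = (y - x) * cnj d + of_real (r/2) * (d * cnj d)"
        by (simp add: x_def algebra_simps)
      moreover have "d * cnj d = 1" using dd(1) by (auto simp: dirs_def)
      ultimately have e: "(y - p) * cnj d = (y - x) * cnj d + of_real (r/2)" by simp
      have n: "norm ((y - x) * cnj d) < r/2"
        using y norm_dirs[OF dd(1)] by (simp add: norm_mult dist_norm norm_minus_commute)
      have "\<bar>s - r/2\<bar> < r/2" "\<bar>t\<bar> < r/2"
        using abs_Re_le_cmod[of "(y - x) * cnj d"] abs_Im_le_cmod[of "(y - x) * cnj d"] n
        unfolding s_def t_def e by auto
      then have st: "0 < s" "s < r" "\<bar>t\<bar> < r" by linarith+
      consider "t > 0" | "t = 0" | "t < 0" by linarith
      then show ?thesis
      proof cases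
        case 1
        then have "y \<in> X d" unfolding X_def yeq using st by (intro image_eqI[of _ _ "(s,t)"]) auto
        then show ?thesis by blast
      next
        case 2
        then have "y = p + of_real s * d" using yeq by simp
        moreover have "dist p y < r0" using near[OF dd(1), of s 0] st 2 yeq by simp
        ultimately have "y \<in> frontier H" using ray[of y] d st(1) by auto
        then show ?thesis by blast
      next
        case 3
        have "y = p + of_real (-t) * (-(\<i> * d)) + of_real s * (\<i> * (-(\<i> * d)))"
          unfolding yeq by (simp add: algebra_simps)
        then have "y \<in> X (-(\<i> * d))" unfolding X_def using st 3 by (intro image_eqI[of _ _ "(-t,s)"]) auto
        then show ?thesis by blast
      qed
    qed
    have cl: "x \<in> closure (inside (frontier H))" "x \<in> closure (outside (frontier H))"
      using xJ R(8,9) unfolding frontier_def[of "inside _"] frontier_def[of "outside _"] by blast+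
    obtain y where y: "y \<in> inside (frontier H)" "dist x y < r/2"
      using cl(1) r unfolding closure_approachable by (metis dist_commute half_gt_zero)
    obtain y' where y': "y' \<in> outside (frontier H)" "dist x y' < r/2"
      using cl(2) r unfolding closure_approachable by (metis dist_commute half_gt_zero)
    show False
    proof (cases "quad H p d")
      case True
      then have "X d \<subseteq> interior H" "X (-(\<i> * d)) \<subseteq> interior H" using Xquad[OF dd(1)] Xquad[OF dd(2)] True eq by auto
      then have "y' \<in> inside (frontier H) \<union> frontier H" using fill[OF y'(2)] unfolding F(3) by auto
      then show False using y'(1) R(10,11) by blast
    next
      case False
      then have "X d \<inter> interior H = {}" "X (-(\<i> * d)) \<inter> interior H = {}" using Xquad0[OF dd(1)] Xquad0[OF dd(2)] False eq by simp_all
      then have "y \<in> frontier H" using fill[OF y(2)] y(1) unfolding F(3) by auto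
      then show False using y(1) R(11) by blast
    qed
  qed
  show thesis
  proof (rule that[OF r d12]; intro ballI allI impI; (elim conjE)?)
    fix d s t assume d: "d \<in> dirs" and st: "(0::real) < s" "s < r" "(0::real) < t" "t < r"
    have "p + of_real s * d + of_real t * (\<i> * d) \<in> X d"
      unfolding X_def using st by (intro image_eqI[of _ _ "(s,t)"]) auto
    then show "p + of_real s * d + of_real t * (\<i> * d) \<notin> frontier H \<and>
       (p + of_real s * d + of_real t * (\<i> * d) \<in> interior H \<longleftrightarrow> quad H p d)"
      using XJ[OF d] Xquad[OF d] Xquad0[OF d] by blast
  next
    fix d s assume d: "d \<in> dirs" and s: "(0::real) < s" "s < r"
    show "p + of_real s * d \<in> frontier H \<longleftrightarrow> d \<in> {d1,d2}"
    proof
      assume "p + of_real s * d \<in> frontier H"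
      then show "d \<in> {d1,d2}" using YJ[OF d] rayY[OF s, of d] by blast
    next
      assume "d \<in> {d1,d2}"
      moreover have "dist p (p + of_real s * d) < r0" using near[OF d, of s 0] s by simp
      ultimately show "p + of_real s * d \<in> frontier H" using ray[of "p + of_real s * d"] s(1) by auto
    qed
  next
    fix d s assume "d \<in> dirs" "(0::real) < s" "s < r" "d \<notin> {d1,d2}"
    then show "p + of_real s * d \<in> interior H \<longleftrightarrow> quad H p d" using nongerm by blast
  next
    fix d assume "d \<in> dirs"
    then show "germ H p d \<longleftrightarrow> d \<in> {d1,d2}" using nongerm isgerm by blast
  qed
qed

text \<open>At a boundary point exactly two directions carry the curve, so the status changes
  exactly twice around the four quadrants, and some opposite pair differs. Off the boundary all four
  agree. In particular a checkerboard never occurs.\<close>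

lemma frontier_iff_quads:
  assumes H: "hole H"
  shows "p \<in> frontier H \<longleftrightarrow> quad H p 1 \<noteq> quad H p (-1) \<or> quad H p \<i> \<noteq> quad H p (-\<i>)"
proof (cases "p \<in> frontier H")
  case True
  obtain r d1 d2 where r: "r > 0" and d: "d1 \<in> dirs" "d2 \<in> dirs" "d1 \<noteq> d2"
    and a: "\<forall>d\<in>dirs. \<forall>s t. 0 < s \<and> s < r \<and> 0 < t \<and> t < r \<longrightarrow>
       p + of_real s * d + of_real t * (\<i> * d) \<notin> frontier H \<and>
       (p + of_real s * d + of_real t * (\<i> * d) \<in> interior H \<longleftrightarrow> quad H p d)"
    and b: "\<forall>d\<in>dirs. \<forall>s. 0 < s \<and> s < r \<longrightarrow> p + of_real s * d \<in> frontier H \<longleftrightarrow> d \<in> {d1,d2}"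
    and c: "\<forall>d\<in>dirs. \<forall>s. 0 < s \<and> s < r \<and> d \<notin> {d1,d2} \<longrightarrow> p + of_real s * d \<in> interior H \<longleftrightarrow> quad H p d"
    and g: "\<forall>d\<in>dirs. germ H p d \<longleftrightarrow> d \<in> {d1,d2}"
    by (rule local_structure_on[OF H True])
  have "quad H p 1 \<noteq> quad H p (-\<i>) \<longleftrightarrow> 1 \<in> {d1,d2}" "quad H p \<i> \<noteq> quad H p 1 \<longleftrightarrow> \<i> \<in> {d1,d2}"
    "quad H p (-1) \<noteq> quad H p \<i> \<longleftrightarrow> -1 \<in> {d1,d2}" "quad H p (-\<i>) \<noteq> quad H p (-1) \<longleftrightarrow> -\<i> \<in> {d1,d2}"
    using bspec[OF g, of 1] bspec[OF g, of \<i>] bspec[OF g, of "-1"] bspec[OF g, of "-\<i>"] by (simp_all add: germ_def)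
  moreover have "1 \<notin> {d1,d2} \<or> \<i> \<notin> {d1,d2} \<or> -1 \<notin> {d1,d2}"
    by (auto simp: complex_eq_iff)
  moreover have "1 \<in> {d1,d2} \<or> \<i> \<in> {d1,d2} \<or> -1 \<in> {d1,d2} \<or> -\<i> \<in> {d1,d2}"
    using d(1) unfolding dirs_def by auto
  ultimately have "quad H p 1 \<noteq> quad H p (-1) \<or> quad H p \<i> \<noteq> quad H p (-\<i>)" by argo
  then show ?thesis using True by simp
next
  case False
  obtain r where r: "r > 0" "\<forall>z. dist p z < r \<longrightarrow> z \<notin> frontier H"
    "\<forall>z. dist p z < r \<longrightarrow> z \<in> interior H \<longleftrightarrow> p \<in> interior H"
    "\<forall>d\<in>dirs. quad H p d \<longleftrightarrow> p \<in> interior H"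
    by (rule local_structure_off[OF H False])
  show ?thesis using False bspec[OF r(4), of 1] bspec[OF r(4), of "-1"] bspec[OF r(4), of \<i>] bspec[OF r(4), of "-\<i>"]
    by simp
qed

text \<open>A common form of the cases \<open>p\<close> on and off the boundary, so that later
  arguments need not know where \<open>p\<close> lies.\<close>

lemma quad_local:
  assumes H: "hole H"
  obtains r where "r > 0"
    "\<forall>d\<in>dirs. \<forall>s t. 0 < s \<and> s < r \<and> 0 < t \<and> t < r \<longrightarrow>
       p + of_real s * d + of_real t * (\<i> * d) \<notin> frontier H \<and>
       (p + of_real s * d + of_real t * (\<i> * d) \<in> interior H \<longleftrightarrow> quad H p d)"
    "\<forall>d\<in>dirs. \<forall>s. 0 < s \<and> s < r \<longrightarrow> (p + of_real s * d \<in> frontier H \<longleftrightarrow> germ H p d) \<and>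
      (p + of_real s * d \<in> interior H \<longleftrightarrow> quad H p d \<and> quad H p (-(\<i> * d)))"
proof (cases "p \<in> frontier H")
  case True
  have int: "z \<notin> interior H" if "z \<in> frontier H" for z using that by (simp add: frontier_def)
  obtain r d1 d2 where r: "r > 0" and d: "d1 \<in> dirs" "d2 \<in> dirs" "d1 \<noteq> d2"
    and a: "\<forall>d\<in>dirs. \<forall>s t. 0 < s \<and> s < r \<and> 0 < t \<and> t < r \<longrightarrow>
       p + of_real s * d + of_real t * (\<i> * d) \<notin> frontier H \<and>
       (p + of_real s * d + of_real t * (\<i> * d) \<in> interior H \<longleftrightarrow> quad H p d)"
    and b: "\<forall>d\<in>dirs. \<forall>s. 0 < s \<and> s < r \<longrightarrow> p + of_real s * d \<in> frontier H \<longleftrightarrow> d \<in> {d1,d2}"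
    and c: "\<forall>d\<in>dirs. \<forall>s. 0 < s \<and> s < r \<and> d \<notin> {d1,d2} \<longrightarrow> p + of_real s * d \<in> interior H \<longleftrightarrow> quad H p d"
    and g: "\<forall>d\<in>dirs. germ H p d \<longleftrightarrow> d \<in> {d1,d2}"
    by (rule local_structure_on[OF H True])
  show thesis
  proof (rule that[OF r a]; intro ballI allI impI; (elim conjE)?)
    fix d s assume d: "d \<in> dirs" "(0::real) < s" "s < r"
    have b: "p + of_real s * d \<in> frontier H \<longleftrightarrow> d \<in> {d1,d2}"
      and c: "d \<notin> {d1,d2} \<Longrightarrow> p + of_real s * d \<in> interior H \<longleftrightarrow> quad H p d"
      and g: "germ H p d \<longleftrightarrow> d \<in> {d1,d2}" using b c g d by blast+
    show "(p + of_real s * d \<in> frontier H \<longleftrightarrow> germ H p d) \<and>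
      (p + of_real s * d \<in> interior H \<longleftrightarrow> quad H p d \<and> quad H p (-(\<i> * d)))"
    proof (cases "germ H p d")
      case True
      then have "p + of_real s * d \<in> frontier H" using b g by blast
      then show ?thesis using True int unfolding germ_def by blast
    next
      case False
      then show ?thesis using b c g unfolding germ_def by blast
    qed
  qed
next
  case False
  obtain r where r: "r > 0" "\<forall>z. dist p z < r \<longrightarrow> z \<notin> frontier H"
    "\<forall>z. dist p z < r \<longrightarrow> z \<in> interior H \<longleftrightarrow> p \<in> interior H"
    "\<forall>d\<in>dirs. quad H p d \<longleftrightarrow> p \<in> interior H"
    by (rule local_structure_off[OF H False])
  show thesis
  proof (rule that[OF half_gt_zero[OF r(1)]]; intro ballI allI impI; (elim conjE)?)
    fix d s t assume d: "d \<in> dirs" "(0::real) < s" "s < r/2" "(0::real) < t" "t < r/2"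
    then have "dist p (p + of_real s * d + of_real t * (\<i> * d)) < r" using norm_dir_comb[OF d(1), of p s t] by simp
    then show "p + of_real s * d + of_real t * (\<i> * d) \<notin> frontier H \<and>
       (p + of_real s * d + of_real t * (\<i> * d) \<in> interior H \<longleftrightarrow> quad H p d)"
      using r d(1) by blast
  next
    fix d s assume d: "d \<in> dirs" "(0::real) < s" "s < r/2"
    have "dist p (p + of_real s * d) < r" using norm_dir_comb[OF d(1), of p s 0] d r(1) by simp
    moreover have "-(\<i> * d) \<in> dirs" using d(1) by simp
    ultimately show "(p + of_real s * d \<in> frontier H \<longleftrightarrow> germ H p d) \<and>
      (p + of_real s * d \<in> interior H \<longleftrightarrow> quad H p d \<and> quad H p (-(\<i> * d)))"
      using r(2-4) d(1) unfolding germ_def by blast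
  qed
qed

lemma germ_uminus: "germ H p (-d) \<longleftrightarrow> quad H p (-d) \<noteq> quad H p (\<i> * d)"
  by (simp add: germ_def)

lemma germ_rotate: "germ H p (\<i> * d) \<longleftrightarrow> quad H p (\<i> * d) \<noteq> quad H p d"
  "germ H p (-(\<i> * d)) \<longleftrightarrow> quad H p (-(\<i> * d)) \<noteq> quad H p (-d)"
  by (simp_all add: germ_def)

lemma frontier_iff_quads_dir:
  assumes "hole H" "d \<in> dirs"
  shows "p \<in> frontier H \<longleftrightarrow> quad H p d \<noteq> quad H p (-d) \<or> quad H p (\<i> * d) \<noteq> quad H p (-(\<i> * d))"
  using assms(2) frontier_iff_quads[OF assms(1), of p] by (cases rule: dirs_cases) auto

lemma germ_imp_frontier:
  assumes H: "hole H" and d: "d \<in> dirs" and g: "germ H p d"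
  shows "p \<in> frontier H"
proof (rule ccontr)
  assume p: "p \<notin> frontier H"
  obtain r where r: "r > 0" "\<forall>z. dist p z < r \<longrightarrow> z \<notin> frontier H"
    "\<forall>z. dist p z < r \<longrightarrow> z \<in> interior H \<longleftrightarrow> p \<in> interior H"
    "\<forall>d\<in>dirs. quad H p d \<longleftrightarrow> p \<in> interior H"
    by (rule local_structure_off[OF H p])
  have "-(\<i> * d) \<in> dirs" using d by simp
  then show False using g d r(4) unfolding germ_def by blast
qed

lemma germ_ray:
  assumes H: "hole H" and d: "d \<in> dirs"
  obtains r where "r > 0" "\<forall>s. 0 < s \<and> s < r \<longrightarrow> (p + of_real s * d \<in> frontier H \<longleftrightarrow> germ H p d)"
proof -
  obtain r where "r > 0" "\<forall>d\<in>dirs. \<forall>s t. 0 < s \<and> s < r \<and> 0 < t \<and> t < r \<longrightarrow>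
       p + of_real s * d + of_real t * (\<i> * d) \<notin> frontier H \<and>
       (p + of_real s * d + of_real t * (\<i> * d) \<in> interior H \<longleftrightarrow> quad H p d)"
    "\<forall>d\<in>dirs. \<forall>s. 0 < s \<and> s < r \<longrightarrow> (p + of_real s * d \<in> frontier H \<longleftrightarrow> germ H p d) \<and>
      (p + of_real s * d \<in> interior H \<longleftrightarrow> quad H p d \<and> quad H p (-(\<i> * d)))"
    by (rule quad_local[OF H])
  then show thesis using that d by blast
qed

lemma germI:
  assumes H: "hole H" and d: "d \<in> dirs" and l: "l > 0"
    and on: "\<And>s. \<lbrakk>0 < s; s < l\<rbrakk> \<Longrightarrow> p + of_real s * d \<in> frontier H"
  shows "germ H p d"
proof -
  obtain r where r: "r > 0" "\<forall>s. 0 < s \<and> s < r \<longrightarrow> (p + of_real s * d \<in> frontier H \<longleftrightarrow> germ H p d)"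
    by (rule germ_ray[OF H d])
  define s where "s = min r l / 2"
  have "0 < s" "s < r" "s < l" using r(1) l by (auto simp: s_def)
  then show ?thesis using r(2) on by blast
qed

text \<open>Only two directions carry the boundary at a point, so germs in \<open>d\<close> and
  \<open>-d\<close> leave none across.\<close>

lemma straight_quads:
  assumes H: "hole H" and d: "d \<in> dirs" and g: "germ H p d" "germ H p (-d)"
  shows "quad H p (\<i> * d) = quad H p d" "quad H p (-d) = quad H p (-(\<i> * d))"
    "\<not> germ H p (\<i> * d)" "\<not> germ H p (-(\<i> * d))"
  using g frontier_iff_quads_dir[OF H d, of p] germ_imp_frontier[OF H d g(1)]
  unfolding germ_uminus germ_rotate unfolding germ_def by (simp_all, argo+)

lemma two_germs:
  assumes H: "hole H" and d: "d \<in> dirs" and g: "germ H p d" "\<not> germ H p (-d)"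
  shows "germ H p (\<i> * d) \<longleftrightarrow> \<not> germ H p (-(\<i> * d))"
  using g frontier_iff_quads_dir[OF H d, of p] germ_imp_frontier[OF H d g(1)]
  unfolding germ_uminus germ_rotate unfolding germ_def by simp argo

lemma frontier_has_germ:
  assumes H: "hole H" and p: "p \<in> frontier H"
  shows "\<exists>d\<in>dirs. germ H p d"
  using frontier_iff_quads[OF H, of p] p unfolding dirs_def germ_def by auto

text \<open>A point of the ray close to \<open>p\<close> sees in its four quadrants only parts of
  the two quadrants of \<open>p\<close> that border the ray.\<close>

lemma quad_along:
  assumes H: "hole H" and d: "d \<in> dirs"
  obtains r where "r > 0" "\<forall>s. 0 < s \<and> s < r \<longrightarrow>
    quad H (p + of_real s * d) d = quad H p d \<and> quad H (p + of_real s * d) (\<i> * d) = quad H p d \<and>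
    quad H (p + of_real s * d) (-(\<i> * d)) = quad H p (-(\<i> * d)) \<and>
    quad H (p + of_real s * d) (-d) = quad H p (-(\<i> * d))"
proof -
  obtain r where r: "r > 0" and loc: "\<forall>d\<in>dirs. \<forall>s t. 0 < s \<and> s < r \<and> 0 < t \<and> t < r \<longrightarrow>
       p + of_real s * d + of_real t * (\<i> * d) \<notin> frontier H \<and>
       (p + of_real s * d + of_real t * (\<i> * d) \<in> interior H \<longleftrightarrow> quad H p d)"
    "\<forall>d\<in>dirs. \<forall>s. 0 < s \<and> s < r \<longrightarrow> (p + of_real s * d \<in> frontier H \<longleftrightarrow> germ H p d) \<and>
      (p + of_real s * d \<in> interior H \<longleftrightarrow> quad H p d \<and> quad H p (-(\<i> * d)))"
    by (rule quad_local[OF H])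
  define X where "X e = {p + of_real s * e + of_real t * (\<i> * e) |s t. 0 < s \<and> s < r \<and> 0 < t \<and> t < r}" for e
  have side: "X e \<inter> interior H = {} \<or> X e \<subseteq> interior H" if "e \<in> dirs" for e
    using bspec[OF loc(1) that] unfolding X_def by (cases "quad H p e") auto
  have base: "quad H p e \<longleftrightarrow> X e \<subseteq> interior H" if "e \<in> dirs" for e
    by (rule quadI_side[OF r _ side[OF that]]) (auto simp: X_def)
  have mem: "y \<in> X e" if "y = p + of_real s * e + of_real t * (\<i> * e)" "0 < s" "s < r" "0 < t" "t < r" for y e s t
    using that unfolding X_def by blast
  have e': "-(\<i> * d) \<in> dirs" using d by simp
  show thesis
  proof (rule that[OF r], intro allI impI)
    fix s assume s: "0 < s \<and> s < r"
    define m where "m = min s (r - s)"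
    have m: "0 < m" "m \<le> s" "m \<le> r - s" using s by (auto simp: m_def)
    let ?x = "p + of_real s * d"
    have "quad H ?x d \<longleftrightarrow> X d \<subseteq> interior H"
    proof (rule quadI_side[OF m(1) _ side[OF d]])
      fix u v :: real assume uv: "0 < u" "u < m" "0 < v" "v < m"
      show "?x + of_real u * d + of_real v * (\<i> * d) \<in> X d"
        by (rule mem[of _ "s + u" _ v]) (use uv m s in \<open>auto simp: algebra_simps\<close>)
    qed
    moreover have "quad H ?x (\<i> * d) \<longleftrightarrow> X d \<subseteq> interior H"
    proof (rule quadI_side[OF m(1) _ side[OF d]])
      fix u v :: real assume uv: "0 < u" "u < m" "0 < v" "v < m"
      show "?x + of_real u * (\<i> * d) + of_real v * (\<i> * (\<i> * d)) \<in> X d"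
        by (rule mem[of _ "s - v" _ u]) (use uv m s in \<open>auto simp: algebra_simps\<close>)
    qed
    moreover have "quad H ?x (-(\<i> * d)) \<longleftrightarrow> X (-(\<i> * d)) \<subseteq> interior H"
    proof (rule quadI_side[OF m(1) _ side[OF e']])
      fix u v :: real assume uv: "0 < u" "u < m" "0 < v" "v < m"
      show "?x + of_real u * (-(\<i> * d)) + of_real v * (\<i> * (-(\<i> * d))) \<in> X (-(\<i> * d))"
        by (rule mem[of _ u _ "s + v"]) (use uv m s in \<open>auto simp: algebra_simps\<close>)
    qed
    moreover have "quad H ?x (-d) \<longleftrightarrow> X (-(\<i> * d)) \<subseteq> interior H"
    proof (rule quadI_side[OF m(1) _ side[OF e']])
      fix u v :: real assume uv: "0 < u" "u < m" "0 < v" "v < m"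
      show "?x + of_real u * (-d) + of_real v * (\<i> * (-d)) \<in> X (-(\<i> * d))"
        by (rule mem[of _ v _ "s - u"]) (use uv m s in \<open>auto simp: algebra_simps\<close>)
    qed
    ultimately show "quad H ?x d = quad H p d \<and> quad H ?x (\<i> * d) = quad H p d \<and>
      quad H ?x (-(\<i> * d)) = quad H p (-(\<i> * d)) \<and> quad H ?x (-d) = quad H p (-(\<i> * d))"
      using base[OF d] base[OF e'] by simp
  qed
qed

lemma segment_germs:
  assumes H: "hole H" and d: "d \<in> dirs" and l: "l > 0"
    and on: "\<forall>s. 0 \<le> s \<and> s \<le> l \<longrightarrow> a + of_real s * d \<in> frontier H"
  shows "0 \<le> s \<Longrightarrow> s < l \<Longrightarrow> germ H (a + of_real s * d) d"
    "0 < s \<Longrightarrow> s \<le> l \<Longrightarrow> germ H (a + of_real s * d) (-d)"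
proof -
  assume s: "0 \<le> s" "s < l"
  show "germ H (a + of_real s * d) d"
  proof (rule germI[OF H d, of "l - s"])
    fix u :: real assume u: "0 < u" "u < l - s"
    have eq: "a + of_real s * d + of_real u * d = a + of_real (s + u) * d" by (simp add: algebra_simps)
    show "a + of_real s * d + of_real u * d \<in> frontier H" unfolding eq using spec[OF on, of "s + u"] s u by simp
  qed (use s in simp)
next
  assume s: "0 < s" "s \<le> l"
  show "germ H (a + of_real s * d) (-d)"
  proof (rule germI[OF H _, of _ s])
    fix u :: real assume u: "0 < u" "u < s"
    have eq: "a + of_real s * d + of_real u * (-d) = a + of_real (s - u) * d" by (simp add: algebra_simps)
    show "a + of_real s * d + of_real u * (-d) \<in> frontier H" unfolding eq using spec[OF on, of "s - u"] s u by simp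
  qed (use s d in auto)
qed

text \<open>The side on which the interior lies is locally constant along the segment, by
  \<open>quad_along\<close> forwards and backwards, hence constant. The half-open ranges leave out
  the ends where the boundary may turn.\<close>

lemma segment_quads:
  assumes H: "hole H" and d: "d \<in> dirs" and l: "l > 0"
    and on: "\<forall>s. 0 \<le> s \<and> s \<le> l \<longrightarrow> a + of_real s * d \<in> frontier H"
  shows "0 \<le> s \<Longrightarrow> s < l \<Longrightarrow> quad H (a + of_real s * d) d = quad H a d"
    "0 \<le> s \<Longrightarrow> s < l \<Longrightarrow> quad H (a + of_real s * d) (-(\<i> * d)) = (\<not> quad H a d)"
    "0 < s \<Longrightarrow> s \<le> l \<Longrightarrow> quad H (a + of_real s * d) (\<i> * d) = quad H a d"
    "0 < s \<Longrightarrow> s \<le> l \<Longrightarrow> quad H (a + of_real s * d) (-d) = (\<not> quad H a d)"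
proof -
  note G = segment_germs[OF H d l on]
  have nd: "-d \<in> dirs" using d by simp
  have st: "quad H (a + of_real s * d) (\<i> * d) = quad H (a + of_real s * d) d" if "0 < s" "s < l" for s
    using straight_quads(1)[OF H d G(1)[of s] G(2)[of s]] that by simp
  have fwd: "\<exists>r>0. \<forall>u. 0 < u \<and> u < r \<longrightarrow> quad H (a + of_real (s + u) * d) d = quad H (a + of_real s * d) d" for s
  proof -
    obtain r where "r > 0" "\<forall>u. 0 < u \<and> u < r \<longrightarrow>
      quad H (a + of_real s * d + of_real u * d) d = quad H (a + of_real s * d) d \<and>
      quad H (a + of_real s * d + of_real u * d) (\<i> * d) = quad H (a + of_real s * d) d \<and>
      quad H (a + of_real s * d + of_real u * d) (-(\<i> * d)) = quad H (a + of_real s * d) (-(\<i> * d)) \<and>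
      quad H (a + of_real s * d + of_real u * d) (-d) = quad H (a + of_real s * d) (-(\<i> * d))"
      by (rule quad_along[OF H d])
    then show ?thesis by (intro exI[of _ r]) (simp add: algebra_simps)
  qed
  have bwd: "\<exists>r>0. \<forall>u. 0 < u \<and> u < r \<longrightarrow> quad H (a + of_real (s - u) * d) d = quad H (a + of_real s * d) (\<i> * d)" for s
  proof -
    obtain r where "r > 0" "\<forall>u. 0 < u \<and> u < r \<longrightarrow>
      quad H (a + of_real s * d + of_real u * (-d)) (-d) = quad H (a + of_real s * d) (-d) \<and>
      quad H (a + of_real s * d + of_real u * (-d)) (\<i> * (-d)) = quad H (a + of_real s * d) (-d) \<and>
      quad H (a + of_real s * d + of_real u * (-d)) (-(\<i> * (-d))) = quad H (a + of_real s * d) (-(\<i> * (-d))) \<and>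
      quad H (a + of_real s * d + of_real u * (-d)) (-(-d)) = quad H (a + of_real s * d) (-(\<i> * (-d)))"
      by (rule quad_along[OF H nd])
    then show ?thesis by (intro exI[of _ r]) (simp add: algebra_simps)
  qed
  define f where "f s = quad H (a + of_real s * d) d" for s
  have const: "f s = f s'" if ss: "s \<in> {0<..<l}" "s' \<in> {0<..<l}" for s s'
  proof (rule connected_local_const[of "{0<..<l}"])
    show "\<forall>x\<in>{0<..<l}. \<forall>\<^sub>F y in at x within {0<..<l}. f x = f y"
    proof
      fix x assume x: "x \<in> {0<..<l}"
      obtain r where r: "r > 0" "\<forall>u. 0 < u \<and> u < r \<longrightarrow> f (x + u) = f x"
        using fwd[of x] unfolding f_def by blast
      obtain r' where r': "r' > 0" "\<forall>u. 0 < u \<and> u < r' \<longrightarrow> f (x - u) = f x"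
        using bwd[of x] st[of x] x unfolding f_def by auto
      have "f x = f y" if y: "y \<noteq> x" "dist y x < min r r'" for y
      proof (cases "y > x")
        case True
        then have "f (x + (y - x)) = f x" using spec[OF r(2), of "y - x"] y by (auto simp: dist_real_def)
        then show ?thesis by simp
      next
        case False
        then have "f (x - (x - y)) = f x" using spec[OF r'(2), of "x - y"] y by (auto simp: dist_real_def)
        then show ?thesis by simp
      qed
      then show "\<forall>\<^sub>F y in at x within {0<..<l}. f x = f y"
        unfolding eventually_at using r(1) r'(1) by (intro exI[of _ "min r r'"]) auto
    qed
  qed (use ss in auto)
  have f0: "f s = f 0" if s: "s \<in> {0<..<l}" for s
  proof -
    obtain r where r: "r > 0" "\<forall>u. 0 < u \<and> u < r \<longrightarrow> f (0 + u) = f 0" using fwd[of 0] unfolding f_def by blast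
    define u where "u = min r l / 2"
    have "0 < u" "u < r" "u < l" using r(1) l by (auto simp: u_def)
    then show ?thesis using r(2) const[OF s, of u] by auto
  qed
  have 1: "quad H (a + of_real s * d) d = quad H a d" if "0 \<le> s" "s < l" for s
    using f0[of s] that unfolding f_def by (cases "s = 0") auto
  have 3: "quad H (a + of_real s * d) (\<i> * d) = quad H a d" if s: "0 < s" "s \<le> l" for s
  proof -
    obtain r where r: "r > 0" "\<forall>u. 0 < u \<and> u < r \<longrightarrow>
      quad H (a + of_real (s - u) * d) d = quad H (a + of_real s * d) (\<i> * d)" using bwd by blast
    define u where "u = min r s / 2"
    have u: "0 < u" "u < r" "u < s" using r(1) s by (auto simp: u_def)
    then have "quad H (a + of_real (s - u) * d) d = quad H a d" using 1[of "s - u"] s by simp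
    then show ?thesis using r(2) u by blast
  qed
  show "0 \<le> s \<Longrightarrow> s < l \<Longrightarrow> quad H (a + of_real s * d) d = quad H a d" using 1 .
  show "0 < s \<Longrightarrow> s \<le> l \<Longrightarrow> quad H (a + of_real s * d) (\<i> * d) = quad H a d" using 3 .
  show "0 \<le> s \<Longrightarrow> s < l \<Longrightarrow> quad H (a + of_real s * d) (-(\<i> * d)) = (\<not> quad H a d)"
    using 1[of s] G(1)[of s] unfolding germ_def by blast
  show "0 < s \<Longrightarrow> s \<le> l \<Longrightarrow> quad H (a + of_real s * d) (-d) = (\<not> quad H a d)"
    using 3[of s] G(2)[of s] unfolding germ_uminus by blast
qed

section \<open>Edges as oriented maximal boundary segments\<close>

text \<open>Maximality is the absence of a continuing germ at both ends. The interior is on the left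
  of the edge so oriented iff \<open>quad H a d\<close>, which is how orientation is expressed from
  here on.\<close>

definition dir_edge :: "complex set \<Rightarrow> complex \<Rightarrow> complex \<Rightarrow> real \<Rightarrow> bool" where
  "dir_edge H a d l \<longleftrightarrow> d \<in> dirs \<and> l > 0 \<and> (\<forall>s. 0 \<le> s \<and> s \<le> l \<longrightarrow> a + of_real s * d \<in> frontier H) \<and>
     \<not> germ H (a + of_real l * d) d \<and> \<not> germ H a (-d)"

lemma dir_edgeD:
  assumes "dir_edge H a d l"
  shows "d \<in> dirs" "l > 0" "\<forall>s. 0 \<le> s \<and> s \<le> l \<longrightarrow> a + of_real s * d \<in> frontier H"
    "\<not> germ H (a + of_real l * d) d" "\<not> germ H a (-d)"
  using assms by (auto simp: dir_edge_def)

lemma dir_edge_reverse: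
  assumes "dir_edge H a d l" shows "dir_edge H (a + of_real l * d) (-d) l"
proof -
  note D = dir_edgeD[OF assms]
  have "a + of_real l * d + of_real s * (-d) \<in> frontier H" if "0 \<le> s" "s \<le> l" for s
  proof -
    have eq: "a + of_real l * d + of_real s * (-d) = a + of_real (l - s) * d" by (simp add: algebra_simps)
    show ?thesis unfolding eq using spec[OF D(3), of "l - s"] that by simp
  qed
  then show ?thesis using D by (simp add: dir_edge_def)
qed

text \<open>The lengths for which the segment stays on the boundary are bounded; their supremum is
  attained since the boundary is closed, and a germ at the end would exceed it.\<close>

lemma extend_germ:
  assumes H: "hole H" and d: "d \<in> dirs" and g: "germ H p d"
  obtains l where "l > 0" "\<forall>s. 0 \<le> s \<and> s \<le> l \<longrightarrow> p + of_real s * d \<in> frontier H"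
    "\<not> germ H (p + of_real l * d) d"
proof -
  define T where "T = {l. 0 \<le> l \<and> (\<forall>s. 0 \<le> s \<and> s \<le> l \<longrightarrow> p + of_real s * d \<in> frontier H)}"
  have pf: "p \<in> frontier H" using germ_imp_frontier[OF H d g] .
  have "compact (frontier H)" using Jordan_regions(1)[OF hole_facts(1)[OF H]] .
  then obtain B where B: "\<forall>z\<in>frontier H. norm z \<le> B" using compact_imp_bounded bounded_iff by metis
  have "0 \<in> T" using pf by (auto simp: T_def)
  have bd: "x \<le> B + norm p" if "x \<in> T" for x
  proof -
    have "p + of_real x * d \<in> frontier H" "0 \<le> x" using that by (auto simp: T_def)
    then have "norm (p + of_real x * d) \<le> B" using B by blast
    moreover have "norm (of_real x * d) \<le> norm (p + of_real x * d) + norm p"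
      using norm_triangle_ineq4[of "p + of_real x * d" p] by simp
    ultimately show ?thesis using norm_dirs[OF d] \<open>0 \<le> x\<close> by (simp add: norm_mult)
  qed
  then have bdd: "bdd_above T" by (meson bdd_aboveI)
  define l where "l = Sup T"
  obtain r where r: "r > 0" "\<forall>s. 0 < s \<and> s < r \<longrightarrow> (p + of_real s * d \<in> frontier H \<longleftrightarrow> germ H p d)"
    by (rule germ_ray[OF H d])
  have "r/2 \<in> T" unfolding T_def
  proof (intro CollectI conjI allI impI)
    fix s :: real assume s: "0 \<le> s \<and> s \<le> r/2"
    show "p + of_real s * d \<in> frontier H"
      using pf r g s by (cases "s = 0") auto
  qed (use r in simp)
  then have l: "l > 0" using cSup_upper[OF _ bdd, of "r/2"] r(1) unfolding l_def by linarith
  have on1: "p + of_real s * d \<in> frontier H" if s: "0 \<le> s" "s < l" for s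
  proof -
    obtain x where "x \<in> T" "s < x" using less_cSup_iff[of T s] bdd \<open>0 \<in> T\<close> s(2) unfolding l_def by blast
    then show ?thesis using s(1) by (auto simp: T_def)
  qed
  have "p + of_real l * d \<in> frontier H"
  proof (rule closed_sequentially[OF frontier_closed])
    show "p + of_real (l - l / real (Suc n)) * d \<in> frontier H" for n
      using l by (intro on1) (auto simp: field_simps)
    have "(\<lambda>n. l / real (Suc n)) \<longlonglongrightarrow> 0" by (rule LIMSEQ_Suc[OF lim_const_over_n])
    then have "(\<lambda>n. l - l / real (Suc n)) \<longlonglongrightarrow> l - 0" by (intro tendsto_intros)
    then have "(\<lambda>n. of_real (l - l / real (Suc n)) :: complex) \<longlonglongrightarrow> of_real l" by (intro tendsto_of_real) simp
    then show "(\<lambda>n. p + of_real (l - l / real (Suc n)) * d) \<longlonglongrightarrow> p + of_real l * d"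
      by (intro tendsto_add tendsto_mult tendsto_const)
  qed
  then have on: "p + of_real s * d \<in> frontier H" if "0 \<le> s" "s \<le> l" for s
    using on1[of s] that by (cases "s = l") auto
  have "\<not> germ H (p + of_real l * d) d"
  proof
    assume g': "germ H (p + of_real l * d) d"
    obtain r' where r': "r' > 0"
      "\<forall>s. 0 < s \<and> s < r' \<longrightarrow> (p + of_real l * d + of_real s * d \<in> frontier H \<longleftrightarrow> germ H (p + of_real l * d) d)"
      by (rule germ_ray[OF H d])
    have "l + r'/2 \<in> T" unfolding T_def
    proof (intro CollectI conjI allI impI)
      fix s :: real assume s: "0 \<le> s \<and> s \<le> l + r'/2"
      show "p + of_real s * d \<in> frontier H"
      proof (cases "s \<le> l")
        case False
        have eq: "p + of_real s * d = p + of_real l * d + of_real (s - l) * d" by (simp add: algebra_simps)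
        show ?thesis unfolding eq using spec[OF r'(2), of "s - l"] g' False s r'(1) by simp
      qed (use s on in simp)
    qed (use l r' in simp)
    then show False using cSup_upper[OF _ bdd, of "l + r'/2"] r'(1) unfolding l_def by simp
  qed
  then show thesis using that[OF l] on by blast
qed

text \<open>The germ is prolonged forwards, and also backwards if the boundary continues there, in
  which case \<open>p\<close> is an inner point of the edge.\<close>

lemma germ_dir_edge:
  assumes H: "hole H" and d: "d \<in> dirs" and g: "germ H p d"
  obtains a l s where "dir_edge H a d l" "0 \<le> s" "s < l" "p = a + of_real s * d"
proof -
  obtain l where l: "l > 0" "\<forall>s. 0 \<le> s \<and> s \<le> l \<longrightarrow> p + of_real s * d \<in> frontier H"
    "\<not> germ H (p + of_real l * d) d" by (rule extend_germ[OF H d g])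
  show thesis
  proof (cases "germ H p (-d)")
    case False
    then have "dir_edge H p d l" using l d by (simp add: dir_edge_def)
    then show thesis using that[of p l 0] l(1) by simp
  next
    case True
    have nd: "-d \<in> dirs" using d by simp
    obtain m where m: "m > 0" "\<forall>s. 0 \<le> s \<and> s \<le> m \<longrightarrow> p + of_real s * (-d) \<in> frontier H"
      "\<not> germ H (p + of_real m * (-d)) (-d)" by (rule extend_germ[OF H nd True])
    define a where "a = p + of_real m * (-d)"
    have on: "a + of_real s * d \<in> frontier H" if s: "0 \<le> s" "s \<le> m + l" for s
    proof (cases "s \<le> m")
      case True
      have eq: "a + of_real s * d = p + of_real (m - s) * (-d)" by (simp add: a_def algebra_simps)
      show ?thesis unfolding eq using spec[OF m(2), of "m - s"] True s by simp
    next
      case False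
      have eq: "a + of_real s * d = p + of_real (s - m) * d" by (simp add: a_def algebra_simps)
      show ?thesis unfolding eq using spec[OF l(2), of "s - m"] False s by simp
    qed
    have eq: "a + of_real (m + l) * d = p + of_real l * d" by (simp add: a_def algebra_simps)
    have "dir_edge H a d (m + l)"
      unfolding dir_edge_def eq using on l(1,3) m(1,3) d by (simp add: a_def)
    moreover have "p = a + of_real m * d" by (simp add: a_def)
    ultimately show thesis using that m(1) l(1) by (metis less_add_same_cancel1 less_imp_le)
  qed
qed

text \<open>If one edge began or ended before the other, that end would carry a germ of the other
  edge, against maximality.\<close>

lemma dir_edge_unique:
  assumes H: "hole H" and e: "dir_edge H a d l" and e': "dir_edge H a' d l'"
    and eq: "a + of_real s * d = a' + of_real s' * d" and s: "0 \<le> s" "s < l" "0 \<le> s'" "s' < l'"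
  shows "a = a' \<and> l = l'"
proof -
  note D = dir_edgeD[OF e] and D' = dir_edgeD[OF e']
  have end1: "\<not> l - s < l' - s'" if "dir_edge H a d l" "dir_edge H a' d l'"
    "a + of_real s * d = a' + of_real s' * d" "0 \<le> s" "s < l" "0 \<le> s'" "s' < l'" for a a' l l' s s'
  proof
    assume "l - s < l' - s'"
    note D = dir_edgeD[OF that(1)] and D' = dir_edgeD[OF that(2)]
    have "a = a' + of_real s' * d - of_real s * d" using that(3) by (simp add: algebra_simps)
    then have "a + of_real l * d = a' + of_real (s' + (l - s)) * d" by (simp add: algebra_simps)
    moreover have "germ H (a' + of_real (s' + (l - s)) * d) d"
      using segment_germs(1)[OF H D'(1-3), of "s' + (l - s)"] that \<open>l - s < l' - s'\<close> by simp
    ultimately show False using D(4) by simp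
  qed
  have start1: "\<not> s < s'" if "dir_edge H a d l" "dir_edge H a' d l'"
    "a + of_real s * d = a' + of_real s' * d" "0 \<le> s" "s < l" "0 \<le> s'" "s' < l'" for a a' l l' s s'
  proof
    assume "s < s'"
    note D = dir_edgeD[OF that(1)] and D' = dir_edgeD[OF that(2)]
    have "a = a' + of_real s' * d - of_real s * d" using that(3) by (simp add: algebra_simps)
    then have "a = a' + of_real (s' - s) * d" by (simp add: algebra_simps)
    moreover have "germ H (a' + of_real (s' - s) * d) (-d)"
      using segment_germs(2)[OF H D'(1-3), of "s' - s"] that \<open>s < s'\<close> by simp
    ultimately show False using D(5) by simp
  qed
  have "s = s'" using start1[OF e e' eq s] start1[OF e' e eq[symmetric] s(3,4,1,2)] by simp
  moreover have "l - s = l' - s'" using end1[OF e e' eq s] end1[OF e' e eq[symmetric] s(3,4,1,2)] by simp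
  ultimately show ?thesis using eq by simp
qed

section \<open>Edges and vertices\<close>

lemma dir_edge_germs:
  assumes "hole H" "dir_edge H a d l"
  shows "0 \<le> s \<Longrightarrow> s < l \<Longrightarrow> germ H (a + of_real s * d) d"
    "0 < s \<Longrightarrow> s \<le> l \<Longrightarrow> germ H (a + of_real s * d) (-d)"
    "germ H a d" "germ H (a + of_real l * d) (-d)"
proof -
  note D = dir_edgeD[OF assms(2)]
  note G = segment_germs[OF assms(1) D(1-3)]
  show "0 \<le> s \<Longrightarrow> s < l \<Longrightarrow> germ H (a + of_real s * d) d"
    "0 < s \<Longrightarrow> s \<le> l \<Longrightarrow> germ H (a + of_real s * d) (-d)" using G by auto
  show "germ H a d" "germ H (a + of_real l * d) (-d)" using G(1)[of 0] G(2)[of l] D(2) by auto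
qed

lemma dir_edge_quads:
  assumes "hole H" "dir_edge H a d l"
  shows "0 \<le> s \<Longrightarrow> s < l \<Longrightarrow> quad H (a + of_real s * d) d = quad H a d"
    "0 \<le> s \<Longrightarrow> s < l \<Longrightarrow> quad H (a + of_real s * d) (-(\<i> * d)) = (\<not> quad H a d)"
    "0 < s \<Longrightarrow> s \<le> l \<Longrightarrow> quad H (a + of_real s * d) (\<i> * d) = quad H a d"
    "0 < s \<Longrightarrow> s \<le> l \<Longrightarrow> quad H (a + of_real s * d) (-d) = (\<not> quad H a d)"
    "quad H (a + of_real l * d) d = quad H (a + of_real l * d) (-(\<i> * d))"
    "quad H a (-d) = quad H a (\<i> * d)"
proof -
  note D = dir_edgeD[OF assms(2)]
  show "0 \<le> s \<Longrightarrow> s < l \<Longrightarrow> quad H (a + of_real s * d) d = quad H a d"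
    "0 \<le> s \<Longrightarrow> s < l \<Longrightarrow> quad H (a + of_real s * d) (-(\<i> * d)) = (\<not> quad H a d)"
    "0 < s \<Longrightarrow> s \<le> l \<Longrightarrow> quad H (a + of_real s * d) (\<i> * d) = quad H a d"
    "0 < s \<Longrightarrow> s \<le> l \<Longrightarrow> quad H (a + of_real s * d) (-d) = (\<not> quad H a d)"
    using segment_quads[OF assms(1) D(1-3)] by blast+
  show "quad H (a + of_real l * d) d = quad H (a + of_real l * d) (-(\<i> * d))"
    "quad H a (-d) = quad H a (\<i> * d)"
    using D(4,5) unfolding germ_uminus unfolding germ_def by simp_all
qed

lemma collinear_param:
  fixes u v :: complex
  assumes "x \<in> closed_segment u v" "y \<in> closed_segment u v" "z \<in> closed_segment u v" "x \<noteq> y"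
  shows "\<exists>t. z = x + of_real t * (y - x)"
proof -
  obtain \<alpha> where a: "x = (1 - \<alpha>) *\<^sub>R u + \<alpha> *\<^sub>R v" using assms(1) unfolding closed_segment_def by blast
  obtain \<beta> where b: "y = (1 - \<beta>) *\<^sub>R u + \<beta> *\<^sub>R v" using assms(2) unfolding closed_segment_def by blast
  obtain \<gamma> where c: "z = (1 - \<gamma>) *\<^sub>R u + \<gamma> *\<^sub>R v" using assms(3) unfolding closed_segment_def by blast
  have ne: "\<beta> - \<alpha> \<noteq> 0" using assms(4) a b by auto
  have xy: "x - z = of_real (\<alpha> - \<gamma>) * (v - u)" "y - x = of_real (\<beta> - \<alpha>) * (v - u)"
    unfolding a b c by (simp_all add: scaleR_conv_of_real algebra_simps)
  have "of_real ((\<gamma> - \<alpha>) / (\<beta> - \<alpha>)) * (y - x) = of_real ((\<gamma> - \<alpha>) / (\<beta> - \<alpha>) * (\<beta> - \<alpha>)) * (v - u)"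
    unfolding xy(2) of_real_mult by (simp only: mult.assoc)
  also have "\<dots> = of_real (\<gamma> - \<alpha>) * (v - u)" using ne by simp
  also have "\<dots> = z - x" using xy(1) by (simp add: algebra_simps)
  finally show ?thesis by (intro exI[of _ "(\<gamma> - \<alpha>) / (\<beta> - \<alpha>)"]) simp
qed

lemma edges_subset_frontier: "e \<in> edges H \<Longrightarrow> e \<subseteq> frontier H"
  unfolding edges_def by (elim CollectE conjE)

lemma edges_maximal:
  "e \<in> edges H \<Longrightarrow> e \<subseteq> closed_segment x y \<Longrightarrow> closed_segment x y \<subseteq> frontier H \<Longrightarrow> closed_segment x y = e"
  unfolding edges_def by (elim CollectE conjE) simp

text \<open>A segment containing the edge is collinear with it, and reaching beyond an end it would
  produce a germ there.\<close>

lemma dir_edge_in_edges: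
  assumes H: "hole H" and e: "dir_edge H a d l"
  shows "closed_segment a (a + of_real l * d) \<in> edges H"
proof -
  note D = dir_edgeD[OF e]
  define b where "b = a + of_real l * d"
  have l0: "0 \<le> l" using D(2) by simp
  have ab: "a \<noteq> b" using D(1,2) by (auto simp: b_def dirs_def)
  have sub: "closed_segment a b \<subseteq> frontier H"
  proof
    fix z assume "z \<in> closed_segment a b"
    then obtain t where "0 \<le> t" "t \<le> l" "z = a + of_real t * d"
      unfolding b_def in_ray_segment[OF D(1) l0] by (elim exE conjE)
    then show "z \<in> frontier H" using D(3) by simp
  qed
  have max: "closed_segment u v = closed_segment a b"
    if uv: "closed_segment a b \<subseteq> closed_segment u v" "closed_segment u v \<subseteq> frontier H" for u v
  proof
    have in_uv: "a \<in> closed_segment u v" "b \<in> closed_segment u v" using uv(1) by auto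
    have seg: "closed_segment x y \<subseteq> frontier H" if xy: "x \<in> closed_segment u v" "y \<in> closed_segment u v" for x y
    proof -
      have "closed_segment x y \<subseteq> closed_segment u v" unfolding subset_closed_segment using xy by simp
      then show ?thesis using uv(2) by (rule order_trans)
    qed
    show "closed_segment u v \<subseteq> closed_segment a b"
    proof
      fix z assume z: "z \<in> closed_segment u v"
      obtain t where "z = a + of_real t * (b - a)" using collinear_param[OF in_uv z ab] by blast
      then have z1: "z = a + of_real (t * l) * d" by (simp add: b_def)
      define \<sigma> where "\<sigma> = t * l"
      have z2: "z = a + of_real \<sigma> * d" using z1 by (simp add: \<sigma>_def)
      have "\<not> \<sigma> > l"
      proof
        assume \<sigma>: "\<sigma> > l"
        have zb: "z = b + of_real (\<sigma> - l) * d" unfolding z2 b_def by (simp add: algebra_simps)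
        have \<sigma>0: "0 \<le> \<sigma> - l" using \<sigma> by simp
        have "b + of_real s * d \<in> frontier H" if s: "0 < s" "s < \<sigma> - l" for s
        proof -
          have "b + of_real s * d \<in> closed_segment b z"
            unfolding zb in_ray_segment[OF D(1) \<sigma>0] using s by (intro exI[of _ s]) simp
          then show ?thesis by (rule subsetD[OF seg[OF in_uv(2) z]])
        qed
        then have "germ H b d" using germI[OF H D(1), of "\<sigma> - l" b] \<sigma> by simp
        then show False using D(4) by (simp add: b_def)
      qed
      moreover have "\<not> \<sigma> < 0"
      proof
        assume \<sigma>: "\<sigma> < 0"
        have nd: "-d \<in> dirs" using D(1) by simp
        have za: "z = a + of_real (- \<sigma>) * (-d)" unfolding z2 by simp
        have \<sigma>0: "0 \<le> - \<sigma>" using \<sigma> by simp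
        have "a + of_real s * (-d) \<in> frontier H" if s: "0 < s" "s < - \<sigma>" for s
        proof -
          have "a + of_real s * (-d) \<in> closed_segment a z"
            unfolding za in_ray_segment[OF nd \<sigma>0] using s by (intro exI[of _ s]) simp
          then show ?thesis by (rule subsetD[OF seg[OF in_uv(1) z]])
        qed
        then have "germ H a (-d)" using germI[OF H nd, of "-\<sigma>" a] \<sigma> by simp
        then show False using D(5) by simp
      qed
      ultimately have "0 \<le> \<sigma> \<and> \<sigma> \<le> l \<and> z = a + of_real \<sigma> * d" using z2 by simp
      then show "z \<in> closed_segment a b"
        unfolding b_def in_ray_segment[OF D(1) l0] by (intro exI[of _ \<sigma>]) simp
    qed
  qed (rule uv(1))
  show ?thesis
    unfolding edges_def b_def[symmetric]
  proof (intro CollectI conjI allI impI)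
    show "\<exists>x y. x \<noteq> y \<and> closed_segment a b = closed_segment x y"
      using ab by (intro exI[of _ a] exI[of _ b]) simp
    show "closed_segment a b \<subseteq> frontier H" by (rule sub)
    fix x y assume "closed_segment a b \<subseteq> closed_segment x y \<and> closed_segment x y \<subseteq> frontier H"
    then show "closed_segment x y = closed_segment a b" by (elim conjE) (rule max)
  qed
qed

text \<open>\<open>edges\<close> admits segments of any slope; a boundary segment is axis-parallel
  because it starts within the cross at \<open>u\<close>.\<close>

lemma segment_direction:
  assumes H: "hole H" and uv: "u \<noteq> v" "closed_segment u v \<subseteq> frontier H"
  obtains d l where "d \<in> dirs" "l > 0" "v = u + of_real l * d"
proof -
  obtain r where r: "r > 0" "\<forall>z\<in>frontier H. dist u z < r \<longrightarrow> Re z = Re u \<or> Im z = Im u"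
    using hole_facts(2)[OF H] unfolding cross_like_def by blast
  define \<epsilon> where "\<epsilon> = min 1 (r / (2 * norm (v - u)))"
  have n: "norm (v - u) > 0" using uv(1) by simp
  have \<epsilon>: "0 < \<epsilon>" "\<epsilon> \<le> 1" using r n by (auto simp: \<epsilon>_def)
  define z where "z = u + of_real \<epsilon> * (v - u)"
  have "z = (1 - \<epsilon>) *\<^sub>R u + \<epsilon> *\<^sub>R v" by (simp add: z_def scaleR_conv_of_real algebra_simps)
  then have "z \<in> closed_segment u v" using \<epsilon> unfolding closed_segment_def by auto
  moreover have "dist u z < r"
  proof -
    have "dist u z = \<epsilon> * norm (v - u)" using \<epsilon> by (simp add: z_def dist_norm norm_mult)
    also have "\<dots> \<le> r / (2 * norm (v - u)) * norm (v - u)" by (intro mult_right_mono) (auto simp: \<epsilon>_def)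
    also have "\<dots> = r / 2" using n by simp
    finally show ?thesis using r by simp
  qed
  ultimately have "Re z = Re u \<or> Im z = Im u" using r uv(2) by blast
  then have "Re v = Re u \<or> Im v = Im u" using \<epsilon> by (auto simp: z_def)
  moreover have "Re v \<noteq> Re u \<or> Im v \<noteq> Im u" using uv(1) by (auto simp: complex_eq_iff)
  ultimately consider "Im v = Im u" "Re v > Re u" | "Im v = Im u" "Re v < Re u"
    | "Re v = Re u" "Im v > Im u" | "Re v = Re u" "Im v < Im u" by linarith
  then show thesis
  proof cases
    case 1 then show ?thesis using that[of 1 "Re v - Re u"] by (simp add: complex_eq_iff)
  next
    case 2 then show ?thesis using that[of "-1" "Re u - Re v"] by (simp add: complex_eq_iff)
  next
    case 3 then show ?thesis using that[of \<i> "Im v - Im u"] by (simp add: complex_eq_iff)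
  next
    case 4 then show ?thesis using that[of "-\<i>" "Im u - Im v"] by (simp add: complex_eq_iff)
  qed
qed

lemma segment_within_dir_edge:
  assumes H: "hole H" and d: "d \<in> dirs" and l: "l > 0"
    and sub: "closed_segment u (u + of_real l * d) \<subseteq> frontier H"
  obtains a l' s where "dir_edge H a d l'" "0 \<le> s" "s + l \<le> l'" "u = a + of_real s * d"
proof -
  have on: "u + of_real t * d \<in> frontier H" if t: "0 \<le> t" "t \<le> l" for t
  proof -
    have "0 \<le> l" using l by simp
    then have "u + of_real t * d \<in> closed_segment u (u + of_real l * d)"
      unfolding in_ray_segment[OF d \<open>0 \<le> l\<close>] using t by (intro exI[of _ t]) simp
    then show ?thesis by (rule subsetD[OF sub])
  qed
  have "germ H u d" using germI[OF H d l, of u] on by simp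
  then obtain a l' s where a: "dir_edge H a d l'" "0 \<le> s" "s < l'" "u = a + of_real s * d"
    by (rule germ_dir_edge[OF H d])
  note D = dir_edgeD[OF a(1)]
  have "s + l \<le> l'"
  proof (rule ccontr)
    assume c: "\<not> s + l \<le> l'"
    have "germ H (a + of_real l' * d) d"
    proof (rule germI[OF H d, of "s + l - l'"])
      fix t assume t: "0 < t" "t < s + l - l'"
      have eq: "a + of_real l' * d + of_real t * d = u + of_real (l' - s + t) * d"
        unfolding a(4) by (simp add: algebra_simps)
      show "a + of_real l' * d + of_real t * d \<in> frontier H"
        unfolding eq using on[of "l' - s + t"] t a(3) by simp
    qed (use c in simp)
    then show False using D(4) by simp
  qed
  then show thesis using that a by blast
qed

lemma edges_iff:
  assumes H: "hole H"
  shows "e \<in> edges H \<longleftrightarrow> (\<exists>a d l. dir_edge H a d l \<and> e = closed_segment a (a + of_real l * d))"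
proof
  assume e: "e \<in> edges H"
  then obtain u v where uv: "u \<noteq> v" "e = closed_segment u v"
    unfolding edges_def by (elim CollectE conjE exE)
  note uv = uv edges_subset_frontier[OF e]
  have sub: "closed_segment u v \<subseteq> frontier H" using uv by simp
  obtain d l where d: "d \<in> dirs" "l > 0" "v = u + of_real l * d"
    by (rule segment_direction[OF H uv(1) sub])
  obtain a l' s where a: "dir_edge H a d l'" "0 \<le> s" "s + l \<le> l'" "u = a + of_real s * d"
    by (rule segment_within_dir_edge[OF H d(1,2) sub[unfolded d(3)]])
  note D = dir_edgeD[OF a(1)]
  have seg: "z \<in> closed_segment a (a + of_real l' * d) \<longleftrightarrow> (\<exists>t. 0 \<le> t \<and> t \<le> l' \<and> z = a + of_real t * d)" for z
    using in_ray_segment[OF D(1)] D(2) by simp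
  have v: "v = a + of_real (s + l) * d" unfolding d(3) a(4) by (simp add: algebra_simps)
  have "u \<in> closed_segment a (a + of_real l' * d)"
    unfolding seg using a d(2) by (intro exI[of _ s]) auto
  moreover have "v \<in> closed_segment a (a + of_real l' * d)"
    unfolding seg using a d(2) v by (intro exI[of _ "s + l"]) auto
  ultimately have 1: "e \<subseteq> closed_segment a (a + of_real l' * d)"
    unfolding uv(2) by (simp add: subset_closed_segment)
  have 2: "closed_segment a (a + of_real l' * d) \<subseteq> frontier H"
  proof
    fix z assume "z \<in> closed_segment a (a + of_real l' * d)"
    then obtain t where "0 \<le> t" "t \<le> l'" "z = a + of_real t * d" unfolding seg by blast
    then show "z \<in> frontier H" using D(3) by simp
  qed
  have "closed_segment a (a + of_real l' * d) = e" by (rule edges_maximal[OF e 1 2])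
  then show "\<exists>a d l. dir_edge H a d l \<and> e = closed_segment a (a + of_real l * d)"
    using a(1) by (intro exI[of _ a] exI[of _ d] exI[of _ l']) simp
next
  assume "\<exists>a d l. dir_edge H a d l \<and> e = closed_segment a (a + of_real l * d)"
  then obtain a d l where "dir_edge H a d l" "e = closed_segment a (a + of_real l * d)" by (elim exE conjE)
  then show "e \<in> edges H" using dir_edge_in_edges[OF H] by simp
qed

lemma dir_edge_same_germ:
  assumes H: "hole H" and e: "dir_edge H a d l" "0 \<le> s" "s < l" "p = a + of_real s * d"
    and e': "dir_edge H a' d' l'" "p \<in> closed_segment a' (a' + of_real l' * d')" and dd: "d' = d \<or> d' = -d"
    and g: "germ H p d"
  shows "closed_segment a' (a' + of_real l' * d') = closed_segment a (a + of_real l * d)"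
proof -
  have *: ?thesis if f: "dir_edge H c d m" "p \<in> closed_segment c (c + of_real m * d)"
    "closed_segment a' (a' + of_real l' * d') = closed_segment c (c + of_real m * d)" for c m
  proof -
    note D = dir_edgeD[OF f(1)]
    obtain t where t: "0 \<le> t" "t \<le> m" "p = c + of_real t * d"
      using f(2) in_ray_segment[OF D(1), of m p c] D(2) by auto
    have "t \<noteq> m" using g D(4) t(3) by auto
    then have "c = a \<and> m = l" using dir_edge_unique[OF H f(1) e(1), of t s] t e by simp
    then show ?thesis using f(3) by simp
  qed
  show ?thesis
  proof (cases "d' = d")
    case True
    then show ?thesis using *[of a' l'] e' by simp
  next
    case False
    then have d': "d' = -d" using dd by simp
    have r: "dir_edge H (a' + of_real l' * d') d l'" using dir_edge_reverse[OF e'(1)] d' by simp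
    have "a' + of_real l' * d' + of_real l' * d = a'" using d' by simp
    then have eq: "closed_segment a' (a' + of_real l' * d') =
      closed_segment (a' + of_real l' * d') (a' + of_real l' * d' + of_real l' * d)"
      by (metis closed_segment_commute)
    show ?thesis by (rule *[OF r e'(2)[unfolded eq] eq])
  qed
qed

text \<open>At a point where every germ has its opposite, all edges through it lie in one line and
  coincide; so different edges meet exactly where the boundary turns.\<close>

lemma vertices_iff:
  assumes H: "hole H"
  shows "p \<in> vertices H \<longleftrightarrow> (\<exists>d\<in>dirs. germ H p d \<and> \<not> germ H p (-d))"
proof
  assume "\<exists>d\<in>dirs. germ H p d \<and> \<not> germ H p (-d)"
  then obtain d where d: "d \<in> dirs" "germ H p d" "\<not> germ H p (-d)" by blast
  \<comment> \<open>The other direction in which the boundary leaves the corner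
    \<open>p\<close>.\<close>
  define d' where "d' = (if germ H p (\<i> * d) then \<i> * d else -(\<i> * d))"
  have d': "d' \<in> dirs" "germ H p d'" using d two_germs[OF H d] by (auto simp: d'_def)
  have nd: "d' \<noteq> d" "d' \<noteq> -d" using d(1) by (auto simp: d'_def dirs_def complex_eq_iff)
  obtain a l s where a: "dir_edge H a d l" "0 \<le> s" "s < l" "p = a + of_real s * d"
    by (rule germ_dir_edge[OF H d(1,2)])
  obtain a' l' s' where a': "dir_edge H a' d' l'" "0 \<le> s'" "s' < l'" "p = a' + of_real s' * d'"
    by (rule germ_dir_edge[OF H d'])
  let ?e = "closed_segment a (a + of_real l * d)" and ?e' = "closed_segment a' (a' + of_real l' * d')"
  have seg: "z \<in> ?e \<longleftrightarrow> (\<exists>t. 0 \<le> t \<and> t \<le> l \<and> z = a + of_real t * d)" for z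
    using in_ray_segment[OF d(1)] dir_edgeD(2)[OF a(1)] by simp
  have seg': "z \<in> ?e' \<longleftrightarrow> (\<exists>t. 0 \<le> t \<and> t \<le> l' \<and> z = a' + of_real t * d')" for z
    using in_ray_segment[OF d'(1)] dir_edgeD(2)[OF a'(1)] by simp
  have "?e \<noteq> ?e'"
  proof
    assume eq: "?e = ?e'"
    have "a + of_real l * d \<in> ?e'" unfolding eq[symmetric] by simp
    then obtain t where t: "a + of_real l * d = a' + of_real t * d'" unfolding seg' by blast
    have "of_real (l - s) * d = (a + of_real l * d) - p" unfolding a(4) by (simp add: algebra_simps)
    also have "\<dots> = of_real (t - s') * d'" unfolding t unfolding a'(4) by (simp add: algebra_simps)
    finally have "of_real (l - s) * d = of_real (t - s') * d'" .
    moreover have "l - s \<noteq> 0" using a by simp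
    ultimately show False using d(1) d'(1) nd by (auto simp: dirs_def complex_eq_iff)
  qed
  moreover have "p \<in> ?e" unfolding seg using a by (intro exI[of _ s]) auto
  moreover have "p \<in> ?e'" unfolding seg' using a' by (intro exI[of _ s']) auto
  ultimately show "p \<in> vertices H"
    unfolding vertices_def using dir_edge_in_edges[OF H a(1)] dir_edge_in_edges[OF H a'(1)]
    by (intro CollectI bexI[of _ ?e] bexI[of _ ?e'] conjI)
next
  assume "p \<in> vertices H"
  then obtain e e' where ee: "e \<in> edges H" "e' \<in> edges H" "e \<noteq> e'" "p \<in> e" "p \<in> e'"
    unfolding vertices_def by blast
  show "\<exists>d\<in>dirs. germ H p d \<and> \<not> germ H p (-d)"
  proof (rule ccontr)
    assume c: "\<not> ?thesis"
    have sym: "germ H p (-d)" if "d \<in> dirs" "germ H p d" for d using c that by blast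
    have "p \<in> frontier H" using subsetD[OF edges_subset_frontier[OF ee(1)] ee(4)] .
    then obtain g where g: "g \<in> dirs" "germ H p g" using frontier_has_germ[OF H] by blast
    note gs = g sym[OF g]
    obtain a0 l0 s0 where a0: "dir_edge H a0 g l0" "0 \<le> s0" "s0 < l0" "p = a0 + of_real s0 * g"
      by (rule germ_dir_edge[OF H g])
    have "f = closed_segment a0 (a0 + of_real l0 * g)" if f: "f \<in> edges H" "p \<in> f" for f
    proof -
      obtain a d l where a: "dir_edge H a d l" "f = closed_segment a (a + of_real l * d)"
        using f(1) unfolding edges_iff[OF H] by (elim exE conjE)
      note D = dir_edgeD[OF a(1)]
      obtain t where t: "0 \<le> t" "t \<le> l" "p = a + of_real t * d"
        using f(2) in_ray_segment[OF D(1), of l p a] D(2) a(2) by auto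
      have "germ H p d \<or> germ H p (-d)"
        using dir_edge_germs(1,2)[OF H a(1), of t] t D(2) by (cases "t < l") auto
      then have "d \<in> {g, -g}"
        using straight_quads(3,4)[OF H gs] D(1) g(1) by (auto simp: dirs_def)
      then have "d = g \<or> d = -g" by simp
      then show ?thesis using dir_edge_same_germ[OF H a0 a(1) _ _ g(2)] f(2) a(2) by simp
    qed
    from this[OF ee(1,4)] this[OF ee(2,5)] ee(3) show False by simp
  qed
qed

lemma dir_edge_endpoints_vertices:
  assumes H: "hole H" and e: "dir_edge H a d l"
  shows "a \<in> vertices H" "a + of_real l * d \<in> vertices H"
    "0 < s \<Longrightarrow> s < l \<Longrightarrow> a + of_real s * d \<notin> vertices H"
proof -
  note D = dir_edgeD[OF e] and G = dir_edge_germs[OF H e]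
  show "a \<in> vertices H" unfolding vertices_iff[OF H] using G(3) D by blast
  show "a + of_real l * d \<in> vertices H" unfolding vertices_iff[OF H]
    using G(4) D by (intro bexI[of _ "-d"]) auto
  assume s: "0 < s" "s < l"
  show "a + of_real s * d \<notin> vertices H"
  proof
    let ?x = "a + of_real s * d"
    have g: "germ H ?x d" "germ H ?x (-d)" using G(1,2)[of s] s by auto
    assume "?x \<in> vertices H"
    then obtain d' where d': "d' \<in> dirs" "germ H ?x d'" "\<not> germ H ?x (-d')"
      unfolding vertices_iff[OF H] by blast
    have "d' \<noteq> d" "d' \<noteq> -d" using g d' by auto
    then have "d' = \<i> * d \<or> d' = -(\<i> * d)" using d'(1) D(1) by (auto simp: dirs_def)
    then show False using straight_quads(3,4)[OF H D(1) g] d'(2) by auto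
  qed
qed

lemma rel_interior_dir_segment:
  assumes "d \<in> dirs" "l > 0"
  shows "z \<in> rel_interior (closed_segment a (a + of_real l * d)) \<longleftrightarrow> (\<exists>t. 0 < t \<and> t < l \<and> z = a + of_real t * d)"
proof -
  have ne: "a \<noteq> a + of_real l * d" using assms by (auto simp: dirs_def)
  have "rel_interior (closed_segment a (a + of_real l * d)) = open_segment a (a + of_real l * d)"
    using ne rel_interior_closed_segment[of a "a + of_real l * d"] by simp
  moreover have "z \<in> open_segment a (a + of_real l * d) \<longleftrightarrow> (\<exists>t. 0 < t \<and> t < l \<and> z = a + of_real t * d)"
  proof
    assume z: "z \<in> open_segment a (a + of_real l * d)"
    then obtain t where t: "0 \<le> t" "t \<le> l" "z = a + of_real t * d"
      using in_ray_segment[OF assms(1), of l z a] assms(2) by (auto simp: open_segment_def)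
    moreover have "t \<noteq> 0" "t \<noteq> l" using z t by (auto simp: open_segment_def)
    ultimately show "\<exists>t. 0 < t \<and> t < l \<and> z = a + of_real t * d" by (metis less_eq_real_def)
  next
    assume "\<exists>t. 0 < t \<and> t < l \<and> z = a + of_real t * d"
    then obtain t where t: "0 < t" "t < l" "z = a + of_real t * d" by blast
    then have "z \<noteq> a" "z \<noteq> a + of_real l * d" using assms(1) by (auto simp: dirs_def)
    then show "z \<in> open_segment a (a + of_real l * d)"
      using in_ray_segment[OF assms(1), of l z a] t assms(2) by (auto simp: open_segment_def)
  qed
  ultimately show ?thesis by simp
qed

text \<open>\<open>interior_near\<close> quantifies over the relative interior of the edge, where
  each side has constant status, so one end decides.\<close>

lemma interior_near_iff:
  assumes H: "hole H" and e: "dir_edge H a d l"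
  shows "interior_near H (closed_segment a (a + of_real l * d)) (\<i> * d) \<longleftrightarrow> quad H a d"
    "interior_near H (closed_segment a (a + of_real l * d)) (-(\<i> * d)) \<longleftrightarrow> \<not> quad H a d"
proof -
  note D = dir_edgeD[OF e] and Q = dir_edge_quads[OF H e]
  \<comment> \<open>A ray that is not on the boundary has the status of the two quadrants bordering
    it.\<close>
  have key: "(\<forall>\<^sub>F t in at_right (0::real). x + of_real t * c \<in> interior H) \<longleftrightarrow> quad H x c"
    if c: "c \<in> dirs" "\<not> germ H x c" for x c
  proof -
    obtain r where r: "r > 0" "\<forall>d\<in>dirs. \<forall>s t. 0 < s \<and> s < r \<and> 0 < t \<and> t < r \<longrightarrow>
       x + of_real s * d + of_real t * (\<i> * d) \<notin> frontier H \<and>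
       (x + of_real s * d + of_real t * (\<i> * d) \<in> interior H \<longleftrightarrow> quad H x d)"
      "\<forall>d\<in>dirs. \<forall>s. 0 < s \<and> s < r \<longrightarrow> (x + of_real s * d \<in> frontier H \<longleftrightarrow> germ H x d) \<and>
      (x + of_real s * d \<in> interior H \<longleftrightarrow> quad H x d \<and> quad H x (-(\<i> * d)))"
      by (rule quad_local[OF H])
    have in_iff: "x + of_real s * c \<in> interior H \<longleftrightarrow> quad H x c" if "0 < s" "s < r" for s
      using r(3) c that unfolding germ_def by auto
    show ?thesis
    proof
      assume "\<forall>\<^sub>F t in at_right (0::real). x + of_real t * c \<in> interior H"
      then obtain b where b: "b > 0" "\<forall>y>0. y < b \<longrightarrow> x + of_real y * c \<in> interior H"
        unfolding eventually_at_right[OF zero_less_one] by blast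
      define s where "s = min b r / 2"
      have "0 < s" "s < b" "s < r" using b r by (auto simp: s_def)
      then show "quad H x c" using b(2) in_iff by blast
    next
      assume "quad H x c"
      then show "\<forall>\<^sub>F t in at_right (0::real). x + of_real t * c \<in> interior H"
        unfolding eventually_at_right[OF zero_less_one] using in_iff r(1) by blast
    qed
  qed
  have st: "quad H (a + of_real t * d) (\<i> * d) = quad H a d" "\<not> germ H (a + of_real t * d) (\<i> * d)"
    "quad H (a + of_real t * d) (-(\<i> * d)) = (\<not> quad H a d)" "\<not> germ H (a + of_real t * d) (-(\<i> * d))"
    if t: "0 < t" "t < l" for t
    using Q(1-4)[of t] t straight_quads(3,4)[OF H D(1) dir_edge_germs(1,2)[OF H e, of t]] by simp_all
  have id: "\<i> * d \<in> dirs" "-(\<i> * d) \<in> dirs" using D(1) by auto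
  have near: "(\<forall>p\<in>rel_interior (closed_segment a (a + of_real l * d)).
      \<forall>\<^sub>F t in at_right (0::real). p + of_real t * c \<in> interior H) \<longleftrightarrow> b"
    if c: "c \<in> dirs" "\<And>t. \<lbrakk>0 < t; t < l\<rbrakk> \<Longrightarrow> \<not> germ H (a + of_real t * d) c"
      "\<And>t. \<lbrakk>0 < t; t < l\<rbrakk> \<Longrightarrow> quad H (a + of_real t * d) c = b" for c b
  proof
    have half: "0 < l/2" "l/2 < l" using D(2) by auto
    assume "\<forall>p\<in>rel_interior (closed_segment a (a + of_real l * d)).
      \<forall>\<^sub>F t in at_right (0::real). p + of_real t * c \<in> interior H"
    moreover have "a + of_real (l/2) * d \<in> rel_interior (closed_segment a (a + of_real l * d))"
      unfolding rel_interior_dir_segment[OF D(1,2)] using half by blast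
    ultimately have "\<forall>\<^sub>F t in at_right (0::real). a + of_real (l/2) * d + of_real t * c \<in> interior H" by blast
    then show b unfolding key[OF c(1) c(2)[OF half]] c(3)[OF half] .
  next
    assume b: b
    show "\<forall>p\<in>rel_interior (closed_segment a (a + of_real l * d)).
      \<forall>\<^sub>F t in at_right (0::real). p + of_real t * c \<in> interior H"
    proof
      fix p assume "p \<in> rel_interior (closed_segment a (a + of_real l * d))"
      then obtain t where t: "0 < t" "t < l" "p = a + of_real t * d"
        unfolding rel_interior_dir_segment[OF D(1,2)] by blast
      show "\<forall>\<^sub>F t in at_right (0::real). p + of_real t * c \<in> interior H"
        unfolding t(3) key[OF c(1) c(2)[OF t(1,2)]] c(3)[OF t(1,2)] using b .
    qed
  qed
  show "interior_near H (closed_segment a (a + of_real l * d)) (\<i> * d) \<longleftrightarrow> quad H a d"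
    unfolding interior_near_def
    by (rule near[OF id(1) st(2,1)])
  show "interior_near H (closed_segment a (a + of_real l * d)) (-(\<i> * d)) \<longleftrightarrow> \<not> quad H a d"
    unfolding interior_near_def
    by (rule near[OF id(2) st(4,3)])
qed

lemma inner_dirs:
  assumes "d \<in> dirs" shows "(\<i> * d) \<bullet> d = 0" "d \<bullet> (\<i> * d) = 0" "d \<bullet> d = 1"
  using assms by (auto simp: dirs_def inner_complex_def)

lemma vertex_on_dir_edge:
  assumes H: "hole H" and e: "dir_edge H a d l"
    and v: "v \<in> vertices H" "v \<in> closed_segment a (a + of_real l * d)"
  shows "v = a \<or> v = a + of_real l * d"
proof -
  note D = dir_edgeD[OF e]
  have l0: "0 \<le> l" using D(2) by simp
  obtain t where t: "0 \<le> t" "t \<le> l" "v = a + of_real t * d"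
    using v(2) unfolding in_ray_segment[OF D(1) l0] by (elim exE conjE)
  have "t = 0 \<or> t = l"
    using dir_edge_endpoints_vertices(3)[OF H e, of t] t v(1) by fastforce
  then show ?thesis using t(3) by auto
qed

text \<open>Edges meet at endpoints. Oriented to start at the common vertex, the second edge cannot
  run along the first, as they would then coincide, nor prolong it, by maximality; a right angle
  remains.\<close>

lemma adjacent_dir_edge:
  assumes H: "hole H" and e: "dir_edge H a d l"
    and adj: "adjacent H (closed_segment a (a + of_real l * d)) e'"
  obtains v x m where "v = a \<or> v = a + of_real l * d" "dir_edge H v x m"
    "e' = closed_segment v (v + of_real m * x)" "x = \<i> * d \<or> x = -(\<i> * d)"
proof -
  note D = dir_edgeD[OF e] and G = dir_edge_germs[OF H e]
  define ee where "ee = closed_segment a (a + of_real l * d)"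
  have e': "e' \<in> edges H" "e' \<noteq> ee" "ee \<in> edges H" "ee \<inter> e' \<noteq> {}"
    using adj unfolding adjacent_def ee_def by auto
  obtain v where v: "v \<in> ee" "v \<in> e'" using e'(4) by blast
  have vv: "v \<in> vertices H" unfolding vertices_def using v e'
    by (intro CollectI bexI[of _ ee] bexI[of _ e'] conjI) auto
  obtain f where f: "v = a \<or> v = a + of_real l * d" "f = d \<or> f = -d" "dir_edge H v f l"
    "ee = closed_segment v (v + of_real l * f)"
  proof -
    have "v = a \<or> v = a + of_real l * d" using vertex_on_dir_edge[OF H e vv] v(1) unfolding ee_def by blast
    then show thesis
    proof (elim disjE)
      assume "v = a" then show thesis using that[of d] e by (simp add: ee_def)
    next
      assume va: "v = a + of_real l * d"
      have "v + of_real l * (-d) = a" by (simp add: va)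
      then have "ee = closed_segment v (v + of_real l * (-d))"
        unfolding ee_def va by (metis closed_segment_commute)
      then show thesis using that[of "-d"] dir_edge_reverse[OF e] va by simp
    qed
  qed
  obtain a' d' l' where a': "dir_edge H a' d' l'" "e' = closed_segment a' (a' + of_real l' * d')"
    using e'(1) unfolding edges_iff[OF H] by (elim exE conjE)
  obtain x where x: "dir_edge H v x l'" "e' = closed_segment v (v + of_real l' * x)"
  proof -
    have "v = a' \<or> v = a' + of_real l' * d'" using vertex_on_dir_edge[OF H a'(1) vv] v(2) unfolding a'(2) by blast
    then show thesis
    proof (elim disjE)
      assume "v = a'" then show thesis using that[of d'] a' by simp
    next
      assume va: "v = a' + of_real l' * d'"
      have "v + of_real l' * (-d') = a'" by (simp add: va)
      then have "e' = closed_segment v (v + of_real l' * (-d'))"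
        unfolding a'(2) va by (metis closed_segment_commute)
      then show thesis using that[of "-d'"] dir_edge_reverse[OF a'(1)] va by simp
    qed
  qed
  note Dx = dir_edgeD[OF x(1)] and Gx = dir_edge_germs(3)[OF H x(1)]
  note Df = dir_edgeD[OF f(3)] and Gf = dir_edge_germs(3)[OF H f(3)]
  have "x \<noteq> f"
  proof
    assume xf: "x = f"
    have "v + of_real 0 * f = v + of_real 0 * f" ..
    then have "l = l'" using dir_edge_unique[OF H f(3) x(1)[unfolded xf], of 0 0] D(2) Dx(2) by simp
    then show False using e'(2) x(2) f(4) xf by simp
  qed
  moreover have "x \<noteq> -f" using Df(5) Gx by auto
  ultimately have "x = \<i> * d \<or> x = -(\<i> * d)" using Dx(1) D(1) f(2) by (auto simp: dirs_def)
  then show thesis using that[OF f(1) x] by blast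
qed

text \<open>At each end the boundary goes on perpendicularly, along \<open>c\<close> or
  \<open>-c\<close>, and a neighbour along \<open>-c\<close> contains a point with negative inner
  product.\<close>

lemma neighbours_extend_iff:
  assumes H: "hole H" and e: "dir_edge H a d l" and c: "c = \<i> * d \<or> c = -(\<i> * d)"
  shows "neighbours_extend H (closed_segment a (a + of_real l * d)) c \<longleftrightarrow>
    germ H a c \<and> germ H (a + of_real l * d) c"
proof -
  note D = dir_edgeD[OF e] and G = dir_edge_germs[OF H e]
  let ?e = "closed_segment a (a + of_real l * d)"
  have c1: "c \<in> dirs" using c D(1) by (elim disjE) simp_all
  have "d \<bullet> c = 0" using c inner_dirs(2)[OF D(1)] by (elim disjE) simp_all
  note cd = c1 this inner_dirs(3)[OF c1]
  have seg: "z \<in> ?e \<longleftrightarrow> (\<exists>t. 0 \<le> t \<and> t \<le> l \<and> z = a + of_real t * d)" for z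
    using in_ray_segment[OF D(1)] D(2) by simp
  have e_edge: "?e \<in> edges H" using dir_edge_in_edges[OF H e] .
  have other: "germ H v c \<or> germ H v (-c)"
    if v: "(v = a \<and> f = d) \<or> (v = a + of_real l * d \<and> f = -d)" for v f
  proof -
    have f: "f \<in> dirs" "germ H v f" "\<not> germ H v (-f)" "f = d \<or> f = -d" using v G(3,4) D by auto
    show ?thesis using two_germs[OF H f(1-3)] c f(4) by auto
  qed
  have inner_e: "(y - x) \<bullet> c = (y - a) \<bullet> c" if x: "x \<in> ?e" for x y
  proof -
    obtain t where "x = a + of_real t * d" using x unfolding seg by (elim exE conjE)
    then have eq: "y - x = (y - a) - t *\<^sub>R d" by (simp add: scaleR_conv_of_real)
    show ?thesis unfolding eq inner_diff_left[of "y - a"] using cd(2) by simp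
  qed
  show ?thesis
  proof
    assume ne: "neighbours_extend H ?e c"
    have "germ H v c" if v: "(v = a \<and> f = d) \<or> (v = a + of_real l * d \<and> f = -d)" for v f
    proof (rule ccontr)
      assume "\<not> germ H v c"
      then have g: "germ H v (-c)" using other[OF v] by blast
      have nc: "-c \<in> dirs" using cd(1) by simp
      obtain a' l' s' where a': "dir_edge H a' (-c) l'" "0 \<le> s'" "s' < l'" "v = a' + of_real s' * (-c)"
        by (rule germ_dir_edge[OF H nc g])
      let ?e' = "closed_segment a' (a' + of_real l' * (-c))"
      define b' where "b' = a' + of_real l' * (-c)"
      have seg': "z \<in> ?e' \<longleftrightarrow> (\<exists>t. 0 \<le> t \<and> t \<le> l' \<and> z = a' + of_real t * (-c))" for z
        using in_ray_segment[OF nc] dir_edgeD(2)[OF a'(1)] by simp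
      have ve: "v \<in> ?e" using v by (elim disjE conjE) simp_all
      have ve': "v \<in> ?e'" unfolding seg' using a' by (intro exI[of _ s']) simp
      have b': "b' \<in> ?e'" by (simp add: b'_def)
      have "b' - v = (l' - s') *\<^sub>R (-c)" unfolding b'_def a'(4) by (simp add: scaleR_conv_of_real algebra_simps)
      then have neg: "(b' - v) \<bullet> c < 0" using a'(3) cd(3) by simp
      have "?e' \<noteq> ?e"
      proof
        assume eq: "?e' = ?e"
        have be: "b' \<in> ?e" using b' unfolding eq .
        have "(b' - v) \<bullet> c = (b' - b') \<bullet> c" unfolding inner_e[OF ve, of b'] inner_e[OF be, of b'] ..
        then show False using neg unfolding diff_self inner_zero_left by linarith
      qed
      then have adj: "adjacent H ?e ?e'"
        unfolding adjacent_def using e_edge dir_edge_in_edges[OF H a'(1)] ve ve'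
        by (intro conjI) blast+
      have "0 \<le> (b' - v) \<bullet> c"
        by (rule ne[unfolded neighbours_extend_def, rule_format, OF adj ve b'])
      then show False using neg by linarith
    qed
    from this[of a d] this[of "a + of_real l * d" "-d"]
    show "germ H a c \<and> germ H (a + of_real l * d) c" by simp
  next
    assume g: "germ H a c \<and> germ H (a + of_real l * d) c"
    show "neighbours_extend H ?e c"
      unfolding neighbours_extend_def
    proof (intro allI impI ballI)
      fix e' p q assume adj: "adjacent H ?e e'" and p: "p \<in> ?e" and q: "q \<in> e'"
      obtain v x m where v: "v = a \<or> v = a + of_real l * d" and x: "dir_edge H v x m"
        "e' = closed_segment v (v + of_real m * x)" "x = \<i> * d \<or> x = -(\<i> * d)"
        by (rule adjacent_dir_edge[OF H e adj])
      note Dx = dir_edgeD[OF x(1)]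
      have ve: "v \<in> ?e" using v by (elim disjE) simp_all
      have gv: "germ H v c" using g v by (elim disjE) simp_all
      have "x \<noteq> -c" using Dx(5) gv by force
      then have xc: "x = c" using x(3) c by force
      have m0: "0 \<le> m" using Dx(2) by simp
      obtain t where t: "0 \<le> t" "q = v + of_real t * c"
        using q unfolding x(2) in_ray_segment[OF Dx(1) m0] unfolding xc by (elim exE conjE)
      have "q - v = t *\<^sub>R c" by (simp add: t(2) scaleR_conv_of_real)
      then have "0 \<le> (q - v) \<bullet> c" using t cd(3) by simp
      then show "0 \<le> (q - p) \<bullet> c" unfolding inner_e[OF p, of q] inner_e[OF ve, of q] .
    qed
  qed
qed

section \<open>Local characterisation of the edge types\<close>

text \<open>The four components are in the order NE, NW, SW, SE.\<close>

definition pat :: "complex set \<Rightarrow> complex \<Rightarrow> bool \<times> bool \<times> bool \<times> bool" where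
  "pat H p = (quad H p 1, quad H p \<i>, quad H p (-1), quad H p (-\<i>))"

lemma vertical_edge:
  assumes H: "hole H" and e: "e \<in> edges H" "vertical e"
  obtains a l where "dir_edge H a \<i> l" "e = closed_segment a (a + of_real l * \<i>)"
proof -
  obtain a d l where a: "dir_edge H a d l" "e = closed_segment a (a + of_real l * d)"
    using e(1) unfolding edges_iff[OF H] by (elim exE conjE)
  note D = dir_edgeD[OF a(1)]
  have "a \<in> e" "a + of_real l * d \<in> e" unfolding a(2) by simp_all
  then have "Re a = Re (a + of_real l * d)" using e(2) unfolding vertical_def by blast
  then have "d = \<i> \<or> d = -\<i>" using D(1,2) by (auto simp: dirs_def)
  then show thesis
  proof
    assume "d = \<i>" then show thesis using that a by simp
  next
    assume d: "d = -\<i>"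
    have "a + of_real l * d + of_real l * \<i> = a" using d by simp
    then have "e = closed_segment (a + of_real l * d) (a + of_real l * d + of_real l * \<i>)"
      unfolding a(2) by (metis closed_segment_commute)
    moreover have "dir_edge H (a + of_real l * d) \<i> l" using dir_edge_reverse[OF a(1)] d by simp
    ultimately show thesis using that by blast
  qed
qed

lemma horizontal_edge:
  assumes H: "hole H" and e: "e \<in> edges H" "horizontal e"
  obtains a l where "dir_edge H a 1 l" "e = closed_segment a (a + of_real l * 1)"
proof -
  obtain a d l where a: "dir_edge H a d l" "e = closed_segment a (a + of_real l * d)"
    using e(1) unfolding edges_iff[OF H] by (elim exE conjE)
  note D = dir_edgeD[OF a(1)]
  have "a \<in> e" "a + of_real l * d \<in> e" unfolding a(2) by simp_all
  then have "Im a = Im (a + of_real l * d)" using e(2) unfolding horizontal_def by blast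
  then have "d = 1 \<or> d = -1" using D(1,2) by (auto simp: dirs_def)
  then show thesis
  proof
    assume "d = 1" then show thesis using that a by simp
  next
    assume d: "d = -1"
    have "a + of_real l * d + of_real l * 1 = a" using d by simp
    then have "e = closed_segment (a + of_real l * d) (a + of_real l * d + of_real l * 1)"
      unfolding a(2) by (metis closed_segment_commute)
    moreover have "dir_edge H (a + of_real l * d) 1 l" using dir_edge_reverse[OF a(1)] d by simp
    ultimately show thesis using that by blast
  qed
qed

lemma vertical_segment: "vertical (closed_segment a (a + of_real l * \<i>))"
  unfolding vertical_def closed_segment_def by (auto simp: algebra_simps)

lemma horizontal_segment: "horizontal (closed_segment a (a + of_real l * 1))"
  unfolding horizontal_def closed_segment_def by (auto simp: algebra_simps)

lemma up_edge_quads: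
  assumes "hole H" "dir_edge H a \<i> l"
  shows "quad H a 1 = (\<not> quad H a \<i>)" "quad H a (-\<i>) = quad H a (-1)"
    "quad H (a + of_real l * \<i>) 1 = quad H (a + of_real l * \<i>) \<i>"
    "quad H (a + of_real l * \<i>) (-1) = quad H a \<i>"
    "quad H (a + of_real l * \<i>) (-\<i>) = (\<not> quad H a \<i>)"
    "0 < s \<Longrightarrow> s < l \<Longrightarrow> pat H (a + of_real s * \<i>) = (\<not> quad H a \<i>, quad H a \<i>, quad H a \<i>, \<not> quad H a \<i>)"
  using dir_edgeD(2)[OF assms(2)] dir_edge_quads(2)[OF assms, of 0] dir_edge_quads(3,4)[OF assms, of l]
    dir_edge_quads(5,6)[OF assms] dir_edge_quads(1-4)[OF assms, of s]
  by (simp_all add: pat_def)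

lemma right_edge_quads:
  assumes "hole H" "dir_edge H a 1 l"
  shows "quad H a (-\<i>) = (\<not> quad H a 1)" "quad H a (-1) = quad H a \<i>"
    "quad H (a + of_real l * 1) 1 = quad H (a + of_real l * 1) (-\<i>)"
    "quad H (a + of_real l * 1) \<i> = quad H a 1"
    "quad H (a + of_real l * 1) (-1) = (\<not> quad H a 1)"
    "0 < s \<Longrightarrow> s < l \<Longrightarrow> pat H (a + of_real s * 1) = (quad H a 1, quad H a 1, \<not> quad H a 1, \<not> quad H a 1)"
  using dir_edgeD(2)[OF assms(2)] dir_edge_quads(2)[OF assms, of 0] dir_edge_quads(3,4)[OF assms, of l]
    dir_edge_quads(5,6)[OF assms] dir_edge_quads(1-4)[OF assms, of s]
  by (simp_all add: pat_def)

lemma up_edge_types: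
  assumes H: "hole H" and e: "dir_edge H a \<i> l"
  shows "interior_near H (closed_segment a (a + of_real l * \<i>)) (-1) \<longleftrightarrow> quad H a \<i>"
    "interior_near H (closed_segment a (a + of_real l * \<i>)) 1 \<longleftrightarrow> \<not> quad H a \<i>"
    "neighbours_extend H (closed_segment a (a + of_real l * \<i>)) (-1) \<longleftrightarrow>
       quad H a (-1) \<noteq> quad H a \<i> \<and> quad H (a + of_real l * \<i>) (-1) \<noteq> quad H (a + of_real l * \<i>) \<i>"
    "neighbours_extend H (closed_segment a (a + of_real l * \<i>)) 1 \<longleftrightarrow>
       quad H a 1 \<noteq> quad H a (-\<i>) \<and> quad H (a + of_real l * \<i>) 1 \<noteq> quad H (a + of_real l * \<i>) (-\<i>)"
  using interior_near_iff[OF H e] neighbours_extend_iff[OF H e, of "-1"] neighbours_extend_iff[OF H e, of 1]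
  by (simp_all add: germ_def)

text \<open>In this and the four following characterisations the edge is oriented upwards or to the
  right by convention, whatever its clockwise direction; the two end patterns then carry all the
  information.\<close>

lemma rightmost_edge_iff:
  assumes H: "hole H"
  shows "rightmost_edge H e \<longleftrightarrow> (\<exists>a l. dir_edge H a \<i> l \<and> e = closed_segment a (a + of_real l * \<i>) \<and>
    pat H a = (False, True, False, False) \<and> pat H (a + of_real l * \<i>) = (False, False, True, False))"
proof
  assume r: "rightmost_edge H e"
  then obtain a l where a: "dir_edge H a \<i> l" "e = closed_segment a (a + of_real l * \<i>)"
    unfolding rightmost_edge_def by (elim conjE) (rule vertical_edge[OF H])
  have "interior_near H e (-1)" "neighbours_extend H e (-1)" using r unfolding rightmost_edge_def by simp_all
  then show "\<exists>a l. dir_edge H a \<i> l \<and> e = closed_segment a (a + of_real l * \<i>) \<and>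
    pat H a = (False, True, False, False) \<and> pat H (a + of_real l * \<i>) = (False, False, True, False)"
    unfolding a(2) up_edge_types[OF H a(1)] using up_edge_quads(1-5)[OF H a(1)] a(1)
    by (intro exI[of _ a] exI[of _ l]) (simp add: pat_def)
next
  assume "\<exists>a l. dir_edge H a \<i> l \<and> e = closed_segment a (a + of_real l * \<i>) \<and>
    pat H a = (False, True, False, False) \<and> pat H (a + of_real l * \<i>) = (False, False, True, False)"
  then obtain a l where a: "dir_edge H a \<i> l" "e = closed_segment a (a + of_real l * \<i>)"
    "pat H a = (False, True, False, False)" "pat H (a + of_real l * \<i>) = (False, False, True, False)"
    by (elim exE conjE)
  show "rightmost_edge H e" unfolding rightmost_edge_def a(2) up_edge_types[OF H a(1)]
    using dir_edge_in_edges[OF H a(1)] vertical_segment[of a l] a(3,4) by (simp add: pat_def)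
qed

lemma left_notch_iff:
  assumes H: "hole H"
  shows "left_notch H e \<longleftrightarrow> (\<exists>a l. dir_edge H a \<i> l \<and> e = closed_segment a (a + of_real l * \<i>) \<and>
    pat H a = (True, False, True, True) \<and> pat H (a + of_real l * \<i>) = (True, True, False, True))"
proof
  assume r: "left_notch H e"
  then obtain a l where a: "dir_edge H a \<i> l" "e = closed_segment a (a + of_real l * \<i>)"
    unfolding left_notch_def by (elim conjE) (rule vertical_edge[OF H])
  have "interior_near H e 1" "neighbours_extend H e (-1)" using r unfolding left_notch_def by simp_all
  then show "\<exists>a l. dir_edge H a \<i> l \<and> e = closed_segment a (a + of_real l * \<i>) \<and>
    pat H a = (True, False, True, True) \<and> pat H (a + of_real l * \<i>) = (True, True, False, True)"
    unfolding a(2) up_edge_types[OF H a(1)] using up_edge_quads(1-5)[OF H a(1)] a(1)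
    by (intro exI[of _ a] exI[of _ l]) (simp add: pat_def)
next
  assume "\<exists>a l. dir_edge H a \<i> l \<and> e = closed_segment a (a + of_real l * \<i>) \<and>
    pat H a = (True, False, True, True) \<and> pat H (a + of_real l * \<i>) = (True, True, False, True)"
  then obtain a l where a: "dir_edge H a \<i> l" "e = closed_segment a (a + of_real l * \<i>)"
    "pat H a = (True, False, True, True)" "pat H (a + of_real l * \<i>) = (True, True, False, True)"
    by (elim exE conjE)
  show "left_notch H e" unfolding left_notch_def a(2) up_edge_types[OF H a(1)]
    using dir_edge_in_edges[OF H a(1)] vertical_segment[of a l] a(3,4) by (simp add: pat_def)
qed

lemma leftmost_edge_iff:
  assumes H: "hole H"
  shows "leftmost_edge H e \<longleftrightarrow> (\<exists>a l. dir_edge H a \<i> l \<and> e = closed_segment a (a + of_real l * \<i>) \<and>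
    pat H a = (True, False, False, False) \<and> pat H (a + of_real l * \<i>) = (False, False, False, True))"
proof
  assume r: "leftmost_edge H e"
  then obtain a l where a: "dir_edge H a \<i> l" "e = closed_segment a (a + of_real l * \<i>)"
    unfolding leftmost_edge_def by (elim conjE) (rule vertical_edge[OF H])
  have "interior_near H e 1" "neighbours_extend H e 1" using r unfolding leftmost_edge_def by simp_all
  then show "\<exists>a l. dir_edge H a \<i> l \<and> e = closed_segment a (a + of_real l * \<i>) \<and>
    pat H a = (True, False, False, False) \<and> pat H (a + of_real l * \<i>) = (False, False, False, True)"
    unfolding a(2) up_edge_types[OF H a(1)] using up_edge_quads(1-5)[OF H a(1)] a(1)
    by (intro exI[of _ a] exI[of _ l]) (simp add: pat_def)
next
  assume "\<exists>a l. dir_edge H a \<i> l \<and> e = closed_segment a (a + of_real l * \<i>) \<and>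
    pat H a = (True, False, False, False) \<and> pat H (a + of_real l * \<i>) = (False, False, False, True)"
  then obtain a l where a: "dir_edge H a \<i> l" "e = closed_segment a (a + of_real l * \<i>)"
    "pat H a = (True, False, False, False)" "pat H (a + of_real l * \<i>) = (False, False, False, True)"
    by (elim exE conjE)
  show "leftmost_edge H e" unfolding leftmost_edge_def a(2) up_edge_types[OF H a(1)]
    using dir_edge_in_edges[OF H a(1)] vertical_segment[of a l] a(3,4) by (simp add: pat_def)
qed

lemma right_notch_iff:
  assumes H: "hole H"
  shows "right_notch H e \<longleftrightarrow> (\<exists>a l. dir_edge H a \<i> l \<and> e = closed_segment a (a + of_real l * \<i>) \<and>
    pat H a = (False, True, True, True) \<and> pat H (a + of_real l * \<i>) = (True, True, True, False))"
proof
  assume r: "right_notch H e"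
  then obtain a l where a: "dir_edge H a \<i> l" "e = closed_segment a (a + of_real l * \<i>)"
    unfolding right_notch_def by (elim conjE) (rule vertical_edge[OF H])
  have "interior_near H e (-1)" "neighbours_extend H e 1" using r unfolding right_notch_def by simp_all
  then show "\<exists>a l. dir_edge H a \<i> l \<and> e = closed_segment a (a + of_real l * \<i>) \<and>
    pat H a = (False, True, True, True) \<and> pat H (a + of_real l * \<i>) = (True, True, True, False)"
    unfolding a(2) up_edge_types[OF H a(1)] using up_edge_quads(1-5)[OF H a(1)] a(1)
    by (intro exI[of _ a] exI[of _ l]) (simp add: pat_def)
next
  assume "\<exists>a l. dir_edge H a \<i> l \<and> e = closed_segment a (a + of_real l * \<i>) \<and>
    pat H a = (False, True, True, True) \<and> pat H (a + of_real l * \<i>) = (True, True, True, False)"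
  then obtain a l where a: "dir_edge H a \<i> l" "e = closed_segment a (a + of_real l * \<i>)"
    "pat H a = (False, True, True, True)" "pat H (a + of_real l * \<i>) = (True, True, True, False)"
    by (elim exE conjE)
  show "right_notch H e" unfolding right_notch_def a(2) up_edge_types[OF H a(1)]
    using dir_edge_in_edges[OF H a(1)] vertical_segment[of a l] a(3,4) by (simp add: pat_def)
qed

lemma top_notch_iff:
  assumes H: "hole H"
  shows "top_notch H e \<longleftrightarrow> (\<exists>a l. dir_edge H a 1 l \<and> e = closed_segment a (a + of_real l * 1) \<and>
    pat H a = (False, True, True, True) \<and> pat H (a + of_real l * 1) = (True, False, True, True))"
proof -
  have types: "interior_near H (closed_segment a (a + of_real l * 1)) (-\<i>) \<longleftrightarrow> \<not> quad H a 1"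
    "neighbours_extend H (closed_segment a (a + of_real l * 1)) \<i> \<longleftrightarrow>
       quad H a \<i> \<noteq> quad H a 1 \<and> quad H (a + of_real l * 1) \<i> \<noteq> quad H (a + of_real l * 1) 1"
    if e: "dir_edge H a 1 l" for a l
    using interior_near_iff(2)[OF H e] neighbours_extend_iff[OF H e, of \<i>] by (simp_all add: germ_def)
  show ?thesis
  proof
    assume r: "top_notch H e"
    then obtain a l where a: "dir_edge H a 1 l" "e = closed_segment a (a + of_real l * 1)"
      unfolding top_notch_def by (elim conjE) (rule horizontal_edge[OF H])
    have "interior_near H e (-\<i>)" "neighbours_extend H e \<i>" using r unfolding top_notch_def by simp_all
    then have "\<not> quad H a 1" "quad H a \<i> \<noteq> quad H a 1 \<and> quad H (a + of_real l * 1) \<i> \<noteq> quad H (a + of_real l * 1) 1"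
      unfolding a(2) types[OF a(1)] .
    then have "pat H a = (False, True, True, True)" "pat H (a + of_real l * 1) = (True, False, True, True)"
      unfolding pat_def using right_edge_quads(1-5)[OF H a(1)] by simp_all
    then show "\<exists>a l. dir_edge H a 1 l \<and> e = closed_segment a (a + of_real l * 1) \<and>
      pat H a = (False, True, True, True) \<and> pat H (a + of_real l * 1) = (True, False, True, True)"
      using a by (intro exI[of _ a] exI[of _ l] conjI)
  next
    assume "\<exists>a l. dir_edge H a 1 l \<and> e = closed_segment a (a + of_real l * 1) \<and>
      pat H a = (False, True, True, True) \<and> pat H (a + of_real l * 1) = (True, False, True, True)"
    then obtain a l where a: "dir_edge H a 1 l" "e = closed_segment a (a + of_real l * 1)"
      "pat H a = (False, True, True, True)" "pat H (a + of_real l * 1) = (True, False, True, True)"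
      by (elim exE conjE)
    show "top_notch H e" unfolding top_notch_def a(2) types[OF a(1)]
      using dir_edge_in_edges[OF H a(1)] horizontal_segment[of a l] a(3,4)
      by (intro conjI) (simp_all add: pat_def)
  qed
qed

section \<open>Clockwise orientation and the winding number\<close>

text \<open>Clockwise means interior on the right. With the interior on the left, the winding number
  would be -1 at a point \<open>z\<close> just left of the edge and 0 at \<open>w\<close> just right
  of it. The edge itself contributes a positive real part at \<open>z\<close> and a negative one at
  \<open>w\<close>, so the contributions of the rest of the curve would differ by more than 1
  between points that are arbitrarily close.\<close>

lemma clockwise_edge_orientation:
  assumes H: "hole H" and ce: "clockwise_edge H a b"
  obtains d l where "dir_edge H a d l" "b = a + of_real l * d" "\<not> quad H a d"
proof -
  have ab_edge: "closed_segment a b \<in> edges H" using ce unfolding clockwise_edge_def by (elim conjE)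
  obtain g s t where g: "clockwise_traversal H g" "0 \<le> s" "s < t" "t \<le> 1" "g s = a" "g t = b"
    "g ` {s..t} = closed_segment a b"
    using ce unfolding clockwise_edge_def by (elim conjE exE)
  have tr: "simple_path g" "pathfinish g = pathstart g" "path_image g = frontier H"
    "\<forall>z\<in>interior H. winding_number g z = - 1"
    using g(1) unfolding clockwise_traversal_def by simp_all
  obtain a0 d0 l where e0: "dir_edge H a0 d0 l" "closed_segment a b = closed_segment a0 (a0 + of_real l * d0)"
    using ab_edge unfolding edges_iff[OF H] by (elim exE conjE)
  have "{a, b} = {a0, a0 + of_real l * d0}" using e0(2) by simp
  then have "(a = a0 \<and> b = a0 + of_real l * d0) \<or> (b = a0 \<and> a = a0 + of_real l * d0)"
    by (simp add: doubleton_eq_iff) metis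
  then obtain d where e: "dir_edge H a d l" "b = a + of_real l * d"
  proof
    assume "a = a0 \<and> b = a0 + of_real l * d0" then show thesis using that[of d0] e0(1) by simp
  next
    assume "b = a0 \<and> a = a0 + of_real l * d0"
    then show thesis using that[of "-d0"] dir_edge_reverse[OF e0(1)] by simp
  qed
  note D = dir_edgeD[OF e(1)] and Q = dir_edge_quads[OF H e(1)]
  have id: "\<i> * d \<in> dirs" "-(\<i> * d) \<in> dirs" using D(1) by auto
  have dd: "d * cnj d = 1" using D(1) by (auto simp: dirs_def)
  have "\<not> quad H a d"
  proof
    assume left: "quad H a d"
    define p where "p = a + of_real (l/2) * d"
    have half: "0 < l/2" "l/2 < l" using D(2) by auto
    have q: "quad H p d" "quad H p (\<i> * d)" "\<not> quad H p (-(\<i> * d))" "\<not> quad H p (-d)"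
      using Q(1-4)[of "l/2"] half left unfolding p_def by auto
    obtain r where r: "r > 0" "\<forall>d\<in>dirs. \<forall>s t. 0 < s \<and> s < r \<and> 0 < t \<and> t < r \<longrightarrow>
       p + of_real s * d + of_real t * (\<i> * d) \<notin> frontier H \<and>
       (p + of_real s * d + of_real t * (\<i> * d) \<in> interior H \<longleftrightarrow> quad H p d)"
      "\<forall>d\<in>dirs. \<forall>s. 0 < s \<and> s < r \<longrightarrow> (p + of_real s * d \<in> frontier H \<longleftrightarrow> germ H p d) \<and>
      (p + of_real s * d \<in> interior H \<longleftrightarrow> quad H p d \<and> quad H p (-(\<i> * d)))"
      by (rule quad_local[OF H])
    have zin: "p + of_real \<epsilon> * (\<i> * d) \<in> interior H" if "0 < \<epsilon>" "\<epsilon> < r" for \<epsilon>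
      using r(3)[rule_format, OF id(1), of \<epsilon>] that q by simp
    have wout: "p + of_real \<epsilon> * (-(\<i> * d)) \<notin> frontier H" "p + of_real \<epsilon> * (-(\<i> * d)) \<notin> interior H"
      if "0 < \<epsilon>" "\<epsilon> < r" for \<epsilon>
      using r(3)[rule_format, OF id(2), of \<epsilon>] that q unfolding germ_def by simp_all
    have pg: "path g" using tr(1) by (rule simple_path_imp_path)
    have ps: "p \<in> closed_segment a b"
      unfolding e(2) in_ray_segment[OF D(1) less_imp_le[OF D(2)]]
      using half by (intro exI[of _ "l/2"]) (simp add: p_def)
    then obtain m where m: "m \<in> {s..t}" "g m = p" unfolding g(7)[symmetric] by auto
    have pa: "p \<noteq> a" "p \<noteq> b" using D(1) half unfolding p_def e(2) by (auto simp: dirs_def)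
    have m': "s < m" "m < t" using m pa g(5,6) by (auto simp: less_le)
    have inj: "x = m" if "g x = g m" "x \<in> {0..1}" for x
    proof -
      have m01: "m \<in> {0..1}" "m \<noteq> 0" "m \<noteq> 1" using m' g(2,4) by auto
      have "\<forall>x\<in>{0..1}. \<forall>y\<in>{0..1}. g x = g y \<longrightarrow> x = y \<or> x = 0 \<and> y = 1 \<or> x = 1 \<and> y = 0"
        using tr(1) unfolding simple_path_def loop_free_def by (elim conjE)
      from this[rule_format, OF that(2) m01(1) that(1)] show ?thesis using m01 by simp
    qed
    \<comment> \<open>The contribution of the curve without the edge, continuous at the midpoint
      \<open>p\<close> of the edge.\<close>
    define F where "F z = winding_number (subpath 0 s g) z + winding_number (subpath t 1 g) z" for z
    have p0: "g x \<noteq> p" if "x \<in> {0..s} \<union> {t..1}" for x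
    proof
      assume "g x = p"
      then have "x = m" using inj[of x] m(2) that g(2-4) by auto
      then show False using that m' by auto
    qed
    have "p \<notin> g ` {0..s}" "p \<notin> g ` {t..1}" using p0 by (metis UnI1 UnI2 imageE)+
    then have p1: "p \<notin> path_image (subpath 0 s g)" "p \<notin> path_image (subpath t 1 g)"
      unfolding path_image_subpath using g(2,4) by simp_all
    have "path (subpath 0 s g)" "path (subpath t 1 g)" using pg g(2-4) by auto
    then have "continuous (at p) F" unfolding F_def
      using p1 by (intro continuous_add continuous_at_winding_number)
    then obtain \<delta> where \<delta>: "\<delta> > 0" "\<forall>z. dist z p < \<delta> \<longrightarrow> dist (F z) (F p) < 1/2"
      unfolding continuous_at_eps_delta by (auto dest: spec[of _ "1/2"])
    define \<epsilon> where "\<epsilon> = min r \<delta> / 2"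
    have \<epsilon>: "0 < \<epsilon>" "\<epsilon> < r" "\<epsilon> < \<delta>" using r(1) \<delta>(1) by (auto simp: \<epsilon>_def)
    define z where "z = p + of_real \<epsilon> * (\<i> * d)"
    define w where "w = p + of_real \<epsilon> * (-(\<i> * d))"
    have nd: "norm (\<i> * d) = 1" using norm_dirs[OF id(1)] .
    have "dist z p < \<delta>" "dist w p < \<delta>" using \<epsilon> nd by (simp_all add: z_def w_def dist_norm norm_mult)
    then have "dist (F z) (F p) < 1/2" "dist (F w) (F p) < 1/2" using \<delta>(2) by blast+
    then have "dist (F z) (F w) < 1" by (metis dist_commute dist_triangle_half_l)
    then have Fzw: "\<bar>Re (F z) - Re (F w)\<bar> < 1"
      using abs_Re_le_cmod[of "F z - F w"] by (simp add: dist_norm)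
    have zH: "z \<in> interior H" unfolding z_def using zin \<epsilon> by blast
    then have zJ: "z \<notin> path_image g" unfolding tr(3) by (simp add: frontier_def)
    have wJ: "w \<notin> path_image g" unfolding tr(3) w_def using wout \<epsilon> by blast
    have "w \<notin> H" using hole_facts(5)[OF H] wout[OF \<epsilon>(1,2)] unfolding w_def by blast
    then have "w \<in> outside (path_image g)" using hole_facts(4)[OF H] unfolding tr(3) by blast
    then have ww: "winding_number g w = 0"
      using winding_number_zero_in_outside[OF pg tr(2)] by blast
    have wz: "winding_number g z = -1" using tr(4) zH by blast
    have st01: "s \<in> {0..1}" "t \<in> {0..1}" using g(2-4) by auto
    have split: "winding_number g x = F x + winding_number (linepath a b) x" if x: "x \<notin> path_image g" for x
    proof -
      have e1: "winding_number (subpath 0 s g) x + winding_number (subpath s t g) x = winding_number (subpath 0 t g) x"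
        and e2: "winding_number (subpath 0 t g) x + winding_number (subpath t 1 g) x = winding_number g x"
        using winding_number_subpath_combine[OF pg x, of 0 s t] winding_number_subpath_combine[OF pg x, of 0 t 1] st01
        by auto
      \<comment> \<open>The traversal may pass the edge with any parametrisation; a linear homotopy
        within the edge replaces it by \<open>linepath a b\<close>.\<close>
      have e3: "winding_number (subpath s t g) x = winding_number (linepath a b) x"
      proof (rule winding_number_homotopic_paths, rule homotopic_paths_linear)
        show "path (subpath s t g)" "path (linepath a b)" using pg st01 by auto
        show "pathstart (linepath a b) = pathstart (subpath s t g)"
          "pathfinish (linepath a b) = pathfinish (subpath s t g)" using g(5,6) by auto
        fix u :: real assume u: "u \<in> {0..1}"
        have "subpath s t g u \<in> path_image (subpath s t g)" using u by (auto simp: path_image_def)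
        then have 1: "subpath s t g u \<in> closed_segment a b"
          unfolding path_image_subpath g(7)[symmetric] using g(3) by simp
        have 2: "linepath a b u \<in> closed_segment a b" using linepath_in_path[OF u] .
        have 3: "closed_segment (subpath s t g u) (linepath a b u) \<subseteq> closed_segment a b"
          unfolding subset_closed_segment using 1 2 by simp
        have "closed_segment a b \<subseteq> path_image g" unfolding tr(3) by (rule edges_subset_frontier[OF ab_edge])
        then show "closed_segment (subpath s t g u) (linepath a b u) \<subseteq> - {x}" using 3 x by auto
      qed
      show ?thesis unfolding F_def e2[symmetric] e1[symmetric] e3 by (simp add: algebra_simps)
    qed
    have Lz: "0 < Re (winding_number (linepath a b) z)"
    proof (rule winding_number_linepath_pos_lt)
      have "(b - a) * cnj (b - z) = of_real l * (d * cnj d) * Complex (l/2) \<epsilon>"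
        by (simp add: e(2) z_def p_def complex_eq_iff algebra_simps)
      then show "0 < Im ((b - a) * cnj (b - z))" using dd D(2) \<epsilon> by simp
    qed
    have "0 < Re (winding_number (linepath b a) w)"
    proof (rule winding_number_linepath_pos_lt)
      have "(a - b) * cnj (a - w) = of_real l * (d * cnj d) * Complex (l/2) \<epsilon>"
        by (simp add: e(2) w_def p_def complex_eq_iff algebra_simps)
      then show "0 < Im ((a - b) * cnj (a - w))" using dd D(2) \<epsilon> by simp
    qed
    moreover have "winding_number (linepath b a) w = - winding_number (linepath a b) w"
    proof -
      have "closed_segment a b \<subseteq> path_image g" unfolding tr(3) by (rule edges_subset_frontier[OF ab_edge])
      then have "w \<notin> path_image (linepath a b)" using wJ by auto
      then show ?thesis using winding_number_reversepath[of "linepath a b" w] by simp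
    qed
    ultimately have Lw: "Re (winding_number (linepath a b) w) < 0" by simp
    have "Re (F z) + Re (winding_number (linepath a b) z) = -1"
      using split[OF zJ] wz by (metis plus_complex.simps(1) uminus_complex.simps(1) one_complex.simps(1))
    moreover have "Re (F w) + Re (winding_number (linepath a b) w) = 0"
      using split[OF wJ] ww by (metis plus_complex.simps(1) zero_complex.simps(1))
    ultimately show False using Fzw Lz Lw by linarith
  qed
  then show thesis using that e by blast
qed

section \<open>Cutting a hole upwards from its left notches\<close>

lemma quads_off_frontier:
  assumes H: "hole H" and p: "p \<notin> frontier H"
  shows "quad H p \<i> = quad H p 1" "quad H p (-1) = quad H p 1" "quad H p (-\<i>) = quad H p 1"
proof -
  obtain r where r: "r > 0" "\<forall>z. dist p z < r \<longrightarrow> z \<notin> frontier H"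
    "\<forall>z. dist p z < r \<longrightarrow> z \<in> interior H \<longleftrightarrow> p \<in> interior H"
    "\<forall>d\<in>dirs. quad H p d \<longleftrightarrow> p \<in> interior H"
    by (rule local_structure_off[OF H p])
  show "quad H p \<i> = quad H p 1" "quad H p (-1) = quad H p 1" "quad H p (-\<i>) = quad H p 1"
    using r(4) by simp_all
qed

lemma frontier_iff_pat:
  assumes H: "hole H"
  shows "p \<in> frontier H \<longleftrightarrow> pat H p \<notin> {(True,True,True,True), (False,False,False,False),
    (True,False,True,False), (False,True,False,True)}"
  unfolding frontier_iff_quads[OF H] pat_def by auto

lemma pat_germs:
  "germ H p 1 \<longleftrightarrow> fst (pat H p) \<noteq> snd (snd (snd (pat H p)))"
  "germ H p \<i> \<longleftrightarrow> fst (snd (pat H p)) \<noteq> fst (pat H p)"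
  "germ H p (-1) \<longleftrightarrow> fst (snd (snd (pat H p))) \<noteq> fst (snd (pat H p))"
  "germ H p (-\<i>) \<longleftrightarrow> snd (snd (snd (pat H p))) \<noteq> fst (snd (snd (pat H p)))"
  by (simp_all add: germ_def pat_def)

text \<open>An edge is determined by the patterns along it, so it can be transferred between
  \<open>H\<close> and a piece in either direction.\<close>

lemma dir_edge_cong:
  assumes H: "hole H" and S: "hole S" and e: "dir_edge S a d l"
    and eq: "\<forall>s. 0 \<le> s \<and> s \<le> l \<longrightarrow> pat H (a + of_real s * d) = pat S (a + of_real s * d)"
  shows "dir_edge H a d l"
proof -
  note D = dir_edgeD[OF e]
  have g: "germ H p c = germ S p c" if "pat H p = pat S p" "c \<in> dirs" for p c
    using that(2) by (cases rule: dirs_cases) (simp_all only: pat_germs that(1))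
  have "pat H (a + of_real 0 * d) = pat S (a + of_real 0 * d)"
    by (rule eq[rule_format]) (use D(2) in simp)
  then have "pat H a = pat S a" by simp
  then have a: "germ H a (-d) = germ S a (-d)" by (rule g) (use D(1) in simp)
  have b: "germ H (a + of_real l * d) d = germ S (a + of_real l * d) d"
    by (rule g[OF _ D(1)]) (rule eq[rule_format], use D(2) in simp)
  have "a + of_real s * d \<in> frontier H" if "0 \<le> s \<and> s \<le> l" for s
    using D(3)[rule_format, OF that] eq[rule_format, OF that]
    unfolding frontier_iff_pat[OF H] frontier_iff_pat[OF S] by simp
  then show ?thesis using D a b by (simp add: dir_edge_def)
qed

lemma germ_start:
  assumes H: "hole H" and d: "d \<in> dirs" and g: "germ H p d" "\<not> germ H p (-d)"
  obtains l where "dir_edge H p d l"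
proof -
  obtain l where "l > 0" "\<forall>s. 0 \<le> s \<and> s \<le> l \<longrightarrow> p + of_real s * d \<in> frontier H"
    "\<not> germ H (p + of_real l * d) d" by (rule extend_germ[OF H d g(1)])
  then have "dir_edge H p d l" using d g(2) by (simp add: dir_edge_def)
  then show thesis by (rule that)
qed

text \<open>Let \<open>q\<close> be the highest of the points of largest abscissa. Nothing lies to
  its right or straight above it, so SW is its only interior quadrant, and the edge going down from
  \<open>q\<close> is a rightmost edge.\<close>

lemma hole_has_rightmost_edge:
  assumes H: "hole H"
  obtains e where "rightmost_edge H e"
proof -
  note F = hole_facts[OF H]
  note R = Jordan_regions[OF F(1)]
  have "closure (interior H) = H" using R(12) F(3,5) by simp
  moreover have "compact (closure (interior H))" using R(7) F(3) by simp
  ultimately have cH: "compact H" by simp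
  have "H \<noteq> {}" using R(2) F(3,5) by auto
  then obtain p where p: "p \<in> H" "\<forall>z\<in>H. Re z \<le> Re p"
    using continuous_attains_sup[OF cH, of Re] continuous_on_Re[OF continuous_on_id] by auto
  define T where "T = H \<inter> {z. Re z = Re p}"
  have "compact T" unfolding T_def
    by (rule compact_Int_closed[OF cH]) (intro closed_Collect_eq continuous_intros)
  moreover have "T \<noteq> {}" using p(1) by (auto simp: T_def)
  ultimately obtain q where q: "q \<in> T" "\<forall>z\<in>T. Im z \<le> Im q"
    using continuous_attains_sup[of T Im] continuous_on_Im[OF continuous_on_id] by auto
  have qH: "q \<in> H" "\<forall>z\<in>H. Re z \<le> Re q" using q(1) p(2) by (auto simp: T_def)
  have up: "\<not> Im z > Im q" if "z \<in> H" "Re z = Re q" for z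
    using q that by (auto simp: T_def not_less)
  have right: "\<not> quad H x 1 \<and> \<not> quad H x (-\<i>)" if x: "Re x = Re q" for x
  proof (intro conjI notI)
    assume "quad H x 1"
    then obtain r where r: "r > 0" "\<forall>s t. 0 < s \<and> s < r \<and> 0 < t \<and> t < r \<longrightarrow>
      x + of_real s * 1 + of_real t * (\<i> * 1) \<in> interior H" unfolding quad_def by blast
    have "x + of_real (r/2) * 1 + of_real (r/2) * (\<i> * 1) \<in> interior H" by (rule r(2)[rule_format]) (use r(1) in auto)
    then have "Re (x + of_real (r/2) * 1 + of_real (r/2) * (\<i> * 1)) \<le> Re q" using qH(2) interior_subset by blast
    then show False using r(1) x by simp
  next
    assume "quad H x (-\<i>)"
    then obtain r where r: "r > 0" "\<forall>s t. 0 < s \<and> s < r \<and> 0 < t \<and> t < r \<longrightarrow>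
      x + of_real s * (-\<i>) + of_real t * (\<i> * (-\<i>)) \<in> interior H" unfolding quad_def by blast
    have "x + of_real (r/2) * (-\<i>) + of_real (r/2) * (\<i> * (-\<i>)) \<in> interior H" by (rule r(2)[rule_format]) (use r(1) in auto)
    then have "Re (x + of_real (r/2) * (-\<i>) + of_real (r/2) * (\<i> * (-\<i>))) \<le> Re q" using qH(2) interior_subset by blast
    then show False using r(1) x by simp
  qed
  have "q \<notin> interior H"
  proof
    assume "q \<in> interior H"
    then have qf: "q \<notin> frontier H" by (simp add: frontier_def)
    obtain r where r: "r > 0" "\<forall>z. dist q z < r \<longrightarrow> z \<notin> frontier H"
      "\<forall>z. dist q z < r \<longrightarrow> z \<in> interior H \<longleftrightarrow> q \<in> interior H"
      "\<forall>d\<in>dirs. quad H q d \<longleftrightarrow> q \<in> interior H"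
      by (rule local_structure_off[OF H qf])
    then show False using right[of q] \<open>q \<in> interior H\<close> by simp
  qed
  then have qf: "q \<in> frontier H" using qH(1) F(5) by blast
  have nup: "\<not> germ H q \<i>"
  proof
    assume g: "germ H q \<i>"
    obtain r where r: "r > 0" "\<forall>s. 0 < s \<and> s < r \<longrightarrow> (q + of_real s * \<i> \<in> frontier H \<longleftrightarrow> germ H q \<i>)"
      by (rule germ_ray[OF H dirs_simps(3)])
    have "q + of_real (r/2) * \<i> \<in> frontier H" using r(2)[rule_format, of "r/2"] r(1) g by simp
    then have "q + of_real (r/2) * \<i> \<in> H" using F(5) by blast
    then show False using up[of "q + of_real (r/2) * \<i>"] r(1) by simp
  qed
  have pq: "pat H q = (False, False, True, False)"
    using nup right[of q] frontier_iff_pat[OF H, of q] qf unfolding pat_germs by (auto simp: pat_def)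
  then have "germ H q (-\<i>)" "\<not> germ H q (-(-\<i>))" using nup by (simp_all add: pat_germs)
  then obtain l where "dir_edge H q (-\<i>) l" using germ_start[OF H dirs_simps(4)] by blast
  from dir_edge_reverse[OF this] have e: "dir_edge H (q + of_real l * (-\<i>)) \<i> l" by simp
  define a where "a = q + of_real l * (-\<i>)"
  have b: "a + of_real l * \<i> = q" by (simp add: a_def)
  note U = up_edge_quads[OF H e[folded a_def], unfolded b]
  have "\<not> quad H a 1 \<and> \<not> quad H a (-\<i>)" by (rule right) (simp add: a_def)
  then have "pat H a = (False, True, False, False)" using U(1,2) by (simp add: pat_def)
  then have "rightmost_edge H (closed_segment a (a + of_real l * \<i>))"
    unfolding rightmost_edge_iff[OF H] using e pq b unfolding a_def[symmetric]
    by (intro exI[of _ a] exI[of _ l]) simp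
  then show thesis by (rule that)
qed

text \<open>The interior quadrants of \<open>H\<close> at a point form one block, and a piece may
  change status only where \<open>H\<close> does; so it takes the whole block or nothing. The last
  assumption rules out checkerboards, which have two blocks.\<close>

lemma subquadrant_pattern:
  fixes a b c d a' b' c' d' :: bool
  assumes "a' \<longrightarrow> a" "b' \<longrightarrow> b" "c' \<longrightarrow> c" "d' \<longrightarrow> d"
    and "a' \<noteq> d' \<longrightarrow> a \<noteq> d" "b' \<noteq> a' \<longrightarrow> b \<noteq> a" "c' \<noteq> b' \<longrightarrow> c \<noteq> b" "d' \<noteq> c' \<longrightarrow> d \<noteq> c"
    and "a \<noteq> c \<or> b \<noteq> d \<or> (a = b \<and> b = c \<and> c = d)"
  shows "(a' = a \<and> b' = b \<and> c' = c \<and> d' = d) \<or> (\<not> a' \<and> \<not> b' \<and> \<not> c' \<and> \<not> d')"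
  using assms by argo

section \<open>The pieces and their patterns on the cuts\<close>

text \<open>\<open>Qpat\<close> is the pattern at the upper vertex of a left notch, with SW outside,
  and \<open>h i\<close> is the height at which the upward ray from \<open>Q i\<close> first meets
  the boundary.\<close>

locale cut_hole =
  fixes H :: "complex set" and Q :: "nat \<Rightarrow> complex" and h :: "nat \<Rightarrow> real" and I :: "nat set"
  assumes H: "hole H" and finI: "finite I" and injQ: "inj_on Q I"
    and Qpat: "i \<in> I \<Longrightarrow> pat H (Q i) = (True, True, False, True)"
    and hpos: "i \<in> I \<Longrightarrow> h i > 0"
    and top_frontier: "i \<in> I \<Longrightarrow> Q i + of_real (h i) * \<i> \<in> frontier H"
    and cut_interior: "i \<in> I \<Longrightarrow> 0 < t \<Longrightarrow> t < h i \<Longrightarrow> Q i + of_real t * \<i> \<in> interior H"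
begin

definition top :: "nat \<Rightarrow> complex" where "top i = Q i + of_real (h i) * \<i>"

definition cut :: "nat \<Rightarrow> complex set" where "cut i = closed_segment (Q i) (top i)"

definition P :: "complex set set" where "P = pieces H (cut ` I)"

lemma cut_iff: "i \<in> I \<Longrightarrow> z \<in> cut i \<longleftrightarrow> (\<exists>t. 0 \<le> t \<and> t \<le> h i \<and> z = Q i + of_real t * \<i>)"
  unfolding cut_def top_def using in_ray_segment[OF dirs_simps(3) less_imp_le[OF hpos]] by blast

lemma Q_frontier: "i \<in> I \<Longrightarrow> Q i \<in> frontier H"
  using Qpat frontier_iff_pat[OF H] by simp

text \<open>Points just below \<open>top i\<close> are interior, hence so are SW and SE. Three
  boundary patterns remain: a flat ceiling, a falling corner, and a corner where a ceiling coming
  from the left turns upwards.\<close>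

lemma top_pat:
  assumes i: "i \<in> I"
  shows "pat H (top i) \<in> {(False,False,True,True), (False,True,True,True), (True,False,True,True)}"
proof -
  obtain r where r: "r > 0" "\<forall>d\<in>dirs. \<forall>s t. 0 < s \<and> s < r \<and> 0 < t \<and> t < r \<longrightarrow>
       top i + of_real s * d + of_real t * (\<i> * d) \<notin> frontier H \<and>
       (top i + of_real s * d + of_real t * (\<i> * d) \<in> interior H \<longleftrightarrow> quad H (top i) d)"
    "\<forall>d\<in>dirs. \<forall>s. 0 < s \<and> s < r \<longrightarrow> (top i + of_real s * d \<in> frontier H \<longleftrightarrow> germ H (top i) d) \<and>
      (top i + of_real s * d \<in> interior H \<longleftrightarrow> quad H (top i) d \<and> quad H (top i) (-(\<i> * d)))"
    by (rule quad_local[OF H])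
  define s where "s = min r (h i) / 2"
  have s: "0 < s" "s < r" "s < h i" using r(1) hpos[OF i] by (auto simp: s_def)
  have eq: "top i + of_real s * (-\<i>) = Q i + of_real (h i - s) * \<i>" by (simp add: top_def algebra_simps)
  have "top i + of_real s * (-\<i>) \<in> interior H" unfolding eq by (rule cut_interior[OF i]) (use s in auto)
  then have "quad H (top i) (-\<i>) \<and> quad H (top i) (-1)"
    using r(3)[rule_format, OF dirs_simps(4), of s] s by simp
  moreover have "top i \<in> frontier H" using top_frontier[OF i] by (simp add: top_def)
  ultimately show ?thesis unfolding frontier_iff_pat[OF H] by (auto simp: pat_def)
qed

lemma cut_frontier:
  assumes i: "i \<in> I" and z: "z \<in> cut i" "z \<in> frontier H"
  shows "z = Q i \<or> z = top i"
proof -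
  obtain t where t: "0 \<le> t" "t \<le> h i" "z = Q i + of_real t * \<i>" using z(1) cut_iff[OF i] by blast
  show ?thesis
  proof (cases "0 < t \<and> t < h i")
    case True
    then have "z \<in> interior H" using cut_interior[OF i] t(3) by simp
    then show ?thesis using z(2) by (simp add: frontier_def)
  next
    case False
    then show ?thesis using t by (auto simp: top_def)
  qed
qed

text \<open>Meeting vertical segments are collinear, so the lower end of the higher one would be a
  boundary point on the other cut and thus one of its ends. It is not the lower end, and not the
  upper one either: SW is interior at \<open>top i\<close> but not at \<open>Q j\<close>.\<close>

lemma cuts_disjoint:
  assumes i: "i \<in> I" and j: "j \<in> I" and z: "z \<in> cut i" "z \<in> cut j"
  shows "i = j"
proof (rule ccontr)
  assume ij: "i \<noteq> j"
  have *: False if ij: "i \<in> I" "j \<in> I" "z \<in> cut i" "z \<in> cut j" "Im (Q i) < Im (Q j)" for i j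
  proof -
    obtain t where t: "0 \<le> t" "t \<le> h i" "z = Q i + of_real t * \<i>" using ij cut_iff by blast
    obtain u where u: "0 \<le> u" "u \<le> h j" "z = Q j + of_real u * \<i>" using ij cut_iff by blast
    define v where "v = Im (Q j) - Im (Q i)"
    have Re: "Re (Q j) = Re (Q i)" using t(3) u(3) by (auto simp: complex_eq_iff)
    have im: "v = t - u" using t(3) u(3) by (auto simp: v_def complex_eq_iff)
    have Qj: "Q j = Q i + of_real v * \<i>" using Re by (simp add: v_def complex_eq_iff)
    have v: "0 < v" "v \<le> h i" using ij(5) im t u by (auto simp: v_def)
    have "Q j \<in> cut i" using cut_iff[OF ij(1)] Qj v by (metis less_imp_le)
    then have "Q j = Q i \<or> Q j = top i" using cut_frontier[OF ij(1)] Q_frontier[OF ij(2)] by blast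
    moreover have "Q j \<noteq> Q i" using ij(5) by auto
    moreover have "Q j \<noteq> top i" using top_pat[OF ij(1)] Qpat[OF ij(2)] by auto
    ultimately show False by blast
  qed
  obtain t where t: "z = Q i + of_real t * \<i>" using cut_iff[OF i] z by blast
  obtain u where u: "z = Q j + of_real u * \<i>" using cut_iff[OF j] z by blast
  have "Q i \<noteq> Q j" using ij i j injQ by (auto dest: inj_onD)
  moreover have "Re (Q i) = Re (Q j)" using t u by (auto simp: complex_eq_iff)
  ultimately have "Im (Q i) \<noteq> Im (Q j)" by (auto simp: complex_eq_iff)
  then show False using *[of i j] *[of j i] i j z by linarith
qed

lemma cut_crosscut: "i \<in> I \<Longrightarrow> crosscut (frontier H) (cut i)"
  unfolding crosscut_def
proof (intro exI conjI)
  assume i: "i \<in> I"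
  show "Q i \<noteq> top i" using hpos[OF i] by (simp add: top_def)
  show "cut i = closed_segment (Q i) (top i)" by (simp add: cut_def)
  show "Q i \<in> frontier H" "top i \<in> frontier H" using Q_frontier[OF i] top_frontier[OF i] by (simp_all add: top_def)
  show "open_segment (Q i) (top i) \<subseteq> inside (frontier H)"
  proof
    fix z assume "z \<in> open_segment (Q i) (top i)"
    then have z: "z \<in> cut i" "z \<noteq> Q i" "z \<noteq> top i" by (simp_all add: open_segment_def cut_def)
    obtain t where t: "0 \<le> t" "t \<le> h i" "z = Q i + of_real t * \<i>" using z(1) cut_iff[OF i] by blast
    then have "0 < t" "t < h i" using z by (auto simp: top_def less_le)
    then have "z \<in> interior H" using cut_interior[OF i] t(3) by simp
    then show "z \<in> inside (frontier H)" using hole_facts(3)[OF H] by simp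
  qed
qed

abbreviation U :: "complex set" where "U \<equiv> interior H - \<Union>(cut ` I)"

text \<open>The Jordan curve around a component lies in a cross-like set, hence is rectilinear, and
  so the closure of the component is a hole.\<close>

lemma components_U:
  shows "finite (components U)" "card (components U) = Suc (card I)"
    "K \<in> components U \<Longrightarrow> hole (closure K) \<and> interior (closure K) = K \<and>
      frontier (closure K) \<subseteq> frontier H \<union> \<Union>(cut ` I)"
proof -
  note F = hole_facts[OF H]
  have inj: "inj_on cut I"
  proof (rule inj_onI)
    fix i j assume ij: "i \<in> I" "j \<in> I" "cut i = cut j"
    have "Q i \<in> cut i" by (simp add: cut_def)
    then show "i = j" using cuts_disjoint[OF ij(1,2)] ij(3) by simp
  qed
  have pw: "pairwise disjnt (cut ` I)"
    unfolding pairwise_def disjnt_def using cuts_disjoint by blast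
  have *: "finite (components (inside (frontier H) - \<Union>(cut ` I))) \<and>
    card (components (inside (frontier H) - \<Union>(cut ` I))) = Suc (card (cut ` I)) \<and>
    (\<forall>K\<in>components (inside (frontier H) - \<Union>(cut ` I)). \<exists>J'. Jordan J' \<and> J' \<subseteq> frontier H \<union> \<Union>(cut ` I) \<and> K = inside J')"
    by (rule components_minus_crosscuts[OF _ F(1) _ pw]) (use finI cut_crosscut in auto)
  show "finite (components U)" "card (components U) = Suc (card I)"
    using * card_image[OF inj] unfolding F(3) by simp_all
  assume "K \<in> components U"
  then obtain J' where J': "Jordan J'" "J' \<subseteq> frontier H \<union> \<Union>(cut ` I)" "K = inside J'"
    using * unfolding F(3) by blast
  have "cross_like (\<Union>(cut ` I))"
    by (rule cross_like_Union) (use finI in \<open>auto simp: cut_def top_def intro!: cross_like_segment\<close>)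
  then have cl: "cross_like J'" using cross_like_mono[OF cross_like_Un[OF F(2)] J'(2)] by blast
  have "closure K = J' \<union> inside J'" using Jordan_regions(12)[OF J'(1)] J'(3) by simp
  then show "hole (closure K) \<and> interior (closure K) = K \<and> frontier (closure K) \<subseteq> frontier H \<union> \<Union>(cut ` I)"
    using Jordan_imp_hole[OF J'(1) cl] J'(2,3) by simp
qed

lemma P_eq: "P = closure ` components U"
  by (simp add: P_def pieces_def)

lemma card_P: "finite P" "card P = Suc (card I)"
proof -
  have "inj_on closure (components U)"
    by (rule inj_on_inverseI[of _ interior]) (use components_U(3) in blast)
  then show "card P = Suc (card I)" unfolding P_eq using card_image components_U(2) by metis
  show "finite P" unfolding P_eq using components_U(1) by simp
qed

lemma piece:
  assumes "S \<in> P"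
  shows "hole S" "interior S \<in> components U" "S = closure (interior S)"
    "frontier S \<subseteq> frontier H \<union> \<Union>(cut ` I)" "interior S \<subseteq> interior H" "i \<in> I \<Longrightarrow> interior S \<inter> cut i = {}"
proof -
  obtain K where K: "K \<in> components U" "S = closure K" using assms unfolding P_eq by blast
  note C = components_U(3)[OF K(1), folded K(2)]
  show "hole S" "frontier S \<subseteq> frontier H \<union> \<Union>(cut ` I)" using C by blast+
  show "interior S \<in> components U" "S = closure (interior S)" using C K by simp_all
  have "K \<subseteq> U" using in_components_subset[OF K(1)] .
  then show "interior S \<subseteq> interior H" "i \<in> I \<Longrightarrow> interior S \<inter> cut i = {}" using C by blast+
qed

lemma pieces_disjoint:
  assumes "S \<in> P" "S' \<in> P" "z \<in> interior S" "z \<in> interior S'"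
  shows "S = S'"
proof -
  have "interior S = interior S'"
    using components_nonoverlap[OF piece(2)[OF assms(1)] piece(2)[OF assms(2)]] assms(3,4) by blast
  then show ?thesis using piece(3)[OF assms(1)] piece(3)[OF assms(2)] by simp
qed

text \<open>The cuts are negligible, so removing them leaves a dense subset of the interior.\<close>

lemma Union_P: "\<Union>P = H"
proof -
  note F = hole_facts[OF H]
  have cH: "closure (interior H) = H" using Jordan_regions(12)[OF F(1)] F(3,5) by simp
  have "closure (\<Union>F) = \<Union>(closure ` F)" if "finite F" for F :: "complex set set"
    using that by (induction F) (auto simp: closure_Un)
  from this[OF components_U(1)] have "\<Union>P = closure (\<Union>(components U))"
    unfolding P_eq by (rule sym)
  also have "\<Union>(components U) = U" by (rule Union_components)
  also have "closure U = H"
  proof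
    show "closure U \<subseteq> H" using closure_mono[of U "interior H"] cH by blast
    have "interior (\<Union>(cut ` I)) = {}"
    proof -
      have "negligible (\<Union>(cut ` I))"
      proof (rule negligible_Union)
        show "negligible t" if t: "t \<in> cut ` I" for t
        proof -
          obtain i where "t = cut i" using t by blast
          then have "t \<subseteq> {z. z \<bullet> 1 = Re (Q i)}"
            by (auto simp: cut_def top_def closed_segment_def inner_complex_def algebra_simps)
          moreover have "negligible {z::complex. z \<bullet> 1 = Re (Q i)}"
            by (rule negligible_standard_hyperplane) (simp add: Basis_complex_def)
          ultimately show ?thesis using negligible_subset by blast
        qed
      qed (use finI in simp)
      then have "negligible (interior (\<Union>(cut ` I)))" by (rule negligible_subset[OF _ interior_subset])
      then show ?thesis using open_not_negligible[OF open_interior, of "\<Union>(cut ` I)"] by blast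
    qed
    then have dense: "closure (- (\<Union>(cut ` I))) = UNIV" unfolding closure_complement by simp
    have "interior H \<subseteq> closure (interior H \<inter> - (\<Union>(cut ` I)))"
      using open_Int_closure_subset[OF open_interior, of H "- (\<Union>(cut ` I))"] unfolding dense by simp
    then have "interior H \<subseteq> closure U" by (simp add: Diff_eq)
    then have "closure (interior H) \<subseteq> closure U" by (simp add: closure_minimal)
    then show "H \<subseteq> closure U" unfolding cH .
  qed
  finally show ?thesis .
qed

lemma quad_piece_imp:
  assumes "S \<in> P" "quad S p d" shows "quad H p d"
  using assms(2) piece(5)[OF assms(1)] unfolding quad_def by (meson subsetD)

text \<open>Interiors of different pieces are disjoint, so a quadrant at a point belongs to at most
  one piece. This is how pieces are told apart and counted.\<close>

lemma quad_piece_unique: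
  assumes S: "S \<in> P" "S' \<in> P" and q: "quad S p d" "quad S' p d"
  shows "S = S'"
proof -
  obtain r where r: "r > 0" "\<forall>s t. 0 < s \<and> s < r \<and> 0 < t \<and> t < r \<longrightarrow>
     p + of_real s * d + of_real t * (\<i> * d) \<in> interior S" using q(1) unfolding quad_def by blast
  obtain r' where r': "r' > 0" "\<forall>s t. 0 < s \<and> s < r' \<and> 0 < t \<and> t < r' \<longrightarrow>
     p + of_real s * d + of_real t * (\<i> * d) \<in> interior S'" using q(2) unfolding quad_def by blast
  define s where "s = min r r' / 2"
  have s: "0 < s" "s < r" "s < r'" using r r' by (auto simp: s_def)
  show ?thesis
    by (rule pieces_disjoint[OF S, of "p + of_real s * d + of_real s * (\<i> * d)"]) (use r(2) r'(2) s in auto)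
qed

text \<open>Cuts not through \<open>p\<close> keep a distance from it, and cuts through
  \<open>p\<close> are vertical, so near \<open>p\<close> only the rays upwards and downwards can
  meet a cut.\<close>

lemma cuts_near:
  obtains r where "r > 0" "\<forall>d\<in>dirs. \<forall>s i. 0 < s \<and> s < r \<and> i \<in> I \<and> p + of_real s * d \<in> cut i \<longrightarrow>
      (\<exists>t. p = Q i + of_real t * \<i> \<and> 0 \<le> t \<and> t \<le> h i \<and> (d = \<i> \<and> t < h i \<or> d = -\<i> \<and> 0 < t))"
proof -
  define A where "A = \<Union>(cut ` {i\<in>I. p \<notin> cut i})"
  have "closed A" unfolding A_def by (rule closed_Union) (use finI in \<open>auto simp: cut_def\<close>)
  moreover have "p \<notin> A" by (auto simp: A_def)
  ultimately obtain r where r: "r > 0" "\<forall>z\<in>A. r \<le> dist p z" using separate_point_closed by metis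
  show thesis
  proof (rule that[OF r(1)], intro ballI allI impI, elim conjE)
    fix d s i assume d: "d \<in> dirs" and s: "0 < s" "s < r" and i: "i \<in> I" and c: "p + of_real s * d \<in> cut i"
    have "dist p (p + of_real s * d) = s" using s norm_dirs[OF d] by (simp add: dist_norm norm_mult)
    then have "p + of_real s * d \<notin> A" using r(2) s by force
    then have "p \<in> cut i" using i c unfolding A_def by blast
    then obtain t where t: "0 \<le> t" "t \<le> h i" "p = Q i + of_real t * \<i>" using cut_iff[OF i] by blast
    obtain u where u: "0 \<le> u" "u \<le> h i" "p + of_real s * d = Q i + of_real u * \<i>" using c cut_iff[OF i] by blast
    have "of_real s * d = of_real (u - t) * \<i>" using t(3) u(3) by (simp add: algebra_simps)
    then have "d = \<i> \<and> u - t = s \<or> d = -\<i> \<and> t - u = s" using d s(1) by (auto simp: dirs_def complex_eq_iff)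
    then have "d = \<i> \<and> t < h i \<or> d = -\<i> \<and> 0 < t" using s(1) u by auto
    then show "\<exists>t. p = Q i + of_real t * \<i> \<and> 0 \<le> t \<and> t \<le> h i \<and> (d = \<i> \<and> t < h i \<or> d = -\<i> \<and> 0 < t)" using t by blast
  qed
qed

text \<open>The boundary of a piece lies on that of \<open>H\<close> and on the cuts; a germ missing
  the former runs along one of the latter.\<close>

lemma quad_piece_germ:
  assumes S: "S \<in> P" and d: "d \<in> dirs" and g: "germ S p d" "\<not> germ H p d"
  obtains i t where "i \<in> I" "p = Q i + of_real t * \<i>" "0 \<le> t" "t \<le> h i" "d = \<i> \<and> t < h i \<or> d = -\<i> \<and> 0 < t"
proof -
  obtain r1 where r1: "r1 > 0" "\<forall>s. 0 < s \<and> s < r1 \<longrightarrow> (p + of_real s * d \<in> frontier S \<longleftrightarrow> germ S p d)"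
    by (rule germ_ray[OF piece(1)[OF S] d])
  obtain r2 where r2: "r2 > 0" "\<forall>s. 0 < s \<and> s < r2 \<longrightarrow> (p + of_real s * d \<in> frontier H \<longleftrightarrow> germ H p d)"
    by (rule germ_ray[OF H d])
  obtain r3 where r3: "r3 > 0" "\<forall>d\<in>dirs. \<forall>s i. 0 < s \<and> s < r3 \<and> i \<in> I \<and> p + of_real s * d \<in> cut i \<longrightarrow>
      (\<exists>t. p = Q i + of_real t * \<i> \<and> 0 \<le> t \<and> t \<le> h i \<and> (d = \<i> \<and> t < h i \<or> d = -\<i> \<and> 0 < t))"
    by (rule cuts_near)
  define s where "s = min r1 (min r2 r3) / 2"
  have s: "0 < s" "s < r1" "s < r2" "s < r3" using r1 r2 r3 by (auto simp: s_def)
  have "p + of_real s * d \<in> frontier S" "p + of_real s * d \<notin> frontier H" using r1(2) r2(2) s g by auto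
  then obtain i where i: "i \<in> I" "p + of_real s * d \<in> cut i" using piece(4)[OF S] by blast
  obtain t where "p = Q i + of_real t * \<i>" "0 \<le> t" "t \<le> h i" "d = \<i> \<and> t < h i \<or> d = -\<i> \<and> 0 < t"
    using r3(2)[rule_format, OF d, of s i] s i by blast
  then show thesis using that i(1) by blast
qed

text \<open>Inner points of a piece avoid the cuts, so no piece owns both quadrants that border a
  stretch of a cut.\<close>

lemma cut_separates:
  assumes S: "S \<in> P" and i: "i \<in> I" and t: "0 \<le> t" "t \<le> h i"
  shows "t < h i \<Longrightarrow> \<not> (quad S (Q i + of_real t * \<i>) \<i> \<and> quad S (Q i + of_real t * \<i>) 1)"
    "0 < t \<Longrightarrow> \<not> (quad S (Q i + of_real t * \<i>) (-\<i>) \<and> quad S (Q i + of_real t * \<i>) (-1))"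
proof -
  define p where "p = Q i + of_real t * \<i>"
  obtain r where r: "r > 0" "\<forall>d\<in>dirs. \<forall>s t. 0 < s \<and> s < r \<and> 0 < t \<and> t < r \<longrightarrow>
       p + of_real s * d + of_real t * (\<i> * d) \<notin> frontier S \<and>
       (p + of_real s * d + of_real t * (\<i> * d) \<in> interior S \<longleftrightarrow> quad S p d)"
    "\<forall>d\<in>dirs. \<forall>s. 0 < s \<and> s < r \<longrightarrow> (p + of_real s * d \<in> frontier S \<longleftrightarrow> germ S p d) \<and>
      (p + of_real s * d \<in> interior S \<longleftrightarrow> quad S p d \<and> quad S p (-(\<i> * d)))"
    by (rule quad_local[OF piece(1)[OF S]])
  {
    assume th: "t < h i"
    define s where "s = min r (h i - t) / 2"
    have s: "0 < s" "s < r" "s < h i - t" using r(1) th by (auto simp: s_def)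
    have "p + of_real s * \<i> = Q i + of_real (t + s) * \<i>" by (simp add: p_def algebra_simps)
    then have "p + of_real s * \<i> \<in> cut i" unfolding cut_iff[OF i] using s t by (intro exI[of _ "t + s"]) simp
    then have "p + of_real s * \<i> \<notin> interior S" using piece(6)[OF S i] by blast
    then show "\<not> (quad S (Q i + of_real t * \<i>) \<i> \<and> quad S (Q i + of_real t * \<i>) 1)"
      using r(3)[rule_format, OF dirs_simps(3), of s] s unfolding p_def[symmetric] by simp
  next
    assume th: "0 < t"
    define s where "s = min r t / 2"
    have s: "0 < s" "s < r" "s < t" using r(1) th by (auto simp: s_def)
    have "p + of_real s * (-\<i>) = Q i + of_real (t - s) * \<i>" by (simp add: p_def algebra_simps)
    then have "p + of_real s * (-\<i>) \<in> cut i" unfolding cut_iff[OF i] using s t by (intro exI[of _ "t - s"]) simp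
    then have "p + of_real s * (-\<i>) \<notin> interior S" using piece(6)[OF S i] by blast
    then show "\<not> (quad S (Q i + of_real t * \<i>) (-\<i>) \<and> quad S (Q i + of_real t * \<i>) (-1))"
      using r(3)[rule_format, OF dirs_simps(4), of s] s unfolding p_def[symmetric] by simp
  }
qed

text \<open>Near \<open>p\<close> the cuts stay on the axes through \<open>p\<close>, so a small
  open square in the quadrant avoids them; being connected, it lies in one component.\<close>

lemma quad_piece_exists:
  assumes d: "d \<in> dirs" and q: "quad H p d"
  obtains S where "S \<in> P" "quad S p d"
proof -
  obtain r where r: "r > 0" "\<forall>s t. 0 < s \<and> s < r \<and> 0 < t \<and> t < r \<longrightarrow>
     p + of_real s * d + of_real t * (\<i> * d) \<in> interior H" using q unfolding quad_def by blast
  have "cross_like (\<Union>(cut ` I))"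
    by (rule cross_like_Union) (use finI in \<open>auto simp: cut_def top_def intro!: cross_like_segment\<close>)
  then obtain r' where r': "r' > 0" "\<forall>z\<in>\<Union>(cut ` I). dist p z < r' \<longrightarrow> Re z = Re p \<or> Im z = Im p"
    unfolding cross_like_def by blast
  define m where "m = min r (r'/2)"
  have m: "0 < m" "m \<le> r" "m \<le> r'/2" using r(1) r'(1) by (auto simp: m_def)
  define X where "X = (\<lambda>(s,t). p + of_real s * d + of_real t * (\<i> * d)) ` ({0<..<m} \<times> {0<..<m})"
  have "connected X" unfolding X_def by (rule connected_rect)
  moreover have "X \<subseteq> U"
  proof
    fix z assume "z \<in> X"
    then obtain s t where st: "0 < s" "s < m" "0 < t" "t < m" "z = p + of_real s * d + of_real t * (\<i> * d)"
      unfolding X_def by auto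
    have "z \<in> interior H" unfolding st(5) by (rule r(2)[rule_format]) (use st m in auto)
    moreover have "z \<notin> \<Union>(cut ` I)"
    proof
      assume "z \<in> \<Union>(cut ` I)"
      moreover have "dist p z < r'" unfolding st(5) using norm_dir_comb[OF d, of p s t] st m by simp
      ultimately have "Re z = Re p \<or> Im z = Im p" using r'(2) by blast
      then show False using d st by (auto simp: dirs_def)
    qed
    ultimately show "z \<in> U" by blast
  qed
  moreover have "p + of_real (m/2) * d + of_real (m/2) * (\<i> * d) \<in> X"
    unfolding X_def using m by (intro image_eqI[of _ _ "(m/2, m/2)"]) auto
  ultimately obtain K where K: "K \<in> components U" "X \<subseteq> K"
    using exists_component_superset[of X U] by blast
  have "quad (closure K) p d"
    unfolding quad_def using components_U(3)[OF K(1)] K(2) m(1) unfolding X_def by (intro exI[of _ m]) force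
  then show thesis using that[of "closure K"] K(1) unfolding P_eq by blast
qed

lemma piece_quad_pat:
  assumes S: "S \<in> P"
  shows "quad S p 1 \<longrightarrow> quad H p 1" "quad S p \<i> \<longrightarrow> quad H p \<i>" "quad S p (-1) \<longrightarrow> quad H p (-1)"
    "quad S p (-\<i>) \<longrightarrow> quad H p (-\<i>)"
    "germ S p 1 \<longrightarrow> germ H p 1" "germ S p (-1) \<longrightarrow> germ H p (-1)"
proof -
  show "quad S p 1 \<longrightarrow> quad H p 1" "quad S p \<i> \<longrightarrow> quad H p \<i>" "quad S p (-1) \<longrightarrow> quad H p (-1)"
    "quad S p (-\<i>) \<longrightarrow> quad H p (-\<i>)" using quad_piece_imp[OF S] by simp_all
  have "germ H p d" if d: "d \<in> dirs" "d \<noteq> \<i>" "d \<noteq> -\<i>" "germ S p d" for d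
  proof (rule ccontr)
    assume g: "\<not> germ H p d"
    obtain i t where "i \<in> I" "p = Q i + of_real t * \<i>" "0 \<le> t" "t \<le> h i" "d = \<i> \<and> t < h i \<or> d = -\<i> \<and> 0 < t"
      by (rule quad_piece_germ[OF S d(1,4) g])
    then show False using d(2,3) by simp
  qed
  from this[of 1] this[of "-1"] show "germ S p 1 \<longrightarrow> germ H p 1" "germ S p (-1) \<longrightarrow> germ H p (-1)"
    by (simp_all add: complex_eq_iff)
qed

text \<open>Off the cuts every germ of a piece is a germ of \<open>H\<close>, so
  \<open>subquadrant_pattern\<close> applies.\<close>

lemma pat_off_cuts:
  assumes S: "S \<in> P" and p: "p \<notin> \<Union>(cut ` I)"
  shows "pat S p = pat H p \<or> pat S p = (False, False, False, False)"
proof -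
  have v: "germ S p d \<longrightarrow> germ H p d" if d: "d \<in> dirs" for d
  proof (intro impI, rule ccontr)
    assume g: "germ S p d" "\<not> germ H p d"
    obtain i t where i: "i \<in> I" "p = Q i + of_real t * \<i>" "0 \<le> t" "t \<le> h i"
      "d = \<i> \<and> t < h i \<or> d = -\<i> \<and> 0 < t" by (rule quad_piece_germ[OF S d g])
    have "p \<in> cut i" unfolding cut_iff[OF i(1)] using i(2-4) by (intro exI[of _ t]) simp
    then show False using p i(1) by blast
  qed
  have m: "quad H p 1 \<noteq> quad H p (-1) \<or> quad H p \<i> \<noteq> quad H p (-\<i>) \<or>
      (quad H p 1 = quad H p \<i> \<and> quad H p \<i> = quad H p (-1) \<and> quad H p (-1) = quad H p (-\<i>))"
  proof (cases "p \<in> frontier H")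
    case True
    then show ?thesis unfolding frontier_iff_quads[OF H] by (elim disjE) simp_all
  next
    case False
    from quads_off_frontier[OF H this] show ?thesis by simp
  qed
  have g: "quad S p 1 \<noteq> quad S p (-\<i>) \<longrightarrow> quad H p 1 \<noteq> quad H p (-\<i>)"
    "quad S p \<i> \<noteq> quad S p 1 \<longrightarrow> quad H p \<i> \<noteq> quad H p 1"
    "quad S p (-1) \<noteq> quad S p \<i> \<longrightarrow> quad H p (-1) \<noteq> quad H p \<i>"
    "quad S p (-\<i>) \<noteq> quad S p (-1) \<longrightarrow> quad H p (-\<i>) \<noteq> quad H p (-1)"
    using v[of 1] v[of \<i>] v[of "-1"] v[of "-\<i>"] by (simp_all add: germ_def)
  have "(quad S p 1 = quad H p 1 \<and> quad S p \<i> = quad H p \<i> \<and> quad S p (-1) = quad H p (-1) \<and>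
      quad S p (-\<i>) = quad H p (-\<i>)) \<or>
      (\<not> quad S p 1 \<and> \<not> quad S p \<i> \<and> \<not> quad S p (-1) \<and> \<not> quad S p (-\<i>))"
    by (rule subquadrant_pattern[OF piece_quad_pat(1-4)[OF S, of p] g m])
  then show ?thesis unfolding pat_def by simp
qed

text \<open>All four quadrants are interior to \<open>H\<close>. A piece has no horizontal germ here
  and cannot own both sides of the cut, so it takes the right half, the left half or
  nothing.\<close>

lemma pat_on_cut:
  assumes S: "S \<in> P" and i: "i \<in> I" and t: "0 < t" "t < h i"
  shows "pat S (Q i + of_real t * \<i>) \<in> {(True,False,False,True), (False,True,True,False), (False,False,False,False)}"
  using cut_separates[OF S i, of t] t piece_quad_pat(5,6)[OF S, of "Q i + of_real t * \<i>"]
    quads_off_frontier[OF H, of "Q i + of_real t * \<i>"] cut_interior[OF i t]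
  unfolding germ_def pat_def by (auto simp: frontier_def)

text \<open>The cut prolongs the notch upwards and separates NW from NE, while NE and SE stay
  together. To the piece on the left, \<open>Q i\<close> looks like the lower end of a rightmost
  edge.\<close>

lemma pat_at_Q:
  assumes S: "S \<in> P" and i: "i \<in> I"
  shows "pat S (Q i) \<in> {(False,True,False,False), (True,False,False,True), (False,False,False,False)}"
  using cut_separates(1)[OF S i, of 0] hpos[OF i] piece_quad_pat[OF S, of "Q i"] Qpat[OF i]
  unfolding germ_def pat_def by auto

text \<open>The cut separates SW from SE; an interior quadrant above stays with the one below
  it.\<close>

lemma pat_at_top:
  assumes S: "S \<in> P" and i: "i \<in> I"
  shows "pat H (top i) = (False,False,True,True) \<Longrightarrow>
      pat S (top i) \<in> {(False,False,True,False), (False,False,False,True), (False,False,False,False)}"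
    "pat H (top i) = (False,True,True,True) \<Longrightarrow>
      pat S (top i) \<in> {(False,True,True,False), (False,False,False,True), (False,False,False,False)}"
    "pat H (top i) = (True,False,True,True) \<Longrightarrow>
      pat S (top i) \<in> {(False,False,True,False), (True,False,False,True), (False,False,False,False)}"
  using cut_separates(2)[OF S i, of "h i"] hpos[OF i] piece_quad_pat[OF S, of "top i"]
  unfolding germ_def pat_def top_def by auto

lemma cut_point_cases:
  assumes i: "i \<in> I" and z: "z \<in> cut i"
  obtains "z = Q i" | "z = top i" | t where "0 < t" "t < h i" "z = Q i + of_real t * \<i>"
proof -
  obtain t where "0 \<le> t" "t \<le> h i" "z = Q i + of_real t * \<i>" using z cut_iff[OF i] by blast
  then show thesis using that unfolding top_def by (cases "t = 0"; cases "t = h i") auto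
qed

lemma cut_pats:
  assumes S: "S \<in> P" and i: "i \<in> I" and z: "z \<in> cut i"
  shows "pat S z \<in> {(True,False,False,True), (False,True,True,False), (False,True,False,False),
    (False,False,True,False), (False,False,False,True), (False,False,False,False)}"
  using i z
proof (cases rule: cut_point_cases)
  case 1 then show ?thesis using pat_at_Q[OF S i] by auto
next
  case 2 then show ?thesis using pat_at_top[OF S i] top_pat[OF i] by auto
next
  case 3 then show ?thesis using pat_on_cut[OF S i] by auto
qed

end

text \<open>Of the two germs at a boundary point, one has the interior on its left and the other on
  its right.\<close>

lemma out_germ_unique:
  assumes H: "hole H" and d: "d \<in> dirs" "germ H p d" "\<not> quad H p d"
    and d': "d' \<in> dirs" "germ H p d'" "\<not> quad H p d'"
  shows "d' = d"
proof -
  have "d' = d \<or> d' = \<i> * d \<or> d' = -(\<i> * d) \<or> d' = -d"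
    using d(1) d'(1) by (auto simp: dirs_def)
  then show ?thesis
  proof (elim disjE)
    assume "d' = \<i> * d"
    then show ?thesis using d' d(3) by (simp add: germ_rotate)
  next
    assume "d' = -(\<i> * d)"
    then show ?thesis using d d'(3) by (simp add: germ_def)
  next
    assume m: "d' = -d"
    have "quad H p (\<i> * d)" using d' unfolding m germ_uminus by simp
    moreover have "quad H p (-(\<i> * d))" using d(2,3) unfolding germ_def by simp
    ultimately show ?thesis
      using frontier_iff_quads_dir[OF H d(1), of p] germ_imp_frontier[OF H d(1,2)] d(3) d'(3) m by simp
  qed
qed

text \<open>Only the orientation of the two edges enters, so this applies to pieces, for which no
  list of vertices in clockwise order is constructed.\<close>

lemma falling_corner_pat:
  assumes H: "hole H" and f: "falling_corner H p"
  shows "pat H p = (False, True, True, True)"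
proof -
  obtain a b where a: "downward_edge H a p" and b: "rightward_edge H p b"
    using f unfolding falling_corner_def by blast
  have ca: "clockwise_edge H a p" "Re a = Re p" "Im p < Im a" using a unfolding downward_edge_def by simp_all
  have cb: "clockwise_edge H p b" "Im p = Im b" "Re p < Re b" using b unfolding rightward_edge_def by simp_all
  obtain d l where d: "dir_edge H a d l" "p = a + of_real l * d" "\<not> quad H a d"
    by (rule clockwise_edge_orientation[OF H ca(1)])
  obtain d' l' where d': "dir_edge H p d' l'" "b = p + of_real l' * d'" "\<not> quad H p d'"
    by (rule clockwise_edge_orientation[OF H cb(1)])
  have dd: "d = -\<i>" using dir_edgeD(1,2)[OF d(1)] d(2) ca(2,3) by (auto simp: dirs_def)
  have dd': "d' = 1" using dir_edgeD(1,2)[OF d'(1)] d'(2) cb(2,3) by (auto simp: dirs_def mult_less_0_iff)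
  have "\<not> quad H p 1" using d'(3) dd' by simp
  moreover have "quad H p \<i>"
    using dir_edge_quads(4)[OF H d(1), of l] dir_edgeD(2)[OF d(1)] d(2,3) dd by simp
  moreover have "quad H p (-1) = quad H p \<i>" using dir_edge_quads(6)[OF H d'(1)] dd' by simp
  moreover have "quad H p (-\<i>)" using dir_edge_germs(3)[OF H d'(1)] d'(3) dd' by (simp add: germ_def)
  ultimately show ?thesis by (simp add: pat_def)
qed

lemma up_edge_points:
  assumes H: "hole H" and e: "dir_edge H a \<i> l" and z: "z \<in> closed_segment a (a + of_real l * \<i>)"
  obtains "z = a" | "z = a + of_real l * \<i>"
    | "pat H z = (\<not> quad H a \<i>, quad H a \<i>, quad H a \<i>, \<not> quad H a \<i>)"
proof -
  note D = dir_edgeD[OF e]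
  obtain t where t: "0 \<le> t" "t \<le> l" "z = a + of_real t * \<i>"
    using z unfolding in_ray_segment[OF D(1) less_imp_le[OF D(2)]] by (elim exE conjE)
  show thesis
  proof (cases "t = 0 \<or> t = l")
    case True then show thesis using that(1,2) t(3) by auto
  next
    case False
    then have "0 < t" "t < l" using t by auto
    then show thesis using that(3) up_edge_quads(6)[OF H e] t(3) by simp
  qed
qed

section \<open>Comparing the boundary of a piece with that of the hole\<close>

context cut_hole
begin

text \<open>A boundary point of \<open>H\<close> on a cut is one of its ends: \<open>Q i\<close> has
  the excluded pattern, and \<open>top i\<close> has SW and SE interior.\<close>

lemma off_cuts:
  assumes z: "z \<in> frontier H" "pat H z \<noteq> (True,True,False,True)"
    "\<not> (quad H z (-1) \<and> quad H z (-\<i>))"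
  shows "z \<notin> \<Union>(cut ` I)"
proof
  assume "z \<in> \<Union>(cut ` I)"
  then obtain i where i: "i \<in> I" "z \<in> cut i" by blast
  have "z = Q i \<or> z = top i" using cut_frontier[OF i z(1)] .
  then show False
  proof
    assume "z = Q i" then show False using Qpat[OF i(1)] z(2) by simp
  next
    assume "z = top i" then show False using top_pat[OF i(1)] z(3) by (auto simp: pat_def)
  qed
qed

lemma frontier_piece_pat:
  assumes S: "S \<in> P" and z: "z \<in> frontier S" "z \<notin> \<Union>(cut ` I)"
  shows "pat S z = pat H z"
  using pat_off_cuts[OF S z(2)] z(1) frontier_iff_pat[OF piece(1)[OF S], of z] by auto

lemma boundary_point_pat:
  assumes S: "S \<in> P" and z: "z \<in> S" "z \<in> frontier H" "z \<notin> \<Union>(cut ` I)"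
  shows "pat S z = pat H z" "z \<in> frontier S"
proof -
  have "z \<notin> interior S" using z(2) piece(5)[OF S] by (auto simp: frontier_def)
  then show "z \<in> frontier S" using hole_facts(5)[OF piece(1)[OF S]] z(1) by blast
  then show "pat S z = pat H z" using frontier_piece_pat[OF S _ z(3)] by blast
qed

text \<open>Off the cuts both pieces have the pattern of \<open>H\<close> at \<open>z\<close>, so
  they share a quadrant.\<close>

lemma unique_piece:
  assumes S: "S \<in> P" "S' \<in> P" and z: "z \<in> S" "z \<in> S'" "z \<in> frontier H" "z \<notin> \<Union>(cut ` I)"
  shows "S = S'"
proof -
  have eq: "pat S z = pat S' z" using boundary_point_pat(1) S z by metis
  have "pat S z \<noteq> (False,False,False,False)"
    using boundary_point_pat(2)[OF S(1) z(1,3,4)] frontier_iff_pat[OF piece(1)[OF S(1)], of z] by auto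
  then have "quad S z 1 \<and> quad S' z 1 \<or> quad S z \<i> \<and> quad S' z \<i> \<or>
      quad S z (-1) \<and> quad S' z (-1) \<or> quad S z (-\<i>) \<and> quad S' z (-\<i>)"
    using eq unfolding pat_def by auto
  then show ?thesis using quad_piece_unique[OF S] by blast
qed

text \<open>The pieces are finitely many closed sets covering the boundary and disjoint on it off
  the cuts. This allows a piece to be followed along the boundary of \<open>H\<close> without
  knowing its own boundary.\<close>

lemma connected_in_piece:
  assumes S: "S \<in> P" and A: "connected A" "A \<subseteq> frontier H" "A \<inter> \<Union>(cut ` I) = {}" "A \<inter> S \<noteq> {}"
  shows "A \<subseteq> S"
proof -
  have cl: "closed X" if "X \<in> P" for X using piece(3)[OF that] closed_closure by metis
  have fin: "finite (P - {S})" using card_P(1) by simp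
  have "closed (\<Union>(P - {S}))" using fin cl by (intro closed_Union) auto
  moreover have "A \<subseteq> S \<union> \<Union>(P - {S})"
  proof -
    have "frontier H \<subseteq> H" using hole_facts(5)[OF H] by blast
    then show ?thesis using A(2) Union_P by blast
  qed
  moreover have "S \<inter> \<Union>(P - {S}) \<inter> A = {}"
  proof (rule ccontr)
    assume "S \<inter> \<Union>(P - {S}) \<inter> A \<noteq> {}"
    then obtain z S' where z: "z \<in> A" "z \<in> S" "z \<in> S'" "S' \<in> P" "S' \<noteq> S" by blast
    have "z \<in> frontier H" "z \<notin> \<Union>(cut ` I)" using z(1) A(2,3) by blast+
    then show False using unique_piece[OF S z(4,2,3)] z(5) by blast
  qed
  ultimately have "S \<inter> A = {} \<or> \<Union>(P - {S}) \<inter> A = {}"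
    using A(1) cl[OF S] unfolding connected_closed by blast
  then show ?thesis using A(4) \<open>A \<subseteq> S \<union> \<Union>(P - {S})\<close> by blast
qed

lemma connected_in_some_piece:
  assumes A: "connected A" "A \<subseteq> frontier H" "A \<inter> \<Union>(cut ` I) = {}" "z \<in> A"
  obtains S where "S \<in> P" "A \<subseteq> S"
proof -
  have "z \<in> H" using A(2,4) hole_facts(5)[OF H] by blast
  then obtain S where S: "S \<in> P" "z \<in> S" using Union_P by blast
  then show thesis using connected_in_piece[OF S(1) A(1-3)] A(4) that by blast
qed

lemma edge_off_cuts_of_piece:
  assumes S: "S \<in> P" and e: "dir_edge S a d l"
    and off: "closed_segment a (a + of_real l * d) \<inter> \<Union>(cut ` I) = {}"
  shows "dir_edge H a d l" "z \<in> closed_segment a (a + of_real l * d) \<Longrightarrow> pat H z = pat S z"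
proof -
  note D = dir_edgeD[OF e]
  note seg = in_ray_segment[OF D(1) less_imp_le[OF D(2)]]
  have on: "a + of_real s * d \<in> closed_segment a (a + of_real l * d)" if "0 \<le> s \<and> s \<le> l" for s
    unfolding seg using that by (intro exI[of _ s]) simp
  have eq: "pat H (a + of_real s * d) = pat S (a + of_real s * d)" if s: "0 \<le> s \<and> s \<le> l" for s
  proof -
    have "a + of_real s * d \<notin> \<Union>(cut ` I)" using on[OF s] off by blast
    then show ?thesis using frontier_piece_pat[OF S] D(3) s by simp
  qed
  show "dir_edge H a d l" using dir_edge_cong[OF H piece(1)[OF S] e] eq by blast
  assume "z \<in> closed_segment a (a + of_real l * d)"
  then obtain s where s: "0 \<le> s" "s \<le> l" "z = a + of_real s * d" unfolding seg by (elim exE conjE)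
  show "pat H z = pat S z" unfolding s(3) using eq s(1,2) by blast
qed

lemma edge_off_cuts_in_piece:
  assumes S: "S \<in> P" and e: "dir_edge H a d l"
    and off: "closed_segment a (a + of_real l * d) \<inter> \<Union>(cut ` I) = {}"
    and sub: "closed_segment a (a + of_real l * d) \<subseteq> S"
  shows "dir_edge S a d l" "pat S a = pat H a" "pat S (a + of_real l * d) = pat H (a + of_real l * d)"
proof -
  note D = dir_edgeD[OF e]
  note seg = in_ray_segment[OF D(1) less_imp_le[OF D(2)]]
  have eq: "pat S (a + of_real s * d) = pat H (a + of_real s * d)" if s: "0 \<le> s \<and> s \<le> l" for s
  proof -
    have z: "a + of_real s * d \<in> closed_segment a (a + of_real l * d)"
      unfolding seg using s by (intro exI[of _ s]) simp
    then have "a + of_real s * d \<notin> \<Union>(cut ` I)" using off by blast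
    then show ?thesis using boundary_point_pat(1)[OF S] D(3) s z sub by blast
  qed
  show "dir_edge S a d l" using dir_edge_cong[OF piece(1)[OF S] H e] eq by blast
  show "pat S a = pat H a" "pat S (a + of_real l * d) = pat H (a + of_real l * d)"
    using eq[of 0] eq[of l] D(2) by simp_all
qed

text \<open>An upward edge of the piece that meets the cut contains the part of the cut below the
  meeting point: if it started on the cut above \<open>Q i\<close>, the cut would continue it
  downwards, against maximality.\<close>

lemma cut_reaches_Q:
  assumes S: "S \<in> P" and e: "dir_edge S a \<i> l" and i: "i \<in> I" and x: "a + of_real s * \<i> \<in> cut i" "0 \<le> s" "s \<le> l"
  obtains s' where "0 \<le> s'" "s' \<le> s" "Q i = a + of_real s' * \<i>"
proof -
  note D = dir_edgeD[OF e]
  obtain t where t: "0 \<le> t" "t \<le> h i" "a + of_real s * \<i> = Q i + of_real t * \<i>" using x(1) cut_iff[OF i] by blast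
  show thesis
  proof (cases "t \<le> s")
    case True
    have "Q i = a + of_real (s - t) * \<i>" using t(3) by (simp add: algebra_simps)
    then show thesis using that[of "s - t"] True t(1) by simp
  next
    case False
    define u where "u = t - s"
    have u: "0 < u" "u \<le> h i" using False t x(2) by (auto simp: u_def)
    have a: "a = Q i + of_real u * \<i>" using t(3) by (simp add: u_def algebra_simps)
    have "a + of_real 0 * \<i> \<in> frontier S" by (rule D(3)[rule_format]) (use D(2) in simp)
    then have nz: "pat S a \<noteq> (False,False,False,False)" using frontier_iff_pat[OF piece(1)[OF S], of a] by auto
    have "germ S a (-\<i>)"
    proof (cases "u = h i")
      case True
      then have "a = top i" using a by (simp add: top_def)
      then show ?thesis using pat_at_top[OF S i] top_pat[OF i] nz unfolding pat_germs by auto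
    next
      case False
      then show ?thesis using pat_on_cut[OF S i, of u] u nz a unfolding pat_germs by auto
    qed
    then show thesis using D(5) by simp
  qed
qed

text \<open>The edge contains \<open>Q i\<close>, where the piece on the left of the cut owns NW
  only; such a point can only be the lower end of the edge.\<close>

lemma left_edge_cut:
  assumes S: "S \<in> P" and e: "dir_edge S a \<i> l" "quad S a \<i>" and i: "i \<in> I"
    and x: "x \<in> cut i" "x \<in> closed_segment a (a + of_real l * \<i>)"
  shows "a = Q i" "pat S a = (False,True,False,False)"
proof -
  note D = dir_edgeD[OF e(1)] and U = up_edge_quads[OF piece(1)[OF S] e(1)]
  obtain s where s: "0 \<le> s" "s \<le> l" "x = a + of_real s * \<i>"
    using x(2) unfolding in_ray_segment[OF D(1) less_imp_le[OF D(2)]] by (elim exE conjE)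
  obtain s' where s': "0 \<le> s'" "s' \<le> s" "Q i = a + of_real s' * \<i>"
    by (rule cut_reaches_Q[OF S e(1) i x(1)[unfolded s(3)] s(1,2)])
  note pQ = pat_at_Q[OF S i]
  have "\<not> (0 < s' \<and> s' < l)" using U(6)[of s'] pQ e(2) s'(3) by auto
  moreover have "s' \<noteq> l" using U(4) pQ e(2) s'(3) by (auto simp: pat_def)
  ultimately have "s' = 0" using s' s by auto
  then show "a = Q i" using s'(3) by simp
  then show "pat S a = (False,True,False,False)" using pQ e(2) by (auto simp: pat_def)
qed

end

section \<open>The pieces are nice holes\<close>

text \<open>\<open>all_notches\<close> says that every left notch is cut.
  \<open>clockwise_out\<close> is all that is used here of the list of vertices.\<close>

locale BLS_cut = cut_hole +
  assumes no_right: "\<nexists>e. right_notch H e" and no_top: "\<nexists>e. top_notch H e"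
    and notch: "i \<in> I \<Longrightarrow> \<exists>c m. dir_edge H c \<i> m \<and> Q i = c + of_real m * \<i> \<and> pat H c = (True,False,True,True)"
    and all_notches: "left_notch H (closed_segment c (c + of_real m * \<i>)) \<Longrightarrow> dir_edge H c \<i> m \<Longrightarrow>
      c + of_real m * \<i> \<in> Q ` I"
    and clockwise_out: "v \<in> vertices H \<Longrightarrow> \<exists>b. clockwise_edge H v b"
    and falling: "\<exists>\<^sub>\<le>\<^sub>1p. falling_corner H p"
    and rightmost_unique: "\<exists>!e. rightmost_edge H e"
begin

text \<open>The edge may run through several notches and cuts on one vertical line, since
  \<open>top i\<close> can be the lower vertex of another notch. Below the lowest \<open>Q i\<close>
  on the edge lies its notch, whose lower vertex \<open>c\<close> is off the cuts and keeps the
  pattern of \<open>H\<close>; this forces the edge to start at \<open>c\<close>. So SW is interior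
  at the start, unlike at a leftmost edge.\<close>

lemma right_edge_cut:
  assumes S: "S \<in> P" and e: "dir_edge S a \<i> l" "\<not> quad S a \<i>" and i0: "i0 \<in> I"
    and x: "x \<in> cut i0" "x \<in> closed_segment a (a + of_real l * \<i>)"
  shows "pat S a = (True,False,True,True)"
proof -
  note D = dir_edgeD[OF e(1)] and U = up_edge_quads[OF piece(1)[OF S] e(1)]
  note hS = piece(1)[OF S]
  define A where "A = {i\<in>I. \<exists>s. 0 \<le> s \<and> s \<le> l \<and> Q i = a + of_real s * \<i>}"
  obtain s where s: "0 \<le> s" "s \<le> l" "x = a + of_real s * \<i>"
    using x(2) unfolding in_ray_segment[OF D(1) less_imp_le[OF D(2)]] by (elim exE conjE)
  obtain s' where s': "0 \<le> s'" "s' \<le> s" "Q i0 = a + of_real s' * \<i>"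
    by (rule cut_reaches_Q[OF S e(1) i0 x(1)[unfolded s(3)] s(1,2)])
  have "i0 \<in> A" unfolding A_def using i0 s' s(2) by auto
  moreover have finA: "finite A" unfolding A_def using finI by simp
  \<comment> \<open>The lowest cut on the edge: a cut through the lower vertex of its notch would
    have to start lower still.\<close>
  ultimately obtain i where i: "i \<in> A" "\<forall>j\<in>A. \<not> Im (Q j) < Im (Q i)"
    using arg_min_if_finite[of A "\<lambda>i. Im (Q i)"] by blast
  obtain s where s: "i \<in> I" "0 \<le> s" "s \<le> l" "Q i = a + of_real s * \<i>" using i(1) unfolding A_def by blast
  have fr: "a + of_real t * \<i> \<in> frontier S" if "0 \<le> t" "t \<le> l" for t using D(3) that by blast
  have nz: "pat S z \<noteq> (False,False,False,False)" if "z \<in> frontier S" for z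
    using that frontier_iff_pat[OF hS, of z] by auto
  have pQ: "pat S (Q i) \<in> {(False,True,False,False), (True,False,False,True)}"
    using pat_at_Q[OF S s(1)] nz[OF fr[OF s(2,3)]] s(4) by auto
  have aS: "pat S a \<noteq> (True,False,False,True)" using U(2) by (auto simp: pat_def)
  have s0: "s \<noteq> 0" using pQ aS e(2) s(4) by (auto simp: pat_def)
  obtain c m where c: "dir_edge H c \<i> m" "Q i = c + of_real m * \<i>" "pat H c = (True,False,True,True)"
    using notch[OF s(1)] by blast
  note Dc = dir_edgeD[OF c(1)] and Uc = up_edge_quads[OF H c(1)]
  have qc: "\<not> quad H c \<i>" using c(3) by (simp add: pat_def)
  have c_eq: "c = a + of_real (s - m) * \<i>" using c(2) s(4) by (simp add: algebra_simps)
  show ?thesis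
  proof (cases "s < m")
    case True
    \<comment> \<open>If the edge started above \<open>c\<close>, then \<open>a\<close> would be an
      inner point of the notch, where the boundary runs straight on.\<close>
    have a_eq: "a = c + of_real (m - s) * \<i>" using c_eq by (simp add: algebra_simps)
    have pa: "pat H a = (True,False,False,True)" unfolding a_eq using Uc(6)[of "m - s"] True s s0 qc by simp
    then have "a \<in> frontier H" unfolding frontier_iff_pat[OF H] by simp
    then have "a \<notin> \<Union>(cut ` I)" by (rule off_cuts) (use pa in \<open>auto simp: pat_def\<close>)
    then have "pat S a = (True,False,False,True)"
      using frontier_piece_pat[OF S, of a] fr[of 0] D(2) pa by simp
    then show ?thesis using aS by simp
  next
    case False
    then have sm: "0 \<le> s - m" "s - m \<le> l" using s Dc(2) by auto
    have cS: "c \<in> frontier S" unfolding c_eq by (rule fr[OF sm])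
    have "c \<notin> \<Union>(cut ` I)"
    proof
      assume "c \<in> \<Union>(cut ` I)"
      then obtain j where j: "j \<in> I" "c \<in> cut j" by blast
      obtain t where t: "0 \<le> t" "t \<le> s - m" "Q j = a + of_real t * \<i>"
        by (rule cut_reaches_Q[OF S e(1) j(1) j(2)[unfolded c_eq] sm])
      then have "j \<in> A" unfolding A_def using j(1) sm by auto
      moreover have "Im (Q j) < Im (Q i)" using t s(4) Dc(2) by simp
      ultimately show False using i(2) by blast
    qed
    then have pc: "pat S c = (True,False,True,True)" using frontier_piece_pat[OF S cS] c(3) by simp
    have "s - m = 0"
    proof (rule ccontr)
      assume "s - m \<noteq> 0"
      then have "pat S c = (True,False,False,True)"
        using U(6)[of "s - m"] sm s Dc(2) e(2) c_eq by simp
      then show False using pc by simp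
    qed
    then show ?thesis using pc c_eq by simp
  qed
qed

text \<open>The interior is to the left of the edge, and the pattern at its lower end is not the one
  forced by \<open>left_edge_cut\<close>; so the edge avoids the cuts and is a right notch of
  \<open>H\<close>.\<close>

lemma piece_no_right_notch:
  assumes S: "S \<in> P" shows "\<not> right_notch S e"
proof
  assume "right_notch S e"
  then obtain a l where a: "dir_edge S a \<i> l" "e = closed_segment a (a + of_real l * \<i>)"
    "pat S a = (False, True, True, True)" "pat S (a + of_real l * \<i>) = (True, True, True, False)"
    unfolding right_notch_iff[OF piece(1)[OF S]] by (elim exE conjE)
  have q: "quad S a \<i>" using a(3) by (simp add: pat_def)
  have off: "closed_segment a (a + of_real l * \<i>) \<inter> \<Union>(cut ` I) = {}"
  proof (rule ccontr)
    assume "\<not> ?thesis"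
    then obtain i x where "i \<in> I" "x \<in> cut i" "x \<in> closed_segment a (a + of_real l * \<i>)" by blast
    then have "pat S a = (False,True,False,False)" using left_edge_cut(2)[OF S a(1) q] by blast
    then show False using a(3) by simp
  qed
  note E = edge_off_cuts_of_piece[OF S a(1) off]
  have "right_notch H e"
    unfolding right_notch_iff[OF H]
    by (intro exI[of _ a] exI[of _ l] conjI E(1) a(2)) (use E(2) a(3,4) in simp_all)
  then show False using no_right by blast
qed

text \<open>None of the patterns along a top notch is possible for a piece at a point of a cut, so
  the edge is already a top notch of \<open>H\<close>.\<close>

lemma piece_no_top_notch:
  assumes S: "S \<in> P" shows "\<not> top_notch S e"
proof
  assume "top_notch S e"
  then obtain a l where a: "dir_edge S a 1 l" "e = closed_segment a (a + of_real l * 1)"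
    "pat S a = (False, True, True, True)" "pat S (a + of_real l * 1) = (True, False, True, True)"
    unfolding top_notch_iff[OF piece(1)[OF S]] by (elim exE conjE)
  note D = dir_edgeD[OF a(1)]
  have q: "\<not> quad S a 1" using a(3) by (simp add: pat_def)
  have off: "closed_segment a (a + of_real l * 1) \<inter> \<Union>(cut ` I) = {}"
  proof (rule ccontr)
    assume "\<not> ?thesis"
    then obtain i x where i: "i \<in> I" "x \<in> cut i" "x \<in> closed_segment a (a + of_real l * 1)" by blast
    obtain s where s: "0 \<le> s" "s \<le> l" "x = a + of_real s * 1"
      using i(3) unfolding in_ray_segment[OF D(1) less_imp_le[OF D(2)]] by (elim exE conjE)
    consider "s = 0" | "s = l" | "0 < s" "s < l" using s by linarith
    then have "pat S x \<in> {(False, True, True, True), (True, False, True, True), (False,False,True,True)}"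
    proof cases
      case 1 then show ?thesis using a(3) s(3) by simp
    next
      case 2 then show ?thesis using a(4) s(3) by simp
    next
      case 3 then show ?thesis using right_edge_quads(6)[OF piece(1)[OF S] a(1), of s] q s(3) by simp
    qed
    then show False using cut_pats[OF S i(1,2)] by auto
  qed
  note E = edge_off_cuts_of_piece[OF S a(1) off]
  have pa: "pat H a = (False, True, True, True)" using E(2)[of a] a(3) by simp
  have pb: "pat H (a + of_real l * 1) = (True, False, True, True)" using E(2)[of "a + of_real l * 1"] a(4) by simp
  have "top_notch H e"
    unfolding top_notch_iff[OF H]
    by (intro exI[of _ a] exI[of _ l] conjI E(1) a(2) pa pb)
  then show False using no_top by blast
qed

text \<open>The pattern at the upper end \<open>b\<close> does not occur on a cut, so
  \<open>H\<close> has it there too. The edge of \<open>H\<close> below \<open>b\<close> is not a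
  left notch, as left notches are cut at their upper vertex. The only other pattern at its lower end
  conflicts with the piece, wherever the two edges end.\<close>

lemma piece_no_left_notch:
  assumes S: "S \<in> P" shows "\<not> left_notch S e"
proof
  assume "left_notch S e"
  then obtain a l where a: "dir_edge S a \<i> l" "e = closed_segment a (a + of_real l * \<i>)"
    "pat S a = (True, False, True, True)" "pat S (a + of_real l * \<i>) = (True, True, False, True)"
    unfolding left_notch_iff[OF piece(1)[OF S]] by (elim exE conjE)
  note D = dir_edgeD[OF a(1)] and U = up_edge_quads[OF piece(1)[OF S] a(1)]
  define b where "b = a + of_real l * \<i>"
  have q: "\<not> quad S a \<i>" using a(3) by (simp add: pat_def)
  have bS: "b \<in> frontier S" unfolding b_def by (rule D(3)[rule_format]) (use D(2) in simp)
  have boff: "b \<notin> \<Union>(cut ` I)" using cut_pats[OF S] a(4) unfolding b_def by fastforce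
  have pb: "pat H b = (True, True, False, True)" using frontier_piece_pat[OF S bS boff] a(4) by (simp add: b_def)
  have "germ H b (-\<i>)" "\<not> germ H b (-(-\<i>))" using pb by (simp_all add: pat_germs)
  then obtain m where m: "dir_edge H b (-\<i>) m" using germ_start[OF H dirs_simps(4)] by blast
  define c where "c = b + of_real m * (-\<i>)"
  have c: "dir_edge H c \<i> m" using dir_edge_reverse[OF m] by (simp add: c_def)
  have bc: "c + of_real m * \<i> = b" by (simp add: c_def)
  note Dc = dir_edgeD[OF c] and Uc = up_edge_quads[OF H c, unfolded bc]
  have qc: "\<not> quad H c \<i>" using Uc(5) pb by (simp add: pat_def)
  have "pat H c \<noteq> (True,False,True,True)"
  proof
    assume "pat H c = (True,False,True,True)"
    then have "left_notch H (closed_segment c (c + of_real m * \<i>))"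
      unfolding left_notch_iff[OF H] using c pb bc by (intro exI[of _ c] exI[of _ m]) simp
    then have "b \<in> Q ` I" using all_notches c bc by metis
    then obtain j where "j \<in> I" "b = Q j" by blast
    then show False using boff by (auto simp: cut_def)
  qed
  then have pc: "pat H c = (True,False,False,False)" using Uc(1,2) qc by (auto simp: pat_def)
  have ac: "a = c + of_real (m - l) * \<i>" by (simp add: c_def b_def algebra_simps)
  have ca: "c = a + of_real (l - m) * \<i>" by (simp add: c_def b_def algebra_simps)
  have aS: "a \<in> frontier S" using D(3)[rule_format, of 0] D(2) by simp
  \<comment> \<open>Both edges go down from \<open>b\<close>; where the shorter one ends, the longer
    one runs straight.\<close>
  consider "m > l" | "m = l" | "m < l" by linarith
  then show False
  proof cases
    case 1
    have pa: "pat H a = (True,False,False,True)" unfolding ac using Uc(6)[of "m - l"] 1 D(2) qc by simp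
    then have "a \<in> frontier H" unfolding frontier_iff_pat[OF H] by simp
    then have "a \<notin> \<Union>(cut ` I)" by (rule off_cuts) (use pa in \<open>auto simp: pat_def\<close>)
    then show False using frontier_piece_pat[OF S aS] pa a(3) by simp
  next
    case 2
    then have "a = c" using ac by simp
    have "a \<notin> \<Union>(cut ` I)" using cut_pats[OF S] a(3) by fastforce
    then show False using frontier_piece_pat[OF S aS] pc a(3) \<open>a = c\<close> by simp
  next
    case 3
    have pS: "pat S c = (True,False,False,True)" unfolding ca using U(6)[of "l - m"] 3 Dc(2) q by simp
    have "c \<in> frontier H" unfolding frontier_iff_pat[OF H] using pc by simp
    then have "c \<notin> \<Union>(cut ` I)" by (rule off_cuts) (use pc in \<open>auto simp: pat_def\<close>)
    moreover have "c \<in> frontier S" unfolding frontier_iff_pat[OF piece(1)[OF S]] using pS by simp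
    ultimately show False using frontier_piece_pat[OF S] pc pS by simp
  qed
qed

text \<open>By \<open>right_edge_cut\<close> an edge meeting a cut would start with SW interior, so
  a leftmost edge of a piece avoids the cuts.\<close>

lemma piece_leftmost_edge:
  assumes S: "S \<in> P" and e: "leftmost_edge S e"
  shows "leftmost_edge H e" "e \<subseteq> S"
proof -
  obtain a l where a: "dir_edge S a \<i> l" "e = closed_segment a (a + of_real l * \<i>)"
    "pat S a = (True, False, False, False)" "pat S (a + of_real l * \<i>) = (False, False, False, True)"
    using e unfolding leftmost_edge_iff[OF piece(1)[OF S]] by (elim exE conjE)
  have q: "\<not> quad S a \<i>" using a(3) by (simp add: pat_def)
  have off: "closed_segment a (a + of_real l * \<i>) \<inter> \<Union>(cut ` I) = {}"
  proof (rule ccontr)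
    assume "\<not> ?thesis"
    then obtain i x where "i \<in> I" "x \<in> cut i" "x \<in> closed_segment a (a + of_real l * \<i>)" by blast
    then have "pat S a = (True,False,True,True)" using right_edge_cut[OF S a(1) q] by blast
    then show False using a(3) by simp
  qed
  note E = edge_off_cuts_of_piece[OF S a(1) off]
  show "leftmost_edge H e"
    unfolding leftmost_edge_iff[OF H]
    by (intro exI[of _ a] exI[of _ l] conjI E(1) a(2)) (use E(2) a(3,4) in simp_all)
  have "e \<in> edges S" using e unfolding leftmost_edge_def by (elim conjE)
  then show "e \<subseteq> S" using edges_subset_frontier hole_facts(5)[OF piece(1)[OF S]] by blast
qed

lemma leftmost_edge_off_cuts:
  assumes "leftmost_edge H e" shows "e \<inter> \<Union>(cut ` I) = {}"
proof -
  obtain a l where a: "dir_edge H a \<i> l" "e = closed_segment a (a + of_real l * \<i>)"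
    "pat H a = (True, False, False, False)" "pat H (a + of_real l * \<i>) = (False, False, False, True)"
    using assms unfolding leftmost_edge_iff[OF H] by (elim exE conjE)
  have "e \<in> edges H" using assms unfolding leftmost_edge_def by (elim conjE)
  then have fr: "e \<subseteq> frontier H" by (rule edges_subset_frontier)
  have q: "\<not> quad H a \<i>" using a(3) by (simp add: pat_def)
  have "z \<notin> \<Union>(cut ` I)" if z: "z \<in> e" for z
  proof (rule off_cuts)
    show "z \<in> frontier H" using fr z by blast
    have *: "pat H z \<in> {(True,False,False,False), (False,False,False,True), (True,False,False,True)}"
      using up_edge_points[OF H a(1) z[unfolded a(2)]] a(3,4) q by (metis (full_types) insertCI)
    then show "pat H z \<noteq> (True,True,False,True)" "\<not> (quad H z (-1) \<and> quad H z (-\<i>))" by (auto simp: pat_def)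
  qed
  then show ?thesis by blast
qed

lemma rightmost_edge_off_cuts:
  assumes "rightmost_edge H e" shows "e \<inter> \<Union>(cut ` I) = {}"
proof -
  obtain a l where a: "dir_edge H a \<i> l" "e = closed_segment a (a + of_real l * \<i>)"
    "pat H a = (False, True, False, False)" "pat H (a + of_real l * \<i>) = (False, False, True, False)"
    using assms unfolding rightmost_edge_iff[OF H] by (elim exE conjE)
  have "e \<in> edges H" using assms unfolding rightmost_edge_def by (elim conjE)
  then have fr: "e \<subseteq> frontier H" by (rule edges_subset_frontier)
  have q: "quad H a \<i>" using a(3) by (simp add: pat_def)
  have "z \<notin> \<Union>(cut ` I)" if z: "z \<in> e" for z
  proof (rule off_cuts)
    show "z \<in> frontier H" using fr z by blast
    have *: "pat H z \<in> {(False,True,False,False), (False,False,True,False), (False,True,True,False)}"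
      using up_edge_points[OF H a(1) z[unfolded a(2)]] a(3,4) q by (metis (full_types) insertCI)
    then show "pat H z \<noteq> (True,True,False,True)" "\<not> (quad H z (-1) \<and> quad H z (-\<i>))" by (auto simp: pat_def)
  qed
  then show ?thesis by blast
qed

lemma leftmost_edge_in_piece:
  assumes S: "S \<in> P" and e: "leftmost_edge H e" "e \<subseteq> S"
  shows "leftmost_edge S e"
proof -
  obtain a l where a: "dir_edge H a \<i> l" "e = closed_segment a (a + of_real l * \<i>)"
    "pat H a = (True, False, False, False)" "pat H (a + of_real l * \<i>) = (False, False, False, True)"
    using e(1) unfolding leftmost_edge_iff[OF H] by (elim exE conjE)
  note E = edge_off_cuts_in_piece[OF S a(1) leftmost_edge_off_cuts[OF e(1), unfolded a(2)] e(2)[unfolded a(2)]]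
  show ?thesis
    unfolding leftmost_edge_iff[OF piece(1)[OF S]]
    by (intro exI[of _ a] exI[of _ l] conjI E(1) a(2)) (use E(2,3) a(3,4) in simp_all)
qed

lemma first_above_eq:
  assumes i: "i \<in> I" shows "first_above H (Q i) = top i"
  unfolding first_above_def
proof (rule the_equality)
  have im: "Im (top i) = Im (Q i) + h i" "Re (top i) = Re (Q i)" by (simp_all add: top_def)
  have min: "Im (top i) \<le> Im p'" if p': "p' \<in> frontier H" "Re p' = Re (Q i)" "Im (Q i) < Im p'" for p'
  proof (rule ccontr)
    assume "\<not> ?thesis"
    then have t: "0 < Im p' - Im (Q i)" "Im p' - Im (Q i) < h i" using im p'(3) by auto
    have "p' = Q i + of_real (Im p' - Im (Q i)) * \<i>" using p'(2) by (simp add: complex_eq_iff)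
    then have "p' \<in> interior H" using cut_interior[OF i t] by simp
    then show False using p'(1) by (simp add: frontier_def)
  qed
  show *: "top i \<in> frontier H \<and> Re (top i) = Re (Q i) \<and> Im (Q i) < Im (top i) \<and>
    (\<forall>p'\<in>frontier H. Re p' = Re (Q i) \<and> Im (Q i) < Im p' \<longrightarrow> Im (top i) \<le> Im p')"
    using min top_frontier[OF i] im hpos[OF i] by (auto simp: top_def)
  fix p assume p: "p \<in> frontier H \<and> Re p = Re (Q i) \<and> Im (Q i) < Im p \<and>
    (\<forall>p'\<in>frontier H. Re p' = Re (Q i) \<and> Im (Q i) < Im p' \<longrightarrow> Im p \<le> Im p')"
  then have "Im p \<le> Im (top i)" "Im (top i) \<le> Im p" using * min by blast+
  then show "p = top i" using p im by (simp add: complex_eq_iff)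
qed

text \<open>Some clockwise edge leaves the vertex, and by \<open>out_germ_unique\<close> only one
  direction there has the interior on its right.\<close>

lemma clockwise_dir_edge:
  assumes e: "dir_edge H a d l" "\<not> quad H a d"
  shows "clockwise_edge H a (a + of_real l * d)"
proof -
  note D = dir_edgeD[OF e(1)]
  obtain b where b: "clockwise_edge H a b"
    using clockwise_out dir_edge_endpoints_vertices(1)[OF H e(1)] by blast
  obtain d' l' where d': "dir_edge H a d' l'" "b = a + of_real l' * d'" "\<not> quad H a d'"
    by (rule clockwise_edge_orientation[OF H b])
  have "d' = d"
    by (rule out_germ_unique[OF H D(1) dir_edge_germs(3)[OF H e(1)] e(2)
        dir_edgeD(1)[OF d'(1)] dir_edge_germs(3)[OF H d'(1)] d'(3)])
  moreover have "l = l'"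
    using dir_edge_unique[OF H e(1) d'(1)[unfolded \<open>d' = d\<close>], of 0 0] D(2) dir_edgeD(2)[OF d'(1)] by simp
  ultimately show ?thesis using b d'(2) by simp
qed

lemma falling_cornerI:
  assumes p: "pat H p = (False, True, True, True)" shows "falling_corner H p"
proof -
  have g: "germ H p 1" "\<not> germ H p (-1)" "germ H p \<i>" "\<not> germ H p (-\<i>)" using p by (simp_all add: pat_germs)
  have "p \<in> vertices H" unfolding vertices_iff[OF H] using g(1,2) by (intro bexI[of _ 1]) auto
  moreover obtain l where l: "dir_edge H p 1 l" using germ_start[OF H dirs_simps(1) g(1,2)] by blast
  have "\<not> quad H p 1" using p by (simp add: pat_def)
  from clockwise_dir_edge[OF l this] have "rightward_edge H p (p + of_real l * 1)"
    using dir_edgeD(2)[OF l] by (simp add: rightward_edge_def)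
  moreover obtain m where m: "dir_edge H p \<i> m" using germ_start[OF H dirs_simps(3) g(3,4)] by blast
  have "\<not> quad H (p + of_real m * \<i>) (-\<i>)" using up_edge_quads(5)[OF H m] p by (simp add: pat_def)
  from clockwise_dir_edge[OF dir_edge_reverse[OF m] this]
  have "downward_edge H (p + of_real m * \<i>) p" using dir_edgeD(2)[OF m] by (simp add: downward_edge_def)
  ultimately show ?thesis unfolding falling_corner_def by blast
qed

text \<open>A falling corner has three interior quadrants, while a piece owns at most two at a point
  of a cut. So falling corners of a piece are falling corners of \<open>H\<close>, and uniqueness is
  inherited.\<close>

lemma piece_nice:
  assumes S: "S \<in> P" shows "nice_hole S"
proof -
  have "falling_corner H p" if f: "falling_corner S p" for p
  proof -
    have pS: "pat S p = (False,True,True,True)" using falling_corner_pat[OF piece(1)[OF S] f] .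
    then have "p \<in> frontier S" unfolding frontier_iff_pat[OF piece(1)[OF S]] by simp
    moreover have "p \<notin> \<Union>(cut ` I)" using cut_pats[OF S] pS by fastforce
    ultimately have "pat H p = (False,True,True,True)" using frontier_piece_pat[OF S] pS by simp
    then show ?thesis by (rule falling_cornerI)
  qed
  then have "\<exists>\<^sub>\<le>\<^sub>1p. falling_corner S p" using falling unfolding Uniq_def by blast
  then show ?thesis unfolding nice_hole_def BLS_hole_def
    using piece(1)[OF S] piece_no_right_notch[OF S] piece_no_top_notch[OF S] piece_no_left_notch[OF S] by blast
qed

end

lemma downward_edge_dir:
  assumes H: "hole H" and e: "downward_edge H a p"
  obtains l where "dir_edge H a (-\<i>) l" "p = a + of_real l * (-\<i>)" "\<not> quad H a (-\<i>)"
proof -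
  have ca: "clockwise_edge H a p" "Re a = Re p" "Im p < Im a" using e unfolding downward_edge_def by simp_all
  obtain d l where d: "dir_edge H a d l" "p = a + of_real l * d" "\<not> quad H a d"
    by (rule clockwise_edge_orientation[OF H ca(1)])
  have "d = -\<i>" using dir_edgeD(1,2)[OF d(1)] d(2) ca(2,3) by (auto simp: dirs_def)
  then show thesis using that d by blast
qed

section \<open>Rightmost edges of the pieces and their labelling\<close>

context BLS_cut
begin

lemma star_not_falling:
  assumes i: "i \<in> I" and p: "pat H (top i) \<noteq> (False,True,True,True)"
  shows "first_above_star H (Q i) = top i"
proof -
  have "\<not> downward_edge H a (top i)" for a
  proof
    assume "downward_edge H a (top i)"
    then obtain l where l: "dir_edge H a (-\<i>) l" "top i = a + of_real l * (-\<i>)" "\<not> quad H a (-\<i>)"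
      by (rule downward_edge_dir[OF H])
    have "quad H (top i) \<i>" "\<not> quad H (top i) 1"
      using dir_edge_quads(3,4)[OF H l(1), of l] dir_edgeD(2)[OF l(1)] l(2,3) by simp_all
    then show False using p top_pat[OF i] by (auto simp: pat_def)
  qed
  then show ?thesis unfolding first_above_star_def first_above_eq[OF i] by simp
qed

text \<open>At a falling corner NW and SW belong to the same piece, so its right side runs on
  upwards along \<open>H\<close>. In the absence of right notches this edge of \<open>H\<close> ends
  where only SW is interior, as a rightmost edge does.\<close>

lemma star_falling:
  assumes i: "i \<in> I" and p: "pat H (top i) = (False,True,True,True)"
  obtains m where "dir_edge H (top i) \<i> m" "pat H (top i + of_real m * \<i>) = (False,False,True,False)"
    "first_above_star H (Q i) = top i + of_real m * \<i>"
proof -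
  have "germ H (top i) \<i>" "\<not> germ H (top i) (-\<i>)" using p by (simp_all add: pat_germs)
  then obtain m where m: "dir_edge H (top i) \<i> m" using germ_start[OF H dirs_simps(3)] by blast
  define b where "b = top i + of_real m * \<i>"
  note U = up_edge_quads[OF H m, folded b_def]
  have q: "quad H (top i) \<i>" using p by (simp add: pat_def)
  have "pat H b \<noteq> (True,True,True,False)"
  proof
    assume "pat H b = (True,True,True,False)"
    then have "right_notch H (closed_segment (top i) (top i + of_real m * \<i>))"
      unfolding right_notch_iff[OF H] using m p by (intro exI[of _ "top i"] exI[of _ m]) (simp add: b_def)
    then show False using no_right by blast
  qed
  then have pb: "pat H b = (False,False,True,False)" using U(3-5) q by (auto simp: pat_def)
  have "\<not> quad H b (-\<i>)" using U(5) q by simp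
  from clockwise_dir_edge[OF dir_edge_reverse[OF m, folded b_def] this]
  have down: "downward_edge H b (top i)"
    using dir_edgeD(2)[OF m] by (simp add: downward_edge_def b_def)
  have "a = b" if a: "downward_edge H a (top i)" for a
  proof -
    obtain l where l: "dir_edge H a (-\<i>) l" "top i = a + of_real l * (-\<i>)" "\<not> quad H a (-\<i>)"
      by (rule downward_edge_dir[OF H a])
    have "dir_edge H (top i) \<i> l" using dir_edge_reverse[OF l(1)] l(2) by simp
    then have "l = m"
      using dir_edge_unique[OF H _ m, of "top i" l 0 0] dir_edgeD(2)[OF m] dir_edgeD(2)[OF l(1)] by simp
    then show ?thesis using l(2) by (simp add: b_def)
  qed
  then have "(THE a. downward_edge H a (top i)) = b" using down by (rule the_equality[rotated])
  then have "first_above_star H (Q i) = b"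
    unfolding first_above_star_def first_above_eq[OF i] using down by auto
  then show thesis using that[OF m] pb by (simp add: b_def)
qed

text \<open>An edge meeting a cut starts at \<open>Q i\<close>. Its upper end follows by comparing
  patterns of the piece and of \<open>H\<close>: it is \<open>top i\<close>, or, at a falling
  corner, the upper end of the edge of \<open>H\<close> rising from \<open>top i\<close>.\<close>

lemma piece_rightmost_edge:
  assumes S: "S \<in> P" and e: "rightmost_edge S e"
  shows "rightmost_edge H e \<and> e \<subseteq> S \<or>
    (\<exists>i\<in>I. quad S (Q i) \<i> \<and> e = closed_segment (first_above_star H (Q i)) (Q i))"
proof -
  note hS = piece(1)[OF S]
  obtain a l where a: "dir_edge S a \<i> l" "e = closed_segment a (a + of_real l * \<i>)"
    "pat S a = (False, True, False, False)" "pat S (a + of_real l * \<i>) = (False, False, True, False)"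
    using e unfolding rightmost_edge_iff[OF hS] by (elim exE conjE)
  note D = dir_edgeD[OF a(1)] and Ua = up_edge_quads[OF hS a(1)]
  have q: "quad S a \<i>" using a(3) by (simp add: pat_def)
  show ?thesis
  proof (cases "closed_segment a (a + of_real l * \<i>) \<inter> \<Union>(cut ` I) = {}")
    case True
    note E = edge_off_cuts_of_piece[OF S a(1) True]
    have "rightmost_edge H e"
      unfolding rightmost_edge_iff[OF H]
      by (intro exI[of _ a] exI[of _ l] conjI E(1) a(2)) (use E(2) a(3,4) in simp_all)
    moreover have "e \<in> edges S" using e unfolding rightmost_edge_def by (elim conjE)
    then have "e \<subseteq> S" using edges_subset_frontier hole_facts(5)[OF hS] by blast
    ultimately show ?thesis by blast
  next
    case False
    then obtain i x where i: "i \<in> I" "x \<in> cut i" "x \<in> closed_segment a (a + of_real l * \<i>)" by blast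
    have aQ: "a = Q i" using left_edge_cut(1)[OF S a(1) q i] .
    have "\<not> l < h i"
    proof
      assume "l < h i"
      then show False using pat_on_cut[OF S i(1), of l] D(2) a(4) aQ by auto
    qed
    then have hl: "h i \<le> l" by simp
    have top_eq: "top i = a + of_real (h i) * \<i>" by (simp add: top_def aQ)
    have lt: "pat S (top i) = (False,True,True,False)" if "h i < l"
      unfolding top_eq using Ua(6)[of "h i"] hpos[OF i(1)] that q by simp
    have "a + of_real l * \<i> = first_above_star H (Q i)"
    proof (cases "pat H (top i) = (False,True,True,True)")
      case False
      then have "\<not> h i < l" using lt pat_at_top[OF S i(1)] top_pat[OF i(1)] by auto
      then have "h i = l" using hl by simp
      then show ?thesis using star_not_falling[OF i(1) False] top_eq by simp
    next
      case True
      obtain m where m: "dir_edge H (top i) \<i> m" "pat H (top i + of_real m * \<i>) = (False,False,True,False)"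
        "first_above_star H (Q i) = top i + of_real m * \<i>" by (rule star_falling[OF i(1) True])
      note Um = up_edge_quads[OF H m(1)] and Dm = dir_edgeD[OF m(1)]
      have qt: "quad H (top i) \<i>" using True by (simp add: pat_def)
      have "h i \<noteq> l" using pat_at_top(2)[OF S i(1) True] a(4) top_eq by auto
      then have hl': "h i < l" using hl by simp
      define b where "b = a + of_real l * \<i>"
      define c where "c = top i + of_real m * \<i>"
      have b_eq: "b = top i + of_real (l - h i) * \<i>" by (simp add: b_def top_eq algebra_simps)
      have c_eq: "c = a + of_real (h i + m) * \<i>" by (simp add: c_def top_eq algebra_simps)
      have "\<not> l < h i + m"
      proof
        assume "l < h i + m"
        then have pb: "pat H b = (False,True,True,False)"
          unfolding b_eq using Um(6)[of "l - h i"] hl' qt by simp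
        then have "b \<in> frontier H" unfolding frontier_iff_pat[OF H] by simp
        then have "b \<notin> \<Union>(cut ` I)" by (rule off_cuts) (use pb in \<open>auto simp: pat_def\<close>)
        moreover have "b \<in> frontier S" unfolding frontier_iff_pat[OF hS] using a(4) by (simp add: b_def)
        ultimately show False using frontier_piece_pat[OF S] pb a(4) by (simp add: b_def)
      qed
      moreover have "\<not> h i + m < l"
      proof
        assume "h i + m < l"
        then have pc: "pat S c = (False,True,True,False)"
          unfolding c_eq using Ua(6)[of "h i + m"] hpos[OF i(1)] Dm(2) q by simp
        have "c \<in> frontier H" unfolding frontier_iff_pat[OF H] using m(2) by (simp add: c_def)
        then have "c \<notin> \<Union>(cut ` I)" by (rule off_cuts) (use m(2) in \<open>auto simp: pat_def c_def\<close>)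
        moreover have "c \<in> frontier S" unfolding frontier_iff_pat[OF hS] using pc by simp
        ultimately show False using frontier_piece_pat[OF S] pc m(2) by (simp add: c_def)
      qed
      ultimately have "l = h i + m" by simp
      then show ?thesis using c_eq m(3) by (simp add: c_def)
    qed
    then have "e = closed_segment (first_above_star H (Q i)) (Q i)"
      unfolding a(2) aQ by (metis closed_segment_commute)
    then show ?thesis using i(1) q aQ by blast
  qed
qed

text \<open>\<open>T i\<close> is the piece that owns the NW quadrant at \<open>Q i\<close>, and
  \<open>T 1\<close> the one that contains \<open>R(H)\<close>. The labels reach every piece and are
  as many as the pieces; the resulting injectivity also shows that no piece has two rightmost
  edges.\<close>

lemma labelling:
  assumes one: "1 \<notin> I"
  obtains T where "bij_betw T (insert 1 I) P" "\<forall>i\<in>I. quad (T i) (Q i) \<i>" "rightmost_edge H (rightmost H)"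
    "rightmost H \<subseteq> T 1" "rightmost (T 1) = rightmost H"
    "\<forall>i\<in>I. rightmost (T i) = closed_segment (first_above_star H (Q i)) (Q i)"
proof -
  have R: "rightmost_edge H (rightmost H)" unfolding rightmost_def by (rule theI'[OF rightmost_unique])
  have Rall: "e = rightmost H" if "rightmost_edge H e" for e using R that rightmost_unique by blast
  have Redge: "rightmost H \<in> edges H" using R unfolding rightmost_def rightmost_edge_def by blast
  then obtain u v where uv: "rightmost H = closed_segment u v" unfolding edges_def by (elim CollectE conjE exE)
  have uR: "u \<in> rightmost H" unfolding uv by simp
  have con: "connected (rightmost H)" unfolding uv by simp
  note Rfr = edges_subset_frontier[OF Redge] and Roff = rightmost_edge_off_cuts[OF R]
  obtain S1 where S1: "S1 \<in> P" "rightmost H \<subseteq> S1" by (rule connected_in_some_piece[OF con Rfr Roff uR])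
  have S1u: "S = S1" if "S \<in> P" "rightmost H \<subseteq> S" for S
    by (rule unique_piece[OF that(1) S1(1), of u]) (use that(2) S1(2) uR Rfr Roff in auto)
  have "\<exists>S. S \<in> P \<and> quad S (Q i) \<i>" if "i \<in> I" for i
    using quad_piece_exists[OF dirs_simps(3), of "Q i"] Qpat[OF that] unfolding pat_def by blast
  then obtain T0 where T0: "\<And>i. i \<in> I \<Longrightarrow> T0 i \<in> P \<and> quad (T0 i) (Q i) \<i>" by metis
  define T where "T i = (if i = 1 then S1 else T0 i)" for i
  have T1: "T 1 = S1" by (simp add: T_def)
  have TI: "T i \<in> P" "quad (T i) (Q i) \<i>" if "i \<in> I" for i
    using T0[OF that] one that by (auto simp: T_def)
  have cases: "(e = rightmost H \<and> S = T 1) \<or> (\<exists>i\<in>I. S = T i \<and> e = closed_segment (first_above_star H (Q i)) (Q i))"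
    if S: "S \<in> P" and e: "rightmost_edge S e" for S e
    using piece_rightmost_edge[OF S e]
  proof
    assume "rightmost_edge H e \<and> e \<subseteq> S"
    then show ?thesis using Rall S1u[OF S] T1 by blast
  next
    assume "\<exists>i\<in>I. quad S (Q i) \<i> \<and> e = closed_segment (first_above_star H (Q i)) (Q i)"
    then obtain i where i: "i \<in> I" "quad S (Q i) \<i>" "e = closed_segment (first_above_star H (Q i)) (Q i)" by blast
    have "S = T i" by (rule quad_piece_unique[OF S TI(1)[OF i(1)] i(2) TI(2)[OF i(1)]])
    then show ?thesis using i by blast
  qed
  have "S \<in> T ` insert 1 I" if S: "S \<in> P" for S
  proof -
    obtain e where "rightmost_edge S e" by (rule hole_has_rightmost_edge[OF piece(1)[OF S]])
    then show ?thesis using cases[OF S] by blast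
  qed
  then have img: "T ` insert 1 I = P" using TI(1) S1(1) T1 by blast
  have "card (T ` insert 1 I) = card (insert 1 I)" using img card_P(2) one finI by simp
  then have inj: "inj_on T (insert 1 I)" using finI by (intro eq_card_imp_inj_on) auto
  \<comment> \<open>\<open>rightmost\<close> is a definite description, so uniqueness within the
    piece must be supplied along with existence.\<close>
  have rm: "rightmost S = e" if S: "S \<in> P" and all: "\<And>e'. rightmost_edge S e' \<Longrightarrow> e' = e" for S e
  proof -
    obtain e' where e': "rightmost_edge S e'" by (rule hole_has_rightmost_edge[OF piece(1)[OF S]])
    have "e' = e" using all[OF e'] .
    then show ?thesis unfolding rightmost_def using e' all by (intro the_equality) auto
  qed
  have ne: "T 1 \<noteq> T i" if "i \<in> I" for i using inj that one by (auto simp: inj_on_def)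
  show thesis
  proof (rule that[of T])
    show "bij_betw T (insert 1 I) P" unfolding bij_betw_def using inj img by blast
    show "\<forall>i\<in>I. quad (T i) (Q i) \<i>" using TI by blast
    show "rightmost_edge H (rightmost H)" by (rule R)
    show "rightmost H \<subseteq> T 1" using S1 T1 by simp
    show "rightmost (T 1) = rightmost H"
    proof (rule rm)
      show "T 1 \<in> P" using S1 T1 by simp
      then show "e' = rightmost H" if "rightmost_edge (T 1) e'" for e' using cases[OF _ that] ne by blast
    qed
    show "\<forall>i\<in>I. rightmost (T i) = closed_segment (first_above_star H (Q i)) (Q i)"
    proof
      fix i assume i: "i \<in> I"
      show "rightmost (T i) = closed_segment (first_above_star H (Q i)) (Q i)"
      proof (rule rm[OF TI(1)[OF i]])
        fix e' assume e': "rightmost_edge (T i) e'"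
        have "T i = T 1 \<or> (\<exists>j\<in>I. T i = T j \<and> e' = closed_segment (first_above_star H (Q j)) (Q j))"
          using cases[OF TI(1)[OF i] e'] by blast
        then obtain j where j: "j \<in> I" "T i = T j" "e' = closed_segment (first_above_star H (Q j)) (Q j)"
          using ne[OF i] by metis
        have "i = j" using inj_onD[OF inj j(2)] i j(1) by simp
        then show "e' = closed_segment (first_above_star H (Q i)) (Q i)" using j(3) by simp
      qed
    qed
  qed
qed

section \<open>Counting the vertices of the pieces\<close>

lemma Q_vertex: "i \<in> I \<Longrightarrow> Q i \<in> vertices H"
  unfolding vertices_iff[OF H] using Qpat by (intro bexI[of _ "-1"]) (simp_all add: pat_germs)

text \<open>Between the ends of a cut the boundary of a piece runs straight, so the upper ends of
  the cuts are the only possible new vertices.\<close>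

lemma piece_vertices:
  assumes S: "S \<in> P" and p: "p \<in> vertices S"
  shows "p \<in> vertices H \<union> top ` I" "\<exists>d\<in>dirs. quad S p d"
proof -
  note hS = piece(1)[OF S]
  obtain d where d: "d \<in> dirs" "germ S p d" "\<not> germ S p (-d)" using p unfolding vertices_iff[OF hS] by blast
  have fr: "p \<in> frontier S" by (rule germ_imp_frontier[OF hS d(1,2)])
  show "\<exists>d\<in>dirs. quad S p d"
  proof (cases "quad S p d")
    case False
    then have "quad S p (-(\<i> * d))" using d(2) unfolding germ_def by simp
    then show ?thesis using d(1) dirs_rotate(3) by blast
  qed (use d in blast)
  show "p \<in> vertices H \<union> top ` I"
  proof (cases "p \<in> \<Union>(cut ` I)")
    case False
    then have eq: "pat S p = pat H p" by (rule frontier_piece_pat[OF S fr])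
    have "germ H p c = germ S p c" if "c \<in> dirs" for c
      using that by (cases rule: dirs_cases) (simp_all only: pat_germs eq)
    then have "germ H p d" "\<not> germ H p (-d)" using d by simp_all
    then show ?thesis unfolding Un_iff vertices_iff[OF H] using d(1) by blast
  next
    case True
    then obtain i where i: "i \<in> I" "p \<in> cut i" by blast
    show ?thesis using i
    proof (cases rule: cut_point_cases)
      case 1 then show ?thesis using Q_vertex[OF i(1)] by simp
    next
      case 2 then show ?thesis using i(1) by simp
    next
      case (3 t)
      have "pat S p \<in> {(True,False,False,True), (False,True,True,False)}"
        using pat_on_cut[OF S i(1) 3(1,2)] 3(3) fr frontier_iff_pat[OF hS, of p] by auto
      then have False using d by (cases rule: dirs_cases[OF d(1)]) (auto simp: pat_germs)
      then show ?thesis ..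
    qed
  qed
qed

text \<open>Double counting of incidences. Pieces with a common vertex \<open>p\<close> own
  different quadrants at \<open>p\<close>, so there are at most 4 of them; the possible vertices
  number at most \<open>2 * nv H\<close>, since there are no more cuts than vertices
  \<open>Q i\<close>. Hence 8.\<close>

lemma sum_nv_pieces:
  assumes fin: "finite (vertices H)"
  shows "(\<Sum>S\<in>P. nv S) \<le> 8 * nv H"
proof -
  define V where "V = vertices H \<union> top ` I"
  have finV: "finite V" unfolding V_def using fin finI by simp
  have sub: "vertices S \<subseteq> V" if "S \<in> P" for S using piece_vertices(1)[OF that] unfolding V_def by blast
  have few: "card {S\<in>P. p \<in> vertices S} \<le> 4" for p
  proof -
    define f where "f S = (SOME d. d \<in> dirs \<and> quad S p d)" for S
    have f: "f S \<in> dirs \<and> quad S p (f S)" if "S \<in> {S\<in>P. p \<in> vertices S}" for S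
      unfolding f_def by (rule someI_ex) (use piece_vertices(2) that in blast)
    have "inj_on f {S\<in>P. p \<in> vertices S}"
    proof (rule inj_onI)
      fix S S' assume SS: "S \<in> {S\<in>P. p \<in> vertices S}" "S' \<in> {S\<in>P. p \<in> vertices S}" "f S = f S'"
      show "S = S'" by (rule quad_piece_unique[of _ _ p "f S"]) (use SS f[OF SS(1)] f[OF SS(2)] in auto)
    qed
    moreover have "f ` {S\<in>P. p \<in> vertices S} \<subseteq> dirs" using f by blast
    moreover have "finite dirs" by (simp add: dirs_def)
    ultimately have "card {S\<in>P. p \<in> vertices S} \<le> card dirs" by (rule card_inj_on_le)
    also have "card dirs \<le> 4" unfolding dirs_def
      using card_insert_le_m1[of 4 "{-1, \<i>, -\<i>}" 1] card_insert_le_m1[of 3 "{\<i>, -\<i>}" "-1::complex"]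
        card_insert_le_m1[of 2 "{-\<i>}" \<i>] by simp
    finally show ?thesis .
  qed
  have "(\<Sum>S\<in>P. nv S) = (\<Sum>S\<in>P. \<Sum>p\<in>V. if p \<in> vertices S then 1 else 0)"
  proof (rule sum.cong[OF refl])
    fix S assume S: "S \<in> P"
    have "V \<inter> vertices S = vertices S" using sub[OF S] by blast
    then show "nv S = (\<Sum>p\<in>V. if p \<in> vertices S then 1 else 0)"
      unfolding nv_def using finV by (simp add: sum.If_cases Int_def)
  qed
  also have "\<dots> = (\<Sum>p\<in>V. \<Sum>S\<in>P. if p \<in> vertices S then 1 else 0)" by (rule sum.swap)
  also have "\<dots> = (\<Sum>p\<in>V. card {S\<in>P. p \<in> vertices S})"
    using card_P(1) by (intro sum.cong refl) (simp add: sum.If_cases Int_def)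
  also have "\<dots> \<le> (\<Sum>p\<in>V. 4)" by (intro sum_mono few)
  also have "\<dots> = 4 * card V" by simp
  also have "card V \<le> card (vertices H) + card (top ` I)" unfolding V_def by (rule card_Un_le)
  also have "card (top ` I) \<le> card I" using finI by (rule card_image_le)
  also have "card I \<le> card (vertices H)" using injQ Q_vertex fin by (intro card_inj_on_le) auto
  finally show ?thesis by (simp add: nv_def)
qed

end

section \<open>The clockwise list of edges\<close>

text \<open>Decides the types of a given edge, where the earlier characterisations produce an
  unknown one.\<close>

lemma up_edge_kind:
  assumes H: "hole H" and e: "dir_edge H a \<i> l"
  shows "leftmost_edge H (closed_segment a (a + of_real l * \<i>)) \<longleftrightarrow>
      pat H a = (True,False,False,False) \<and> pat H (a + of_real l * \<i>) = (False,False,False,True)"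
    "left_notch H (closed_segment a (a + of_real l * \<i>)) \<longleftrightarrow>
      pat H a = (True,False,True,True) \<and> pat H (a + of_real l * \<i>) = (True,True,False,True)"
    "rightmost_edge H (closed_segment a (a + of_real l * \<i>)) \<longleftrightarrow>
      pat H a = (False,True,False,False) \<and> pat H (a + of_real l * \<i>) = (False,False,True,False)"
    "right_notch H (closed_segment a (a + of_real l * \<i>)) \<longleftrightarrow>
      pat H a = (False,True,True,True) \<and> pat H (a + of_real l * \<i>) = (True,True,True,False)"
  unfolding leftmost_edge_def left_notch_def rightmost_edge_def right_notch_def up_edge_types[OF H e]
  using dir_edge_in_edges[OF H e] vertical_segment[of a l] up_edge_quads(1-5)[OF H e]
  by (simp_all add: pat_def) (blast | argo)+

lemma upper_vertex_up_edge:
  assumes "l > 0" shows "upper_vertex (closed_segment a (a + of_real l * \<i>)) = a + of_real l * \<i>"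
  unfolding upper_vertex_def
proof (rule the_equality)
  have seg: "z \<in> closed_segment a (a + of_real l * \<i>) \<longleftrightarrow> (\<exists>t. 0 \<le> t \<and> t \<le> l \<and> z = a + of_real t * \<i>)" for z
    using in_ray_segment[OF dirs_simps(3) less_imp_le[OF assms]] .
  show top: "a + of_real l * \<i> \<in> closed_segment a (a + of_real l * \<i>) \<and>
    (\<forall>q\<in>closed_segment a (a + of_real l * \<i>). Im q \<le> Im (a + of_real l * \<i>))"
  proof (intro conjI ballI)
    fix q assume "q \<in> closed_segment a (a + of_real l * \<i>)"
    then obtain t where "0 \<le> t" "t \<le> l" "q = a + of_real t * \<i>" unfolding seg by (elim exE conjE)
    then show "Im q \<le> Im (a + of_real l * \<i>)" by simp
  qed simp
  fix p assume p: "p \<in> closed_segment a (a + of_real l * \<i>) \<and>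
    (\<forall>q\<in>closed_segment a (a + of_real l * \<i>). Im q \<le> Im p)"
  then obtain t where t: "0 \<le> t" "t \<le> l" "p = a + of_real t * \<i>" unfolding seg by blast
  have "Im (a + of_real l * \<i>) \<le> Im p" using p top by blast
  then have "t = l" using t by simp
  then show "p = a + of_real l * \<i>" using t(3) by simp
qed

lemma filter_eq_append_split:
  "filter R xs = ys @ zs \<Longrightarrow> \<exists>us vs. xs = us @ vs \<and> ys = filter R us \<and> zs = filter R vs"
proof (induction xs arbitrary: ys)
  case Nil
  then show ?case by simp
next
  case (Cons a xs)
  show ?case
  proof (cases "ys = []")
    case True
    then show ?thesis using Cons.prems by (intro exI[of _ "[]"] exI[of _ "a # xs"]) simp
  next
    case False
    define ys' where "ys' = (if R a then tl ys else ys)"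
    have "filter R xs = ys' @ zs" using Cons.prems False by (cases ys) (auto simp: ys'_def)
    then obtain us vs where uv: "xs = us @ vs" "ys' = filter R us" "zs = filter R vs"
      using Cons.IH by blast
    have "ys = filter R (a # us)"
      using Cons.prems False uv(2) by (cases ys) (auto simp: ys'_def split: if_splits)
    then show ?thesis using uv by (intro exI[of _ "a # us"] exI[of _ vs]) simp
  qed
qed

text \<open>Recovers the stretch of boundary between \<open>N i\<close> and \<open>L i\<close>:
  neighbours in the filtered list have nothing selected between them in the full list.\<close>

lemma filter_adjacent:
  assumes "filter R xs = ys @ [x, y] @ zs"
  obtains a b where "a < b" "b < length xs" "xs ! a = x" "xs ! b = y" "\<forall>m. a < m \<and> m < b \<longrightarrow> \<not> R (xs ! m)"
proof -
  obtain us vs where uv: "xs = us @ vs" "ys = filter R us" "[x, y] @ zs = filter R vs"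
    using filter_eq_append_split[OF assms] by (elim exE conjE) simp
  from uv(3) have "filter R vs = x # (y # zs)" by simp
  then obtain u1 v1 where 1: "vs = u1 @ x # v1" "\<forall>u\<in>set u1. \<not> R u" "y # zs = filter R v1"
    using filter_eq_ConsD[of R vs x "y # zs"] by auto
  from 1(3) obtain u2 v2 where 2: "v1 = u2 @ y # v2" "\<forall>u\<in>set u2. \<not> R u"
    using filter_eq_ConsD[of R v1 y zs] by auto
  define a where "a = length us + length u1"
  define b where "b = Suc a + length u2"
  have xs: "xs = (us @ u1) @ x # (u2 @ y # v2)" using uv(1) 1(1) 2(1) by simp
  have la: "length (us @ u1) = a" by (simp add: a_def)
  have nth: "xs ! m = (x # (u2 @ y # v2)) ! (m - a)" if "a \<le> m" for m
    unfolding xs nth_append la using that by simp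
  show thesis
  proof (rule that[of a b])
    show "a < b" by (simp add: b_def)
    show "b < length xs" unfolding xs by (simp add: b_def a_def)
    show "xs ! a = x" using nth[of a] by simp
    show "xs ! b = y" using nth[of b] by (simp add: b_def nth_append)
    show "\<forall>m. a < m \<and> m < b \<longrightarrow> \<not> R (xs ! m)"
    proof (intro allI impI)
      fix m assume m: "a < m \<and> m < b"
      then have "xs ! m = u2 ! (m - Suc a)" "m - Suc a < length u2"
        using nth[of m] by (auto simp: b_def nth_append nth_Cons')
      then show "\<not> R (xs ! m)" using 2(2) nth_mem by metis
    qed
  qed
qed

lemma filter_first:
  assumes "filter R xs = x # zs"
  obtains a where "a < length xs" "xs ! a = x" "\<forall>m<a. \<not> R (xs ! m)"
proof -
  obtain u v where uv: "xs = u @ x # v" "\<forall>y\<in>set u. \<not> R y"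
    using filter_eq_ConsD[OF assms] by auto
  show thesis
    by (rule that[of "length u"]) (use uv in \<open>auto simp: nth_append\<close>)
qed

section \<open>The boundary as a periodic closed walk\<close>

locale clockwise_hole =
  fixes H :: "complex set" and vs :: "complex list"
  assumes holeH: "hole H" and clockwise: "clockwise_vertices H vs" and vs_ne: "vs \<noteq> []"
begin

text \<open>With indices modulo the length, stretches of boundary that pass the end of the list need
  no separate treatment.\<close>

definition v :: "nat \<Rightarrow> complex" where "v i = vs ! (i mod length vs)"

definition E :: "nat \<Rightarrow> complex set" where "E i = closed_segment (v i) (v (Suc i))"

text \<open>Direction and length of the edge leaving \<open>v i\<close>, chosen together. The choice
  depends on \<open>v i\<close> and \<open>v (Suc i)\<close> only, so it is periodic too.\<close>

definition dl :: "nat \<Rightarrow> complex \<times> real" where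
  "dl i = (SOME x. dir_edge H (v i) (fst x) (snd x) \<and> v (Suc i) = v i + of_real (snd x) * fst x \<and>
     \<not> quad H (v i) (fst x))"

definition dir :: "nat \<Rightarrow> complex" where "dir i = fst (dl i)"

definition len :: "nat \<Rightarrow> real" where "len i = snd (dl i)"

lemma v_periodic: "v (i + length vs) = v i"
  by (simp add: v_def)

lemma dl_periodic: "dl (i + length vs) = dl i"
  using v_periodic[of i] v_periodic[of "Suc i"] by (simp add: dl_def)

lemma E_periodic: "E (i + length vs) = E i"
  using v_periodic[of i] v_periodic[of "Suc i"] by (simp add: E_def)

lemma dir_periodic: "dir (i + length vs) = dir i"
  by (simp add: dir_def dl_periodic)

lemma clockwise_step: "clockwise_edge H (v i) (v (Suc i))"
proof -
  have "i mod length vs < length vs" using vs_ne by simp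
  then have "clockwise_edge H (vs ! (i mod length vs)) (vs ! (Suc (i mod length vs) mod length vs))"
    using clockwise unfolding clockwise_vertices_def by blast
  then show ?thesis unfolding v_def by (simp add: mod_Suc_eq)
qed

lemma step: "dir_edge H (v i) (dir i) (len i)" "v (Suc i) = v i + of_real (len i) * dir i"
  "\<not> quad H (v i) (dir i)"
proof -
  obtain d l where "dir_edge H (v i) d l" "v (Suc i) = v i + of_real l * d" "\<not> quad H (v i) d"
    by (rule clockwise_edge_orientation[OF holeH clockwise_step])
  then have "\<exists>x. dir_edge H (v i) (fst x) (snd x) \<and> v (Suc i) = v i + of_real (snd x) * fst x \<and>
     \<not> quad H (v i) (fst x)" by (intro exI[of _ "(d, l)"]) simp
  from someI_ex[OF this] show "dir_edge H (v i) (dir i) (len i)" "v (Suc i) = v i + of_real (len i) * dir i"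
    "\<not> quad H (v i) (dir i)" unfolding dir_def len_def dl_def by simp_all
qed

lemma dir_dirs: "dir i \<in> dirs" and len_pos: "len i > 0"
  using dir_edgeD(1,2)[OF step(1)] by auto

lemma E_eq: "E i = closed_segment (v i) (v i + of_real (len i) * dir i)"
  unfolding E_def step(2) ..

text \<open>The quadrants at a vertex as seen from the incoming and from the outgoing edge; the two
  directions together fix the pattern.\<close>

lemma corner:
  "\<not> quad H (v (Suc i)) (\<i> * dir i)" "quad H (v (Suc i)) (-dir i)"
  "quad H (v (Suc i)) (dir i) = quad H (v (Suc i)) (-(\<i> * dir i))"
  "\<not> quad H (v (Suc i)) (dir (Suc i))" "quad H (v (Suc i)) (-(\<i> * dir (Suc i)))"
  "quad H (v (Suc i)) (-dir (Suc i)) = quad H (v (Suc i)) (\<i> * dir (Suc i))"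
proof -
  note Q = dir_edge_quads[OF holeH step(1)[of i], folded step(2)]
  note Q' = dir_edge_quads[OF holeH step(1)[of "Suc i"]]
  show "\<not> quad H (v (Suc i)) (\<i> * dir i)" "quad H (v (Suc i)) (-dir i)"
    using dir_edge_quads(3,4)[OF holeH step(1)[of i], of "len i", folded step(2)] len_pos[of i] step(3)[of i] by auto
  show "quad H (v (Suc i)) (dir i) = quad H (v (Suc i)) (-(\<i> * dir i))" by (rule Q(5))
  show "\<not> quad H (v (Suc i)) (dir (Suc i))" by (rule step(3))
  then show "quad H (v (Suc i)) (-(\<i> * dir (Suc i)))"
    using dir_edge_germs(3)[OF holeH step(1)[of "Suc i"]] unfolding germ_def by simp
  show "quad H (v (Suc i)) (-dir (Suc i)) = quad H (v (Suc i)) (\<i> * dir (Suc i))" by (rule Q'(6))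
qed

lemma turn: "dir (Suc i) = \<i> * dir i \<or> dir (Suc i) = -(\<i> * dir i)"
proof -
  have "dir (Suc i) \<noteq> -dir i" using corner(2,4)[of i] by auto
  moreover have "dir (Suc i) \<noteq> dir i"
  proof
    assume eq: "dir (Suc i) = dir i"
    show False using corner(3,4,5)[of i] unfolding eq by simp
  qed
  ultimately show ?thesis using dir_dirs[of i] dir_dirs[of "Suc i"] by (auto simp: dirs_def)
qed

lemma dir_cases: "dir i = 1 \<or> dir i = -1 \<or> dir i = \<i> \<or> dir i = -\<i>"
  using dir_dirs[of i] by (auto simp: dirs_def)

lemma E_frontier: "E i \<subseteq> frontier H"
  unfolding E_eq by (rule edges_subset_frontier[OF dir_edge_in_edges[OF holeH step(1)]])

lemma v_frontier: "v i \<in> frontier H"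
  using E_frontier[of i] by (auto simp: E_def)

text \<open>With the interior on the right, the type of an upward edge depends only on the
  horizontal directions before and after it.\<close>

lemma up_kinds:
  assumes up: "dir (Suc i) = \<i>"
  shows "leftmost_edge H (E (Suc i)) \<longleftrightarrow> dir i = -1 \<and> dir (Suc (Suc i)) = 1"
    "left_notch H (E (Suc i)) \<longleftrightarrow> dir i = 1 \<and> dir (Suc (Suc i)) = -1"
    "\<not> rightmost_edge H (E (Suc i))" "\<not> right_notch H (E (Suc i))"
    "dir i = 1 \<or> dir i = -1" "dir (Suc (Suc i)) = 1 \<or> dir (Suc (Suc i)) = -1"
proof -
  note K = up_edge_kind[OF holeH step(1)[of "Suc i", unfolded up], folded E_eq[of "Suc i", unfolded up],
      folded step(2)[of "Suc i", unfolded up]]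
  show a: "dir i = 1 \<or> dir i = -1" using turn[of i] dir_cases[of i] up by (auto simp: complex_eq_iff)
  show b: "dir (Suc (Suc i)) = 1 \<or> dir (Suc (Suc i)) = -1" using turn[of "Suc i"] up by auto
  have pa: "pat H (v (Suc i)) = (if dir i = 1 then (True,False,True,True) else (True,False,False,False))"
    using corner[of i] a up by (auto simp: pat_def)
  have pb: "pat H (v (Suc (Suc i))) = (if dir (Suc (Suc i)) = 1 then (False,False,False,True) else (True,True,False,True))"
    using corner[of "Suc i"] b up by (auto simp: pat_def)
  show "leftmost_edge H (E (Suc i)) \<longleftrightarrow> dir i = -1 \<and> dir (Suc (Suc i)) = 1"
    "left_notch H (E (Suc i)) \<longleftrightarrow> dir i = 1 \<and> dir (Suc (Suc i)) = -1"
    "\<not> rightmost_edge H (E (Suc i))" "\<not> right_notch H (E (Suc i))"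
    unfolding K pa pb using a b by auto
qed

lemma down_kinds:
  assumes down: "dir (Suc i) = -\<i>"
  shows "rightmost_edge H (E (Suc i)) \<longleftrightarrow> dir i = 1 \<and> dir (Suc (Suc i)) = -1"
    "right_notch H (E (Suc i)) \<longleftrightarrow> dir i = -1 \<and> dir (Suc (Suc i)) = 1"
    "\<not> leftmost_edge H (E (Suc i))" "\<not> left_notch H (E (Suc i))"
    "dir i = 1 \<or> dir i = -1" "dir (Suc (Suc i)) = 1 \<or> dir (Suc (Suc i)) = -1"
proof -
  \<comment> \<open>Edge types are read upwards, so the downward edge is reversed to start at its
    lower end.\<close>
  define b where "b = v (Suc (Suc i))"
  have e: "dir_edge H b \<i> (len (Suc i))"
    using dir_edge_reverse[OF step(1)[of "Suc i"], folded step(2)] unfolding down b_def by simp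
  have t: "b + of_real (len (Suc i)) * \<i> = v (Suc i)" unfolding b_def step(2)[of "Suc i"] down by simp
  have Eb: "E (Suc i) = closed_segment b (b + of_real (len (Suc i)) * \<i>)"
    unfolding E_def t b_def[symmetric] by (rule closed_segment_commute)
  note K = up_edge_kind[OF holeH e, folded Eb, unfolded t]
  show a: "dir i = 1 \<or> dir i = -1" using turn[of i] dir_cases[of i] down by (auto simp: complex_eq_iff)
  show c: "dir (Suc (Suc i)) = 1 \<or> dir (Suc (Suc i)) = -1" using turn[of "Suc i"] down by auto
  have pa: "pat H (v (Suc i)) = (if dir i = 1 then (False,False,True,False) else (True,True,True,False))"
    using corner[of i] a down by (auto simp: pat_def)
  have pb: "pat H b = (if dir (Suc (Suc i)) = 1 then (False,True,True,True) else (False,True,False,False))"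
    using corner[of "Suc i"] c down by (auto simp: pat_def b_def)
  show "rightmost_edge H (E (Suc i)) \<longleftrightarrow> dir i = 1 \<and> dir (Suc (Suc i)) = -1"
    "right_notch H (E (Suc i)) \<longleftrightarrow> dir i = -1 \<and> dir (Suc (Suc i)) = 1"
    "\<not> leftmost_edge H (E (Suc i))" "\<not> left_notch H (E (Suc i))"
    unfolding K pa pb using a c by auto
qed

lemma horizontal_kinds:
  assumes h: "dir (Suc i) = 1 \<or> dir (Suc i) = -1"
  shows "\<not> leftmost_edge H (E (Suc i))" "\<not> left_notch H (E (Suc i))" "\<not> rightmost_edge H (E (Suc i))"
    "Re (dir i) = 0" "Re (dir (Suc (Suc i))) = 0"
proof -
  have "v (Suc i) \<in> E (Suc i)" "v (Suc (Suc i)) \<in> E (Suc i)" by (simp_all add: E_def)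
  moreover have "Re (v (Suc (Suc i))) \<noteq> Re (v (Suc i))"
    unfolding step(2)[of "Suc i"] using h len_pos[of "Suc i"] by auto
  ultimately have "\<not> vertical (E (Suc i))" unfolding vertical_def by metis
  then show "\<not> leftmost_edge H (E (Suc i))" "\<not> left_notch H (E (Suc i))" "\<not> rightmost_edge H (E (Suc i))"
    unfolding leftmost_edge_def left_notch_def rightmost_edge_def by simp_all
  show "Re (dir i) = 0" using turn[of i] dir_cases[of i] h by (auto simp: complex_eq_iff)
  show "Re (dir (Suc (Suc i))) = 0" using turn[of "Suc i"] h by auto
qed

text \<open>The type lemmas need a predecessor; by periodicity every index may be taken to be a
  successor.\<close>

lemma shift_index:
  obtains j where "E i = E (Suc j)" "dir i = dir (Suc j)" "dir (Suc i) = dir (Suc (Suc j))"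
proof -
  have "Suc (i + length vs - 1) = i + length vs" using vs_ne by (cases vs) auto
  then show thesis
    using that[of "i + length vs - 1"] E_periodic[of i] dir_periodic[of i] dir_periodic[of "Suc i"] by simp
qed

lemma left_notch_dirs: "left_notch H (E i) \<Longrightarrow> dir i = \<i> \<and> dir (Suc i) = -1"
  and rightmost_dirs: "rightmost_edge H (E i) \<Longrightarrow> dir i = -\<i> \<and> dir (Suc i) = -1"
  and leftmost_dirs: "leftmost_edge H (E i) \<Longrightarrow> dir i = \<i>"
proof -
  obtain j where j: "E i = E (Suc j)" "dir i = dir (Suc j)" "dir (Suc i) = dir (Suc (Suc j))"
    by (rule shift_index)
  have "left_notch H (E (Suc j)) \<longrightarrow> dir (Suc j) = \<i> \<and> dir (Suc (Suc j)) = -1"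
    using dir_cases[of "Suc j"] by (elim disjE) (simp_all add: up_kinds down_kinds horizontal_kinds)
  then show "left_notch H (E i) \<Longrightarrow> dir i = \<i> \<and> dir (Suc i) = -1" unfolding j by simp
  have "rightmost_edge H (E (Suc j)) \<longrightarrow> dir (Suc j) = -\<i> \<and> dir (Suc (Suc j)) = -1"
    using dir_cases[of "Suc j"] by (elim disjE) (simp_all add: up_kinds down_kinds horizontal_kinds)
  then show "rightmost_edge H (E i) \<Longrightarrow> dir i = -\<i> \<and> dir (Suc i) = -1" unfolding j by simp
  have "leftmost_edge H (E (Suc j)) \<longrightarrow> dir (Suc j) = \<i>"
    using dir_cases[of "Suc j"] by (elim disjE) (simp_all add: up_kinds down_kinds horizontal_kinds)
  then show "leftmost_edge H (E i) \<Longrightarrow> dir i = \<i>" unfolding j by simp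
qed

lemma edge_list_eq: "edge_list vs = map E [0..<length vs]"
proof -
  have "closed_segment (vs ! i) (vs ! (Suc i mod length vs)) = E i" if "i < length vs" for i
    using that by (simp add: E_def v_def)
  then show ?thesis unfolding edge_list_def by (intro map_cong) auto
qed

text \<open>Oriented with the interior on its right, an edge leaves some listed vertex, and only one
  such edge leaves that vertex.\<close>

lemma edge_in_list:
  assumes e: "e \<in> edges H" shows "\<exists>i<length vs. e = E i"
proof -
  obtain a0 d0 l where e0: "dir_edge H a0 d0 l" "e = closed_segment a0 (a0 + of_real l * d0)"
    using e unfolding edges_iff[OF holeH] by (elim exE conjE)
  obtain a d where a: "dir_edge H a d l" "e = closed_segment a (a + of_real l * d)" "\<not> quad H a d"
  proof (cases "quad H a0 d0")
    case False then show thesis using that e0 by blast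
  next
    case True
    define b where "b = a0 + of_real l * d0"
    have "dir_edge H b (-d0) l" using dir_edge_reverse[OF e0(1)] by (simp add: b_def)
    moreover have "b + of_real l * (-d0) = a0" by (simp add: b_def)
    then have "e = closed_segment b (b + of_real l * (-d0))"
      unfolding e0(2) b_def[symmetric] by (metis closed_segment_commute)
    moreover have "\<not> quad H b (-d0)"
      using dir_edge_quads(4)[OF holeH e0(1), of l] dir_edgeD(2)[OF e0(1)] True by (simp add: b_def)
    ultimately show thesis by (rule that)
  qed
  have "a \<in> set vs" using dir_edge_endpoints_vertices(1)[OF holeH a(1)] clockwise
    unfolding clockwise_vertices_def by simp
  then obtain i where i: "i < length vs" "a = vs ! i" by (metis in_set_conv_nth)
  have vi: "v i = a" using i by (simp add: v_def)
  have "dir i = d"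
    by (rule out_germ_unique[OF holeH dir_edgeD(1)[OF a(1)] dir_edge_germs(3)[OF holeH a(1)] a(3)
          dir_dirs dir_edge_germs(3)[OF holeH step(1)[of i], unfolded vi] step(3)[of i, unfolded vi]])
  have "len i = l"
    using dir_edge_unique[OF holeH step(1)[of i, unfolded vi \<open>dir i = d\<close>] a(1), of 0 0] len_pos[of i]
      dir_edgeD(2)[OF a(1)] by simp
  then have "e = E i" unfolding E_eq a(2) vi \<open>dir i = d\<close> by simp
  then show ?thesis using i(1) by blast
qed

lemma distinct_edges: "distinct (edge_list vs)"
proof -
  have "inj_on E {0..<length vs}"
  proof (rule inj_onI)
    fix i j assume ij: "i \<in> {0..<length vs}" "j \<in> {0..<length vs}" "E i = E j"
    have "{v i, v (Suc i)} = {v j, v (Suc j)}" using ij(3) unfolding E_def by simp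
    then consider "v i = v j" | "v i = v (Suc j)" "v (Suc i) = v j" by (auto simp: doubleton_eq_iff)
    then show "i = j"
    proof cases
      case 1
      then show ?thesis using ij(1,2) clockwise unfolding v_def clockwise_vertices_def
        by (simp add: nth_eq_iff_index_eq)
    next
      case 2
      \<comment> \<open>The same edge listed in both directions would have the interior on both of
        its sides.\<close>
      have "of_real (len i) * dir i = v j - v i" using step(2)[of i] 2(2) by simp
      also have "\<dots> = of_real (len j) * (-dir j)" using step(2)[of j] 2(1) by simp
      finally have "of_real (len i) * dir i = of_real (len j) * (-dir j)" .
      then have "dir i = -dir j"
        using len_pos[of i] len_pos[of j] dir_dirs[of i] dir_dirs[of j] by (auto simp: dirs_def complex_eq_iff)
      then show ?thesis using step(3)[of i] corner(2)[of j] 2(1) by simp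
    qed
  qed
  then show ?thesis unfolding edge_list_eq by (simp add: distinct_map)
qed

text \<open>For a canonical ordering the total weight is k - (k - 1) = 1.\<close>

definition weight :: "complex set \<Rightarrow> real" where
  "weight e = (if leftmost_edge H e then 1 else 0) - (if left_notch H e then 1 else 0)"

text \<open>From the edge before to the edge after, the horizontal component of the direction
  changes by 2 at a leftmost edge, by -2 at a left notch or a rightmost edge, and otherwise not at
  all, as there is no right notch. Around the closed walk the changes cancel, so the number of
  rightmost edges is the total weight.\<close>

lemma rightmost_edge_unique:
  assumes no_right: "\<nexists>e. right_notch H e" and w: "sum_list (map weight (edge_list vs)) = 1"
  shows "\<exists>!e. rightmost_edge H e"
proof -
  let ?n = "length vs"
  define r where "r e = (if rightmost_edge H e then 1 else 0 :: real)" for e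
  have key: "Re (dir (Suc (Suc i))) - Re (dir i) = 2 * (weight (E (Suc i)) - r (E (Suc i)))" for i
    using dir_cases[of "Suc i"]
  proof (elim disjE)
    assume "dir (Suc i) = \<i>"
    note K = up_kinds[OF this]
    show ?thesis using K(5,6) K(1-3) by (elim disjE) (simp_all add: weight_def r_def)
  next
    assume "dir (Suc i) = -\<i>"
    note K = down_kinds[OF this]
    have "\<not> right_notch H (E (Suc i))" using no_right by blast
    then show ?thesis using K(5,6) K(1-4) by (elim disjE) (simp_all add: weight_def r_def)
  qed (use horizontal_kinds[of i] in \<open>simp_all add: weight_def r_def\<close>)
  have shift: "(\<Sum>i<?n. f (Suc i)) = (\<Sum>i<?n. f i)" if "f ?n = f 0" for f :: "nat \<Rightarrow> real"
    using sum.lessThan_Suc_shift[of f ?n] sum.lessThan_Suc[of f ?n] that by simp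
  have per: "dir ?n = dir 0" "dir (Suc ?n) = dir (Suc 0)" "E ?n = E 0"
    using dir_periodic[of 0] dir_periodic[of "Suc 0"] E_periodic[of 0] by simp_all
  have "(\<Sum>i<?n. Re (dir (Suc (Suc i)))) = (\<Sum>i<?n. Re (dir i))"
    using shift[of "\<lambda>i. Re (dir (Suc i))"] shift[of "\<lambda>i. Re (dir i)"] per by simp
  then have "(\<Sum>i<?n. Re (dir (Suc (Suc i))) - Re (dir i)) = 0" by (simp add: sum_subtractf)
  then have "2 * (\<Sum>i<?n. weight (E (Suc i)) - r (E (Suc i))) = 0"
    unfolding key sum_distrib_left .
  then have "(\<Sum>i<?n. weight (E (Suc i)) - r (E (Suc i))) = 0" by simp
  moreover have "(\<Sum>i<?n. weight (E (Suc i)) - r (E (Suc i))) = (\<Sum>i<?n. weight (E i) - r (E i))"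
    using shift[of "\<lambda>i. weight (E i) - r (E i)"] per by simp
  ultimately have "(\<Sum>i<?n. r (E i)) = (\<Sum>i<?n. weight (E i))" by (simp add: sum_subtractf)
  also have "\<dots> = 1" using w unfolding edge_list_eq by (simp add: sum_list_distinct_conv_sum_set atLeast0LessThan comp_def)
  finally have one: "real (card {i. i < ?n \<and> rightmost_edge H (E i)}) = 1"
    unfolding r_def by (simp add: sum.If_cases lessThan_def Int_def)
  then obtain i where i: "{i. i < ?n \<and> rightmost_edge H (E i)} = {i}"
    by (metis card_1_singletonE of_nat_eq_1_iff)
  show ?thesis
  proof (rule ex1I[of _ "E i"])
    show "rightmost_edge H (E i)" using i by blast
    fix e assume e: "rightmost_edge H e"
    then have "e \<in> edges H" unfolding rightmost_edge_def by simp
    then obtain j where j: "j < ?n" "e = E j" using edge_in_list by blast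
    then have "j \<in> {i. i < ?n \<and> rightmost_edge H (E i)}" using e by simp
    then show "e = E i" using i j(2) by simp
  qed
qed

end

section \<open>Walking along the boundary to the next leftmost edge\<close>

locale BLS_walk = BLS_cut H Q h I + clockwise_hole H vs
  for H :: "complex set" and Q :: "nat \<Rightarrow> complex" and h :: "nat \<Rightarrow> real" and I :: "nat set" and vs :: "complex list"
begin

text \<open>After a leftward edge comes a vertical one, and then again a leftward one: going
  rightward would make the vertical edge a leftmost edge or a right notch. The second alternative
  records that a vertical edge follows a leftward one.\<close>

lemma walk_dirs:
  assumes start: "dir (Suc s) = -1" and none: "\<forall>m. s < m \<and> m < s + Suc J \<longrightarrow> \<not> leftmost_edge H (E m)"
    and j: "j \<le> J"
  shows "dir (s + Suc j) = -1 \<or>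
    (\<exists>j'. j = Suc j' \<and> dir (s + Suc j') = -1 \<and> (dir (s + Suc j) = \<i> \<or> dir (s + Suc j) = -\<i>))"
  using j
proof (induction j)
  case 0
  then show ?case using start by simp
next
  case (Suc j)
  let ?i = "s + Suc j"
  have eq: "s + Suc (Suc j) = Suc ?i" by simp
  have IH: "dir ?i = -1 \<or> (\<exists>j'. j = Suc j' \<and> dir (s + Suc j') = -1 \<and> (dir ?i = \<i> \<or> dir ?i = -\<i>))"
    using Suc by simp
  show ?case
  proof (cases "dir ?i = -1")
    case True
    then have "dir (Suc ?i) = \<i> \<or> dir (Suc ?i) = -\<i>" using turn[of ?i] by auto
    then show ?thesis unfolding eq using True by blast
  next
    case False
    then obtain j' where j': "j = Suc j'" "dir (s + Suc j') = -1" "dir ?i = \<i> \<or> dir ?i = -\<i>" using IH by blast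
    have i_eq: "?i = Suc (s + Suc j')" using j'(1) by simp
    have nl: "\<not> leftmost_edge H (E ?i)" using none Suc.prems by simp
    have nr: "\<not> right_notch H (E ?i)" using no_right by blast
    have "dir (Suc ?i) = -1"
      using j'(3)
    proof
      assume u: "dir ?i = \<i>"
      show ?thesis using up_kinds(1,6)[OF u[unfolded i_eq]] nl j'(2) unfolding i_eq by auto
    next
      assume u: "dir ?i = -\<i>"
      show ?thesis using down_kinds(2,6)[OF u[unfolded i_eq]] nr j'(2) unfolding i_eq by auto
    qed
    then show ?thesis unfolding eq by blast
  qed
qed

text \<open>A cut ends from below in a ceiling, which a clockwise traversal runs through rightwards.
  Inner points of all other edges lack two adjacent quadrants, among them SW or SE, and so cannot be
  an end of a cut.\<close>

lemma open_edge_off_cuts: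
  assumes d: "dir m \<noteq> 1" and t: "0 < t" "t < len m"
  shows "v m + of_real t * dir m \<notin> \<Union>(cut ` I)"
proof (rule off_cuts)
  let ?z = "v m + of_real t * dir m"
  note D = dir_edgeD[OF step(1)[of m]]
  show "?z \<in> frontier H" using D(3) t by simp
  have q: "\<not> quad H ?z (dir m)" "quad H ?z (-(\<i> * dir m))" "\<not> quad H ?z (\<i> * dir m)" "quad H ?z (-dir m)"
    using dir_edge_quads(1-4)[OF holeH step(1)[of m], of t] t step(3)[of m] by auto
  have "dir m = -1 \<or> dir m = \<i> \<or> dir m = -\<i>" using dir_cases[of m] d by blast
  then have "(\<not> quad H ?z (-1) \<and> \<not> quad H ?z (-\<i>)) \<or> (\<not> quad H ?z \<i> \<and> \<not> quad H ?z (-1)) \<or>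
      (\<not> quad H ?z (-\<i>) \<and> \<not> quad H ?z 1)"
    using q by (elim disjE) simp_all
  then show "pat H ?z \<noteq> (True,True,False,True)" "\<not> (quad H ?z (-1) \<and> quad H ?z (-\<i>))"
    by (auto simp: pat_def)
qed

text \<open>A \<open>top i\<close> is excluded by its interior quadrants SW and SE. A
  \<open>Q i\<close> could only be reached upwards, through its notch, at whose lower vertex SW is
  interior; but the walk reaches that vertex by a leftward edge and continues upwards, so that SW is
  outside.\<close>

lemma walk_vertex_off_cuts:
  assumes start: "dir (Suc s) = -1" and none: "\<forall>m. s < m \<and> m < s + Suc J \<longrightarrow> \<not> leftmost_edge H (E m)"
    and j: "Suc j \<le> J"
  shows "v (Suc (s + Suc j)) \<notin> \<Union>(cut ` I)"
proof
  let ?i = "s + Suc j"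
  let ?z = "v (Suc ?i)"
  assume "?z \<in> \<Union>(cut ` I)"
  then obtain i where i: "i \<in> I" "?z \<in> cut i" by blast
  have zi: "?z = Q i \<or> ?z = top i" by (rule cut_frontier[OF i v_frontier])
  have W: "dir (Suc ?i) = -1 \<or> (dir ?i = -1 \<and> (dir (Suc ?i) = \<i> \<or> dir (Suc ?i) = -\<i>))"
    using walk_dirs[OF start none j] by auto
  show False
  proof (cases "dir (Suc ?i) = -1")
    case False
    then have "dir ?i = -1" using W by blast
    then have "\<not> quad H ?z (-\<i>)" using corner(1)[of ?i] by simp
    then show False using zi Qpat[OF i(1)] top_pat[OF i(1)] by (auto simp: pat_def)
  next
    case True
    have sw: "\<not> quad H ?z (-1)" using corner(4)[of ?i] True by simp
    then have zQ: "?z = Q i" using zi top_pat[OF i(1)] by (auto simp: pat_def)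
    have vert: "dir ?i = \<i> \<or> dir ?i = -\<i>" using turn[of ?i] dir_cases[of ?i] True by (auto simp: complex_eq_iff)
    have "dir ?i \<noteq> -\<i>"
    proof
      assume "dir ?i = -\<i>"
      then have "\<not> quad H ?z 1" using corner(1)[of ?i] by simp
      then show False using zQ Qpat[OF i(1)] by (simp add: pat_def)
    qed
    then have up: "dir ?i = \<i>" using vert by blast
    have "dir ?i \<noteq> -1" unfolding up by (simp add: complex_eq_iff)
    then obtain j' where j': "j = Suc j'" "dir (s + Suc j') = -1"
      using walk_dirs[OF start none, of j] j by auto
    have i_eq: "?i = Suc (s + Suc j')" using j'(1) by simp
    have qv: "\<not> quad H (v ?i) (-1)"
      using corner(3,4)[of "s + Suc j'", folded i_eq] j'(2) up by simp
    obtain c m where c: "dir_edge H c \<i> m" "Q i = c + of_real m * \<i>" "pat H c = (True,False,True,True)"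
      using notch[OF i(1)] by blast
    have e1: "dir_edge H ?z (-\<i>) m" using dir_edge_reverse[OF c(1)] c(2) zQ by simp
    have e2: "dir_edge H ?z (-\<i>) (len ?i)" using dir_edge_reverse[OF step(1)[of ?i], folded step(2)] up by simp
    have "m = len ?i"
      using dir_edge_unique[OF holeH e1 e2, of 0 0] dir_edgeD(2)[OF e1] dir_edgeD(2)[OF e2] by simp
    then have "c = v ?i" using c(2) zQ step(2)[of ?i] up by simp
    then show False using c(3) qv by (simp add: pat_def)
  qed
qed

text \<open>The piece is carried along the walk edge by edge. The first edge is used without its
  starting point, which may be some \<open>Q i\<close> and so lie on a cut; therefore membership is
  assumed at a positive distance \<open>t0\<close>.\<close>

lemma walk_to_leftmost:
  assumes start: "dir (Suc s) = -1" and none: "\<forall>m. s < m \<and> m < s + Suc J \<longrightarrow> \<not> leftmost_edge H (E m)"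
    and left: "leftmost_edge H (E (s + Suc J))"
    and S: "S \<in> P" and t0: "0 < t0" "t0 \<le> len (Suc s)" "v (Suc s) + of_real t0 * dir (Suc s) \<in> S"
  shows "E (s + Suc J) \<subseteq> S"
proof -
  have "dir (s + Suc J) = \<i>" by (rule leftmost_dirs[OF left])
  then have "J \<noteq> 0" using start by (auto simp: complex_eq_iff intro!: Nat.gr0I)
  then obtain J' where J': "J = Suc J'" by (cases J) auto
  have "v (s + Suc (Suc j)) \<in> S" if "j \<le> J'" for j
    using that
  proof (induction j)
    case 0
    define X where "X = (\<lambda>t. v (Suc s) + of_real t * dir (Suc s)) ` {0<..len (Suc s)}"
    have "connected X" unfolding X_def
      by (intro connected_continuous_image continuous_intros) auto
    moreover have "X \<subseteq> frontier H"
      unfolding X_def using dir_edgeD(3)[OF step(1)[of "Suc s"]] by auto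
    moreover have "X \<inter> \<Union>(cut ` I) = {}"
    proof -
      have "v (Suc s) + of_real t * dir (Suc s) \<notin> \<Union>(cut ` I)" if t: "0 < t" "t \<le> len (Suc s)" for t
      proof (cases "t = len (Suc s)")
        case True
        have "Suc 0 \<le> J" using J' by simp
        from walk_vertex_off_cuts[OF start none this] show ?thesis
          unfolding True step(2)[of "Suc s", symmetric] by simp
      next
        case False
        then show ?thesis using t start by (intro open_edge_off_cuts) auto
      qed
      then show ?thesis unfolding X_def by auto
    qed
    moreover have "v (Suc s) + of_real t0 * dir (Suc s) \<in> X"
      unfolding X_def using t0(1,2) by (intro image_eqI[of _ _ t0]) auto
    then have "X \<inter> S \<noteq> {}" using t0(3) by blast
    ultimately have "X \<subseteq> S" by (intro connected_in_piece[OF S])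
    moreover have "v (Suc (Suc s)) \<in> X"
      unfolding X_def step(2)[of "Suc s"] using len_pos[of "Suc s"] by auto
    ultimately show ?case by auto
  next
    case (Suc j)
    let ?i = "s + Suc (Suc j)"
    have vi: "v ?i \<in> S" using Suc by simp
    have j1: "Suc j \<le> J" "Suc (Suc j) \<le> J" using Suc.prems J' by auto
    have "E ?i \<inter> \<Union>(cut ` I) = {}"
    proof -
      have "z \<notin> \<Union>(cut ` I)" if z: "z \<in> E ?i" for z
      proof -
        obtain t where t: "0 \<le> t" "t \<le> len ?i" "z = v ?i + of_real t * dir ?i"
          using z unfolding E_eq in_ray_segment[OF dir_dirs less_imp_le[OF len_pos]] by (elim exE conjE)
        consider "t = 0" | "t = len ?i" | "0 < t" "t < len ?i" using t by linarith
        then show ?thesis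
        proof cases
          case 1
          then show ?thesis using walk_vertex_off_cuts[OF start none j1(1)] t(3) by simp
        next
          case 2
          then show ?thesis using walk_vertex_off_cuts[OF start none j1(2)] t(3) step(2)[of ?i] by simp
        next
          case 3
          have "dir ?i \<noteq> 1"
          proof
            assume "dir ?i = 1"
            then show False using walk_dirs[OF start none j1(1)] by (auto simp: complex_eq_iff)
          qed
          then show ?thesis unfolding t(3) by (rule open_edge_off_cuts[OF _ 3])
        qed
      qed
      then show ?thesis by blast
    qed
    moreover have "connected (E ?i)" unfolding E_def by simp
    moreover have "v ?i \<in> E ?i" "v (Suc ?i) \<in> E ?i" unfolding E_def by simp_all
    ultimately have "E ?i \<subseteq> S" using connected_in_piece[OF S _ E_frontier] vi by blast
    then show ?case using \<open>v (Suc ?i) \<in> E ?i\<close> by auto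
  qed
  from this[of J'] have "v (s + Suc J) \<in> S" using J' by simp
  moreover have "v (s + Suc J) \<in> E (s + Suc J)" unfolding E_def by simp
  moreover have "connected (E (s + Suc J))" unfolding E_def by simp
  ultimately show ?thesis
    using connected_in_piece[OF S _ E_frontier leftmost_edge_off_cuts[OF left]] by blast
qed

end

text \<open>The height is the infimum of those from \<open>r/2\<close> on at which the ray is on the
  boundary. Starting at \<open>r/2\<close> keeps the boundary point \<open>p\<close> itself out of
  the closed set, which is nonempty because the interior is bounded.\<close>

lemma ray_up:
  assumes H: "hole H" and p: "pat H p = (True,True,False,True)"
  obtains h where "h > 0" "p + of_real h * \<i> \<in> frontier H" "\<forall>t. 0 < t \<and> t < h \<longrightarrow> p + of_real t * \<i> \<in> interior H"
proof -
  note F = hole_facts[OF H]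
  note R = Jordan_regions[OF F(1)]
  obtain r where r: "r > 0" "\<forall>d\<in>dirs. \<forall>s t. 0 < s \<and> s < r \<and> 0 < t \<and> t < r \<longrightarrow>
       p + of_real s * d + of_real t * (\<i> * d) \<notin> frontier H \<and>
       (p + of_real s * d + of_real t * (\<i> * d) \<in> interior H \<longleftrightarrow> quad H p d)"
    "\<forall>d\<in>dirs. \<forall>s. 0 < s \<and> s < r \<longrightarrow> (p + of_real s * d \<in> frontier H \<longleftrightarrow> germ H p d) \<and>
      (p + of_real s * d \<in> interior H \<longleftrightarrow> quad H p d \<and> quad H p (-(\<i> * d)))"
    by (rule quad_local[OF H])
  have near: "p + of_real t * \<i> \<in> interior H" if "0 < t" "t < r" for t
    using r(3)[rule_format, OF dirs_simps(3), of t] that p by (simp add: pat_def)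
  define f where "f t = p + of_real t * \<i>" for t
  have cont: "continuous_on X f" for X unfolding f_def by (intro continuous_intros)
  have inside: "f t \<in> interior H" if t: "r/2 \<le> t" "\<forall>s. r/2 \<le> s \<and> s \<le> t \<longrightarrow> f s \<notin> frontier H" for t
  proof -
    have con: "connected (f ` {r/2..t})" by (intro connected_continuous_image cont) simp
    have "f ` {r/2..t} \<inter> frontier H = {}" using t(2) by auto
    then have "f ` {r/2..t} \<subseteq> inside (frontier H) \<or> f ` {r/2..t} \<subseteq> outside (frontier H)"
      by (rule connected_side[OF F(1) con])
    moreover have "f (r/2) \<in> inside (frontier H)" using near[of "r/2"] r(1) unfolding F(3) f_def by simp
    moreover have "f (r/2) \<in> f ` {r/2..t}" "f t \<in> f ` {r/2..t}" using t(1) by auto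
    ultimately show ?thesis unfolding F(3) using R(10) by blast
  qed
  define A where "A = {r/2..} \<inter> f -` frontier H"
  have "closed A" unfolding A_def
    by (rule continuous_closed_preimage[OF cont]) simp_all
  moreover have "A \<noteq> {}"
  proof
    assume "A = {}"
    then have allin: "f t \<in> interior H" if "r/2 \<le> t" for t
      by (intro inside that) (auto simp: A_def)
    obtain B where B: "\<forall>z\<in>inside (frontier H). norm z \<le> B" using R(7) bounded_iff by metis
    define t where "t = max (r/2) (B + norm p + 1)"
    have "norm (f t) \<le> B" using allin[of t] B unfolding F(3) by (simp add: t_def)
    moreover have "norm (of_real t * \<i>) \<le> norm (f t) + norm p"
      using norm_triangle_ineq4[of "f t" p] by (simp add: f_def)
    moreover have "norm (of_real t * \<i>) = t" using r(1) by (simp add: norm_mult t_def)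
    moreover have "t \<ge> B + norm p + 1" by (simp add: t_def)
    ultimately show False by linarith
  qed
  moreover have bdd: "bdd_below A" unfolding A_def by (intro bdd_belowI[of _ "r/2"]) auto
  ultimately have hA: "Inf A \<in> A" by (intro closed_contains_Inf)
  show thesis
  proof (rule that[of "Inf A"])
    show "Inf A > 0" using hA r(1) by (auto simp: A_def)
    show "p + of_real (Inf A) * \<i> \<in> frontier H" using hA by (simp add: A_def f_def)
    show "\<forall>t. 0 < t \<and> t < Inf A \<longrightarrow> p + of_real t * \<i> \<in> interior H"
    proof (intro allI impI)
      fix t assume t: "0 < t \<and> t < Inf A"
      show "p + of_real t * \<i> \<in> interior H"
      proof (cases "t < r")
        case False
        have "f s \<notin> frontier H" if s: "r/2 \<le> s" "s \<le> t" for s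
        proof
          assume "f s \<in> frontier H"
          then have "s \<in> A" using s by (simp add: A_def)
          then show False using cInf_lower[OF _ bdd, of s] s t by simp
        qed
        then show ?thesis using inside[of t] False r(1) by (simp add: f_def)
      qed (use near t in blast)
    qed
  qed
qed

lemma sum_list_alternating:
  fixes f :: "'a \<Rightarrow> real"
  assumes "\<forall>i\<in>{2..k}. f (N i) + f (L i) = 0"
  shows "sum_list (map f (concat (map (\<lambda>i. [N i, L i]) [2..<Suc k]))) = 0"
proof -
  have "sum_list (map f (concat (map (\<lambda>i. [N i, L i]) xs))) = (\<Sum>i\<leftarrow>xs. f (N i) + f (L i))" for xs
    by (induction xs) simp_all
  moreover have "(\<Sum>i\<leftarrow>[2..<Suc k]. f (N i) + f (L i)) = (\<Sum>i\<leftarrow>[2..<Suc k]. 0)"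
    using assms by (intro arg_cong[of _ _ sum_list] map_cong) auto
  ultimately show ?thesis by simp
qed

lemma sum_list_filter_nonzero:
  fixes f :: "'a \<Rightarrow> real"
  assumes "\<forall>x. \<not> R x \<longrightarrow> f x = 0"
  shows "sum_list (map f (filter R xs)) = sum_list (map f xs)"
  using assms by (induction xs) auto

section \<open>The partition\<close>

context BLS_walk
begin

text \<open>A germ of the piece yields points of the first edge near the vertex, even if the vertex
  itself lies on a cut.\<close>

lemma walk_from_germ:
  assumes start: "dir (Suc s) = -1" and none: "\<forall>m. s < m \<and> m < s + Suc J \<longrightarrow> \<not> leftmost_edge H (E m)"
    and left: "leftmost_edge H (E (s + Suc J))" and S: "S \<in> P" and g: "germ S (v (Suc s)) (-1)"
  shows "E (s + Suc J) \<subseteq> S"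
proof -
  obtain r where r: "r > 0" "\<forall>t. 0 < t \<and> t < r \<longrightarrow> (v (Suc s) + of_real t * (-1) \<in> frontier S \<longleftrightarrow> germ S (v (Suc s)) (-1))"
    by (rule germ_ray[OF piece(1)[OF S] dirs_simps(2)])
  define t0 where "t0 = min r (len (Suc s)) / 2"
  have t0: "0 < t0" "t0 < r" "t0 \<le> len (Suc s)" using r(1) len_pos[of "Suc s"] by (auto simp: t0_def)
  have "v (Suc s) + of_real t0 * (-1) \<in> frontier S" using r(2) t0 g by blast
  then have "v (Suc s) + of_real t0 * dir (Suc s) \<in> S" unfolding start using hole_facts(5)[OF piece(1)[OF S]] by blast
  then show ?thesis by (rule walk_to_leftmost[OF start none left S t0(1,3)])
qed

lemma leftmost_edge_piece_unique:
  assumes e: "leftmost_edge H e" and S: "S \<in> P" "S' \<in> P" "e \<subseteq> S" "e \<subseteq> S'"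
  shows "S = S'"
proof -
  have ed: "e \<in> edges H" using e unfolding leftmost_edge_def by (elim conjE)
  then obtain x y where "e = closed_segment x y" unfolding edges_def by (elim CollectE conjE exE)
  then have x: "x \<in> e" by simp
  show ?thesis
    by (rule unique_piece[OF S(1,2), of x])
       (use x S edges_subset_frontier[OF ed] leftmost_edge_off_cuts[OF e] in auto)
qed

end

text \<open>The two types require opposite directions before the edge.\<close>

lemma (in clockwise_hole) leftmost_not_left_notch:
  assumes "leftmost_edge H e" shows "\<not> left_notch H e"
proof
  assume n: "left_notch H e"
  have "e \<in> edges H" using assms unfolding leftmost_edge_def by (elim conjE)
  then obtain i where "e = E i" using edge_in_list by blast
  moreover obtain j where "E i = E (Suc j)" "dir i = dir (Suc j)" "dir (Suc i) = dir (Suc (Suc j))"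
    by (rule shift_index)
  ultimately have e: "e = E (Suc j)" by simp
  have "dir (Suc j) = \<i>" using leftmost_dirs assms unfolding e by blast
  from up_kinds(1,2)[OF this] have "dir j = -1" "dir j = 1" using assms n unfolding e by blast+
  then show False by (simp add: complex_eq_iff)
qed

lemma distinct_concat_pairs:
  "distinct (concat (map (\<lambda>i. [N i, L i]) xs)) \<Longrightarrow> distinct xs \<Longrightarrow> inj_on N (set xs)"
proof (induction xs)
  case (Cons x xs)
  have "N ` set xs \<subseteq> set (concat (map (\<lambda>i. [N i, L i]) xs))" by auto
  moreover have "N x \<notin> set (concat (map (\<lambda>i. [N i, L i]) xs))" using Cons.prems(1) by auto
  moreover have "inj_on N (set xs)" using Cons by auto
  ultimately show ?case by auto
qed simp

text \<open>Beyond the labelling by rightmost edges it remains to see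
  \<open>L i \<subseteq> T i\<close>. A leftmost edge of a piece is a leftmost edge of
  \<open>H\<close> contained in it, and conversely, so the same labels then describe the leftmost
  edges.\<close>

lemma BLS_partition:
  assumes bls: "BLS_hole H" and co: "canonical_ordering H k L N"
    and Qs: "\<forall>i\<in>{2..k}. Q i = upper_vertex (N i) \<and> QN i = first_above H (Q i) \<and> QNstar i = first_above_star H (Q i)"
    and Peq: "P = pieces H ((\<lambda>i. closed_segment (Q i) (QN i)) ` {2..k})"
  shows "\<exists>S :: nat \<Rightarrow> complex set.
      bij_betw S {1..k} P \<and>
      (\<forall>j\<in>{1..k}. nice_hole (S j)) \<and>
      (\<Union>j\<in>{1..k}. S j) = H \<and>
      (\<forall>j\<in>{1..k}. \<forall>j'\<in>{1..k}. j \<noteq> j' \<longrightarrow> interior (S j) \<inter> interior (S j') = {}) \<and>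
      (\<forall>i\<in>{1..k}. \<exists>!S'. S' \<in> P \<and> L i \<subseteq> S') \<and>
      (\<forall>S'\<in>P. \<exists>!e. leftmost_edge H e \<and> e \<subseteq> S') \<and>
      (\<forall>S'\<in>P. leftmost S' \<in> L ` {1..k} \<and>
         (leftmost S' = L 1 \<longrightarrow> rightmost S' = rightmost H) \<and>
         (\<forall>i\<in>{2..k}. leftmost S' = L i \<longrightarrow> rightmost S' = closed_segment (QNstar i) (Q i))) \<and>
      real (\<Sum>j=1..k. nv (S j)) \<le> 8 * real (nv H)"
proof -
  have H: "hole H" and no_right: "\<nexists>e. right_notch H e" and no_top: "\<nexists>e. top_notch H e"
    and falling: "\<exists>\<^sub>\<le>\<^sub>1p. falling_corner H p"
    using bls unfolding BLS_hole_def by blast+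
  have k: "1 \<le> k" and Lk: "\<forall>i\<in>{1..k}. leftmost_edge H (L i)" and Nk: "\<forall>i\<in>{2..k}. left_notch H (N i)"
    using co unfolding canonical_ordering_def by blast+
  obtain vs where vs: "clockwise_vertices H vs" "vs \<noteq> []" "last (edge_list vs) = rightmost H"
    "filter (\<lambda>e. leftmost_edge H e \<or> left_notch H e) (edge_list vs) =
      L 1 # concat (map (\<lambda>i. [N i, L i]) [2..<Suc k])"
    using co unfolding canonical_ordering_def by blast
  interpret W: clockwise_hole H vs using H vs(1,2) by unfold_locales
  let ?R = "\<lambda>e. leftmost_edge H e \<or> left_notch H e"
  let ?C = "concat (map (\<lambda>i. [N i, L i]) [2..<Suc k])"
  have wL: "W.weight (L i) = 1" if "i \<in> {1..k}" for i
    using Lk that W.leftmost_not_left_notch unfolding W.weight_def by auto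
  have wN: "W.weight (N i) = -1" if "i \<in> {2..k}" for i
  proof -
    have "left_notch H (N i)" using Nk that by blast
    moreover from this have "\<not> leftmost_edge H (N i)" using W.leftmost_not_left_notch by blast
    ultimately show ?thesis unfolding W.weight_def by simp
  qed
  \<comment> \<open>Edges of other types have weight 0, and \<open>N i\<close> cancels
    \<open>L i\<close>; only \<open>L 1\<close> is left.\<close>
  have "sum_list (map W.weight (edge_list vs)) = sum_list (map W.weight (filter ?R (edge_list vs)))"
    by (rule sum_list_filter_nonzero[symmetric]) (simp add: W.weight_def)
  also have "\<dots> = W.weight (L 1) + sum_list (map W.weight ?C)" unfolding vs(4) by simp
  also have "sum_list (map W.weight ?C) = 0"
    by (rule sum_list_alternating) (use wL wN in auto)
  also have "W.weight (L 1) = 1" using wL k by simp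
  finally have "sum_list (map W.weight (edge_list vs)) = 1" by simp
  then have ru: "\<exists>!e. rightmost_edge H e" by (rule W.rightmost_edge_unique[OF no_right])
  have in_filter: "e \<in> set (filter ?R (edge_list vs))" if "?R e" for e
  proof -
    have "e \<in> edges H" using that unfolding leftmost_edge_def left_notch_def by blast
    then obtain i where "i < length vs" "e = W.E i" using W.edge_in_list by blast
    then show ?thesis using that unfolding W.edge_list_eq by auto
  qed
  have set_filter: "set (filter ?R (edge_list vs)) = {L 1} \<union> N ` {2..k} \<union> L ` {2..k}"
    unfolding vs(4) by auto
  have all_left: "\<exists>i\<in>{1..k}. e = L i" if e: "leftmost_edge H e" for e
  proof -
    have "e \<notin> N ` {2..k}" using Nk W.leftmost_not_left_notch[OF e] by auto
    then have "e = L 1 \<or> e \<in> L ` {2..k}" using in_filter[of e] e unfolding set_filter by blast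
    then show ?thesis using k by auto
  qed
  have all_notch: "\<exists>i\<in>{2..k}. e = N i" if e: "left_notch H e" for e
  proof -
    have "e \<notin> L ` {1..k}" using Lk W.leftmost_not_left_notch e by auto
    then have "e \<noteq> L 1" "e \<notin> L ` {2..k}" using k by auto
    then show ?thesis using in_filter[of e] e unfolding set_filter by blast
  qed
  have "distinct (filter ?R (edge_list vs))" using W.distinct_edges by (rule distinct_filter)
  then have "distinct ?C" unfolding vs(4) by simp
  then have "inj_on N (set [2..<Suc k])" by (rule distinct_concat_pairs[OF _ distinct_upt])
  moreover have "set [2..<Suc k] = {2..k}" by (simp del: upt_Suc add: atLeastLessThanSuc_atLeastAtMost)
  ultimately have injN: "inj_on N {2..k}" by simp
  have notch: "\<exists>c m. dir_edge H c \<i> m \<and> N i = closed_segment c (c + of_real m * \<i>) \<and> Q i = c + of_real m * \<i> \<and>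
      pat H c = (True,False,True,True) \<and> pat H (Q i) = (True,True,False,True)" if i: "i \<in> {2..k}" for i
  proof -
    have "left_notch H (N i)" using Nk i by blast
    then obtain c m where c: "dir_edge H c \<i> m" "N i = closed_segment c (c + of_real m * \<i>)"
      "pat H c = (True,False,True,True)" "pat H (c + of_real m * \<i>) = (True,True,False,True)"
      unfolding left_notch_iff[OF H] by (elim exE conjE)
    have "Q i = upper_vertex (N i)" using Qs i by blast
    also have "\<dots> = c + of_real m * \<i>" unfolding c(2) by (rule upper_vertex_up_edge[OF dir_edgeD(2)[OF c(1)]])
    finally have "Q i = c + of_real m * \<i>" .
    then show ?thesis using c by (intro exI[of _ c] exI[of _ m]) simp
  qed
  have injQ: "inj_on Q {2..k}"
  proof (rule inj_onI)
    fix i j assume ij: "i \<in> {2..k}" "j \<in> {2..k}" "Q i = Q j"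
    obtain c m where c: "dir_edge H c \<i> m" "N i = closed_segment c (c + of_real m * \<i>)" "Q i = c + of_real m * \<i>"
      using notch[OF ij(1)] by blast
    obtain c' m' where c': "dir_edge H c' \<i> m'" "N j = closed_segment c' (c' + of_real m' * \<i>)" "Q j = c' + of_real m' * \<i>"
      using notch[OF ij(2)] by blast
    \<comment> \<open>Both notches are the one edge of \<open>H\<close> going down from the common
      point.\<close>
    have e: "dir_edge H (Q i) (-\<i>) m" "dir_edge H (Q i) (-\<i>) m'"
      using dir_edge_reverse[OF c(1)] dir_edge_reverse[OF c'(1)] c(3) c'(3) ij(3) by simp_all
    have "m = m'"
      using dir_edge_unique[OF H e, of 0 0] dir_edgeD(2)[OF e(1)] dir_edgeD(2)[OF e(2)] by simp
    then have "N i = N j" using c(2,3) c'(2,3) ij(3) by simp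
    then show "i = j" using inj_onD[OF injN] ij(1,2) by blast
  qed
  have "\<forall>i\<in>{2..k}. \<exists>h>0. Q i + of_real h * \<i> \<in> frontier H \<and> (\<forall>t. 0 < t \<and> t < h \<longrightarrow> Q i + of_real t * \<i> \<in> interior H)"
  proof
    fix i assume i: "i \<in> {2..k}"
    have "pat H (Q i) = (True,True,False,True)" using notch[OF i] by blast
    then obtain h where "h > 0" "Q i + of_real h * \<i> \<in> frontier H"
      "\<forall>t. 0 < t \<and> t < h \<longrightarrow> Q i + of_real t * \<i> \<in> interior H" by (rule ray_up[OF H])
    then show "\<exists>h>0. Q i + of_real h * \<i> \<in> frontier H \<and> (\<forall>t. 0 < t \<and> t < h \<longrightarrow> Q i + of_real t * \<i> \<in> interior H)"
      by blast
  qed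
  from bchoice[OF this] obtain h where h: "\<forall>i\<in>{2..k}. h i > 0 \<and> Q i + of_real (h i) * \<i> \<in> frontier H \<and>
      (\<forall>t. 0 < t \<and> t < h i \<longrightarrow> Q i + of_real t * \<i> \<in> interior H)" by blast
  interpret B: BLS_walk H Q h "{2..k}" vs
  proof unfold_locales
    show "hole H" by (rule H)
    show "finite {2..k}" by simp
    show "inj_on Q {2..k}" by (rule injQ)
    show "pat H (Q i) = (True,True,False,True)" if "i \<in> {2..k}" for i using notch[OF that] by blast
    show "h i > 0" "Q i + of_real (h i) * \<i> \<in> frontier H" if "i \<in> {2..k}" for i using h that by blast+
    show "Q i + of_real t * \<i> \<in> interior H" if "i \<in> {2..k}" "0 < t" "t < h i" for i t using h that by blast
    show "\<nexists>e. right_notch H e" by (rule no_right)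
    show "\<nexists>e. top_notch H e" by (rule no_top)
    show "\<exists>c m. dir_edge H c \<i> m \<and> Q i = c + of_real m * \<i> \<and> pat H c = (True,False,True,True)"
      if "i \<in> {2..k}" for i using notch[OF that] by blast
    show "c + of_real m * \<i> \<in> Q ` {2..k}"
      if c: "left_notch H (closed_segment c (c + of_real m * \<i>))" "dir_edge H c \<i> m" for c m
    proof -
      obtain i where i: "i \<in> {2..k}" "closed_segment c (c + of_real m * \<i>) = N i" using all_notch[OF c(1)] by blast
      have "Q i = upper_vertex (N i)" using Qs i(1) by blast
      also have "\<dots> = c + of_real m * \<i>"
        unfolding i(2)[symmetric] by (rule upper_vertex_up_edge[OF dir_edgeD(2)[OF c(2)]])
      finally have "Q i = c + of_real m * \<i>" .
      then show ?thesis using imageI[OF i(1), of Q] by simp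
    qed
    show "\<exists>b. clockwise_edge H v b" if v: "v \<in> vertices H" for v
    proof -
      have "v \<in> set vs" using v vs(1) unfolding clockwise_vertices_def by simp
      then obtain i where "i < length vs" "v = vs ! i" by (metis in_set_conv_nth)
      then have "v = W.v i" by (simp add: W.v_def)
      then show ?thesis using W.clockwise_step by blast
    qed
    show "\<exists>\<^sub>\<le>\<^sub>1p. falling_corner H p" by (rule falling)
    show "\<exists>!e. rightmost_edge H e" by (rule ru)
  qed
  have top: "B.top i = QN i" if "i \<in> {2..k}" for i using B.first_above_eq[OF that] Qs that by simp
  have "(\<lambda>i. closed_segment (Q i) (QN i)) ` {2..k} = B.cut ` {2..k}"
    by (intro image_cong refl) (simp add: B.cut_def top)
  then have PB: "P = B.P" unfolding Peq B.P_def by simp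
  have ins: "insert 1 {2..k} = {1..k}" using k by auto
  obtain T where T: "bij_betw T (insert 1 {2..k}) B.P" "\<forall>i\<in>{2..k}. quad (T i) (Q i) \<i>"
    "rightmost_edge H (rightmost H)" "rightmost H \<subseteq> T 1" "rightmost (T 1) = rightmost H"
    "\<forall>i\<in>{2..k}. rightmost (T i) = closed_segment (first_above_star H (Q i)) (Q i)"
    by (rule B.labelling) auto
  have TP: "T i \<in> B.P" if "i \<in> {1..k}" for i using T(1) that unfolding ins by (auto simp: bij_betw_def)
  have Tinj: "i = j" if "i \<in> {1..k}" "j \<in> {1..k}" "T i = T j" for i j
    using T(1) that unfolding ins bij_betw_def by (blast dest: inj_onD)
  have Tsurj: "\<exists>j\<in>{1..k}. S' = T j" if "S' \<in> B.P" for S'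
    using T(1) that unfolding ins bij_betw_def by blast
  have LT1: "L 1 \<subseteq> T 1"
  proof -
    obtain a where a: "a < length (edge_list vs)" "edge_list vs ! a = L 1" "\<forall>m<a. \<not> ?R (edge_list vs ! m)"
      by (rule filter_first[OF vs(4)])
    have al: "a < length vs" using a(1) by (simp add: W.edge_list_eq)
    have Ea: "W.E a = L 1" using a(2) al by (simp add: W.edge_list_eq)
    have Em: "\<not> leftmost_edge H (W.E m)" if "m < a" for m
      using a(3) that al by (simp add: W.edge_list_eq)
    \<comment> \<open>\<open>R(H)\<close> is the last listed edge and has index \<open>s\<close>; a
      full period later the walk starts at the first listed edge, so \<open>W.E (s + Suc j)\<close>
      is \<open>W.E j\<close>.\<close>
    define s where "s = length vs - 1"
    have s: "Suc s = length vs" using vs(2) by (simp add: s_def)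
    have "W.E s = rightmost H" using vs(2,3) s unfolding W.edge_list_eq by (simp add: last_map s_def)
    then have R: "rightmost_edge H (W.E s)" "W.E s \<subseteq> T 1" using T(3,4) by simp_all
    have start: "W.dir (Suc s) = -1" using W.rightmost_dirs[OF R(1)] by blast
    have shift: "W.E (s + Suc j) = W.E j" for j using W.E_periodic[of j] unfolding s[symmetric] by (simp add: add.commute)
    have none: "\<forall>m. s < m \<and> m < s + Suc a \<longrightarrow> \<not> leftmost_edge H (W.E m)"
    proof (intro allI impI)
      fix m assume m: "s < m \<and> m < s + Suc a"
      then have "m = s + Suc (m - Suc s)" "m - Suc s < a" by auto
      then show "\<not> leftmost_edge H (W.E m)" using Em shift by metis
    qed
    have left: "leftmost_edge H (W.E (s + Suc a))" unfolding shift Ea using Lk k by simp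
    have T1P: "T 1 \<in> B.P" using TP k by simp
    have vs_E: "W.v (Suc s) \<in> W.E s" by (simp add: W.E_def)
    \<comment> \<open>The end of \<open>R(H)\<close> is off the cuts, so \<open>T 1\<close> inherits
      the leftward germ of \<open>H\<close> there.\<close>
    have "pat (T 1) (W.v (Suc s)) = pat H (W.v (Suc s))"
      by (rule B.boundary_point_pat(1)[OF T1P _ W.v_frontier])
         (use vs_E R(2) B.rightmost_edge_off_cuts[OF R(1)] in auto)
    moreover have "germ H (W.v (Suc s)) (-1)"
      using dir_edge_germs(3)[OF H W.step(1)[of "Suc s"]] start by simp
    ultimately have "germ (T 1) (W.v (Suc s)) (-1)" by (simp add: pat_germs)
    from B.walk_from_germ[OF start none left T1P this] show ?thesis unfolding shift Ea .
  qed
  have LT: "L i \<subseteq> T i" if i: "i \<in> {1..k}" for i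
  proof (cases "i = 1")
    case True then show ?thesis using LT1 by simp
  next
    case False
    then have i2: "i \<in> {2..k}" using i by auto
    \<comment> \<open>Splitting the index range at \<open>i\<close> exhibits \<open>N i\<close> and
      \<open>L i\<close> as neighbours in the filtered list.\<close>
    have "[2..<Suc k] = [2..<i] @ i # [Suc i..<Suc k]"
      using i2 upt_add_eq_append[of 2 i "Suc k - i"] upt_conv_Cons[of i "Suc k"] by auto
    then have "filter ?R (edge_list vs) =
      (L 1 # concat (map (\<lambda>i. [N i, L i]) [2..<i])) @ [N i, L i] @ concat (map (\<lambda>i. [N i, L i]) [Suc i..<Suc k])"
      unfolding vs(4) by simp
    then obtain a b where ab: "a < b" "b < length (edge_list vs)" "edge_list vs ! a = N i" "edge_list vs ! b = L i"
      "\<forall>m. a < m \<and> m < b \<longrightarrow> \<not> ?R (edge_list vs ! m)" by (rule filter_adjacent)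
    have bl: "b < length vs" using ab(2) by (simp add: W.edge_list_eq)
    have Ea: "W.E a = N i" "W.E b = L i" using ab(1,3,4) bl by (simp_all add: W.edge_list_eq)
    have Em: "\<not> leftmost_edge H (W.E m)" if "a < m" "m < b" for m
      using ab(5) that bl by (simp add: W.edge_list_eq)
    have n: "left_notch H (W.E a)" using Nk i2 Ea by simp
    have d: "W.dir a = \<i>" "W.dir (Suc a) = -1" using W.left_notch_dirs[OF n] by simp_all
    define J where "J = b - Suc a"
    have J: "a + Suc J = b" using ab(1) by (simp add: J_def)
    have none: "\<forall>m. a < m \<and> m < a + Suc J \<longrightarrow> \<not> leftmost_edge H (W.E m)" unfolding J using Em by blast
    have left: "leftmost_edge H (W.E (a + Suc J))" unfolding J Ea using Lk i by blast
    have "upper_vertex (W.E a) = W.v (Suc a)"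
      unfolding W.E_eq d(1) W.step(2)[of a] by (rule upper_vertex_up_edge[OF W.len_pos])
    then have Qv: "W.v (Suc a) = Q i" using Qs i2 Ea(1) by simp
    \<comment> \<open>Owning NW at \<open>Q i\<close> leaves \<open>T i\<close> a single pattern,
      and its leftward germ starts the walk from the upper vertex of \<open>N i\<close>.\<close>
    have "pat (T i) (Q i) = (False,True,False,False)"
      using B.pat_at_Q[OF TP[OF i] i2] T(2) i2 by (auto simp: pat_def)
    then have "germ (T i) (W.v (Suc a)) (-1)" unfolding Qv by (simp add: pat_germs)
    from B.walk_from_germ[OF d(2) none left TP[OF i] this] show ?thesis unfolding J Ea .
  qed
  have Luniq: "i = j" if "i \<in> {1..k}" "j \<in> {1..k}" "L i \<subseteq> T j" for i j
    using B.leftmost_edge_piece_unique[of "L i" "T i" "T j"] Lk that TP LT Tinj by blast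
  have lmT: "leftmost (T j) = L j" if j: "j \<in> {1..k}" for j
    unfolding leftmost_def
  proof (rule the_equality)
    show "leftmost_edge (T j) (L j)" using B.leftmost_edge_in_piece TP LT Lk j by blast
    fix e assume e: "leftmost_edge (T j) e"
    have e': "leftmost_edge H e" "e \<subseteq> T j" using B.piece_leftmost_edge[OF TP[OF j] e] by blast+
    then obtain i where i: "i \<in> {1..k}" "e = L i" using all_left by blast
    then have "i = j" using Luniq j e'(2) by blast
    then show "e = L j" using i(2) by simp
  qed
  have L_inj: "i = j" if "i \<in> {1..k}" "j \<in> {1..k}" "L i = L j" for i j
    using Luniq[OF that(1,2)] LT[OF that(2)] that(3) by simp
  show ?thesis unfolding PB
  proof (intro exI[of _ T] conjI)
    show "bij_betw T {1..k} B.P" using T(1) unfolding ins .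
    show "\<forall>j\<in>{1..k}. nice_hole (T j)" using B.piece_nice TP by blast
    have "T ` {1..k} = B.P" using T(1) unfolding ins bij_betw_def by blast
    then show "(\<Union>j\<in>{1..k}. T j) = H" using B.Union_P by simp
    show "\<forall>j\<in>{1..k}. \<forall>j'\<in>{1..k}. j \<noteq> j' \<longrightarrow> interior (T j) \<inter> interior (T j') = {}"
    proof (intro ballI impI, rule ccontr)
      fix j j' assume j: "j \<in> {1..k}" "j' \<in> {1..k}" "j \<noteq> j'" "interior (T j) \<inter> interior (T j') \<noteq> {}"
      then obtain z where "z \<in> interior (T j)" "z \<in> interior (T j')" by blast
      then have "T j = T j'" by (rule B.pieces_disjoint[OF TP[OF j(1)] TP[OF j(2)]])
      then show False using Tinj j by blast
    qed
    show "\<forall>i\<in>{1..k}. \<exists>!S'. S' \<in> B.P \<and> L i \<subseteq> S'"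
    proof
      fix i assume i: "i \<in> {1..k}"
      show "\<exists>!S'. S' \<in> B.P \<and> L i \<subseteq> S'"
      proof (rule ex1I[of _ "T i"])
        show "T i \<in> B.P \<and> L i \<subseteq> T i" using TP LT i by blast
        fix S' assume "S' \<in> B.P \<and> L i \<subseteq> S'"
        then show "S' = T i" using B.leftmost_edge_piece_unique[of "L i" S' "T i"] Lk TP LT i by blast
      qed
    qed
    show "\<forall>S'\<in>B.P. \<exists>!e. leftmost_edge H e \<and> e \<subseteq> S'"
    proof
      fix S' assume "S' \<in> B.P"
      then obtain j where j: "j \<in> {1..k}" "S' = T j" using Tsurj by blast
      show "\<exists>!e. leftmost_edge H e \<and> e \<subseteq> S'" unfolding j(2)
      proof (rule ex1I[of _ "L j"])
        show "leftmost_edge H (L j) \<and> L j \<subseteq> T j" using Lk LT j by blast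
        fix e assume e: "leftmost_edge H e \<and> e \<subseteq> T j"
        then obtain i where i: "i \<in> {1..k}" "e = L i" using all_left by blast
        then have "i = j" using Luniq j(1) e by blast
        then show "e = L j" using i(2) by simp
      qed
    qed
    show "\<forall>S'\<in>B.P. leftmost S' \<in> L ` {1..k} \<and>
         (leftmost S' = L 1 \<longrightarrow> rightmost S' = rightmost H) \<and>
         (\<forall>i\<in>{2..k}. leftmost S' = L i \<longrightarrow> rightmost S' = closed_segment (QNstar i) (Q i))"
    proof
      fix S' assume "S' \<in> B.P"
      then obtain j where j: "j \<in> {1..k}" "S' = T j" using Tsurj by blast
      have 1: "leftmost S' = L j" using lmT j by simp
      have "rightmost S' = rightmost H" if "leftmost S' = L 1"
      proof -
        have "j = 1" using L_inj[OF j(1), of 1] k 1 that by simp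
        then show ?thesis using j(2) T(5) by simp
      qed
      moreover have "rightmost S' = closed_segment (QNstar i) (Q i)" if i: "i \<in> {2..k}" "leftmost S' = L i" for i
      proof -
        have "i \<in> {1..k}" using i(1) by auto
        then have "j = i" using L_inj[OF j(1)] 1 i(2) by simp
        then show ?thesis using j(2) T(6) i(1) Qs by simp
      qed
      ultimately show "leftmost S' \<in> L ` {1..k} \<and>
         (leftmost S' = L 1 \<longrightarrow> rightmost S' = rightmost H) \<and>
         (\<forall>i\<in>{2..k}. leftmost S' = L i \<longrightarrow> rightmost S' = closed_segment (QNstar i) (Q i))"
        using 1 j(1) by blast
    qed
    have fin: "finite (vertices H)" using vs(1) unfolding clockwise_vertices_def by (metis finite_set)
    have "(\<Sum>j=1..k. nv (T j)) = (\<Sum>S\<in>B.P. nv S)"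
      using T(1) unfolding ins by (rule sum.reindex_bij_betw)
    also have "\<dots> \<le> 8 * nv H" by (rule B.sum_nv_pieces[OF fin])
    finally have "(\<Sum>j=1..k. nv (T j)) \<le> 8 * nv H" .
    then have "real (\<Sum>j=1..k. nv (T j)) \<le> real (8 * nv H)" by (rule of_nat_mono)
    then show "real (\<Sum>j=1..k. nv (T j)) \<le> 8 * real (nv H)" by simp
  qed
qed

theorem mainTheorem10:
  shows "\<exists>C::real. \<forall>H k L N Q QN QNstar P.
    BLS_hole H \<and> canonical_ordering H k L N \<and>
    (\<forall>i\<in>{2..k}. Q i = upper_vertex (N i) \<and>
                QN i = first_above H (Q i) \<and>
                QNstar i = first_above_star H (Q i)) \<and>
    P = pieces H ((\<lambda>i. closed_segment (Q i) (QN i)) ` {2..k}) \<longrightarrow>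
    (\<exists>S :: nat \<Rightarrow> complex set.
      bij_betw S {1..k} P \<and>
      (\<forall>j\<in>{1..k}. nice_hole (S j)) \<and>
      (\<Union>j\<in>{1..k}. S j) = H \<and>
      (\<forall>j\<in>{1..k}. \<forall>j'\<in>{1..k}. j \<noteq> j' \<longrightarrow> interior (S j) \<inter> interior (S j') = {}) \<and>
      (\<forall>i\<in>{1..k}. \<exists>!S'. S' \<in> P \<and> L i \<subseteq> S') \<and>
      (\<forall>S'\<in>P. \<exists>!e. leftmost_edge H e \<and> e \<subseteq> S') \<and>
      (\<forall>S'\<in>P. leftmost S' \<in> L ` {1..k} \<and>
         (leftmost S' = L 1 \<longrightarrow> rightmost S' = rightmost H) \<and>
         (\<forall>i\<in>{2..k}. leftmost S' = L i \<longrightarrow> rightmost S' = closed_segment (QNstar i) (Q i))) \<and>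
      real (\<Sum>j=1..k. nv (S j)) \<le> C * real (nv H))"
  by (intro exI[of _ 8] allI impI, elim conjE) (rule BLS_partition)

end
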